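(* Let $X$ be a graph with a free action of an amenable group $\Gamma$ with finite fundamental domain, let $\sigma$ be a weakly $\Gamma$-invariant weight function on $X$ with discrete magnetic Laplacian $\Delta_\sigma$, and let $\{X_m\}_{m\ge1}$ be the regular exhaustion of $X$ corresponding to a regular exhaustion $\{\Lambda_m\}_{m\ge 1}$ of $\Gamma$. Let $N_m=\#\Lambda_m$, let $E_m(\lambda)$ be the number of eigenvalues (counted with multiplicity) less than or equal to $\lambda$ of the restricted operator $\Delta_\sigma^{(m)}$ on $X_m$, with either Dirichlet or Neumann boundary conditions, and let $F$ be the spectral density function of $\Delta_\sigma$. Then $$\lim_{m\to\infty}\frac{E_m(\lambda)}{N_m}=F(\lambda)$$ at every point $\lambda\in\mathbb{R}$ of continuity of $F$. In particular, this equality holds for all but possibly a countable set of $\lambda$.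
   Context: Graphs and group action. $X$ is a combinatorial graph with vertex set $\mathrm{Vert}\,X$ and set $\mathrm{Edge}\,X$ of oriented edges; each unoriented edge gives two oriented edges $e,\overline e$, and $\mathfrak{o}(e),\mathfrak{t}(e)$ are the origin and terminus of $e$. $E^+\subset \mathrm{Edge}\,X$ contains exactly one orientation of each unoriented edge. $\mathcal{O}(v)$ is the valence of $v$ (the number of oriented edges with terminus $v$). $\Gamma$ is a finitely generated amenable discrete group acting on $X$ by graph automorphisms, freely (i.e. freely on the geometric realization), with finitely many orbits of vertices and edges. $\mathcal{F}$ is a fundamental domain: a finite set of vertices and unoriented edges containing exactly one element of each $\Gamma$-orbit. Weight function and DML. A weight function is $\sigma:\mathrm{Edge}\,X\to U(1)$ with $\sigma(\overline e)=\sigma(e)^{-1}$. It is weakly $\Gamma$-invariant if for each $\gamma\in\Gamma$ there is $s_\gamma:\mathrm{Vert}\,X\to U(1)$ with $\sigma(\gamma e)=\sigma(e)s_\gamma(\mathfrak{t}(e))\overline{s_\gamma(\mathfrak{o}(e))}$ for all $e$. The discrete magnetic Laplacian (DML) is the bounded self-adjoint operator on $\ell^2(\mathrm{Vert}\,X)$ $$(\Delta_\sigma f)(v)=\mathcal{O}(v)f(v)-\sum_{e\in E^+,\,\mathfrak{t}(e)=v}\sigma(e)f(\mathfrak{o}(e))-\sum_{e\in E^+,\,\mathfrak{o}(e)=v}\overline{\sigma(e)}f(\mathfrak{t}(e)).$$ Trace and spectral density. For a bounded operator $A$ commuting with all magnetic translations $(T_\gamma f)(x)=s_\gamma(\gamma^{-1}x)f(\gamma^{-1}x)$,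 $\gamma\in\Gamma$ (for instance any bounded Borel function of $\Delta_\sigma$), the von Neumann trace is $\mathrm{Tr}_{\Gamma,\sigma}(A)=\sum_{v\in\mathcal{F}\cap \mathrm{Vert}\,X}\langle A\delta_v,\delta_v\rangle$. The spectral density function of $\Delta_\sigma$ is $F(\lambda)=\mathrm{Tr}_{\Gamma,\sigma}(\chi_{(-\infty,\lambda]}(\Delta_\sigma))$. Regular exhaustions. A regular exhaustion of $\Gamma$ is an increasing sequence of nonempty finite subsets $\Lambda_m\subset\Lambda_{m+1}$ with $\bigcup_m\Lambda_m=\Gamma$ such that for every $\delta>0$, $\lim_m \#\partial_\delta\Lambda_m/\#\Lambda_m=0$, where $\partial_\delta\Lambda_m=\{\gamma\in\Gamma: d_1(\gamma,\Lambda_m)<\delta,\ d_1(\gamma,\Gamma\setminus\Lambda_m)<\delta\}$ and $d_1$ is the word metric for a finite generating set. The corresponding regular exhaustion of $X$ consists of $X_m$, the largest subgraph of $X$ contained in $\bigcup_{\gamma\in\Lambda_m}\gamma\mathcal{F}$. Restricted DML. $\Delta_\sigma^{(m)}$ is the self-adjoint operator on functions on $\mathrm{Vert}\,X_m$ given by: (Dirichlet) $P_m\Delta_\sigma P_m$, where $P_m$ is the orthogonal projection onto functions supported on $\mathrm{Vert}\,X_m$; or (Neumann) the DML of the finite graph $X_m$ itself with weight $\sigma|_{X_m}$, i.e. $(\Delta_\sigma^{(m)}f)(v)=\mathcal{O}_m(v)f(v)-\sum_{e\in E^+\cap\mathrm{Edge}\,X_m,\,\mathfrak{t}(e)=v}\sigma(e)f(\mathfrak{o}(e))-\sum_{e\in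 E^+\cap\mathrm{Edge}\,X_m,\,\mathfrak{o}(e)=v}\overline{\sigma(e)}f(\mathfrak{t}(e))$ for $v\in\mathrm{Vert}\,X_m$, where $\mathcal{O}_m(v)$ is the valence of $v$ in $X_m$. *)

theory Defs
  imports
    "HOL-Analysis.Analysis"
    "HOL-Algebra.Group_Action"
    "HOL-Algebra.Generated_Groups"
    "HOL-Library.Function_Algebras"
    "Graph_Theory.Bidirected_Digraph"
    "Graph_Theory.Digraph_Component"
begin

section \<open>Amenable groups, word metric, regular exhaustions\<close>

text \<open>Amenability: there is a left-invariant finitely additive probability measure on all subsets.\<close>

definition amenable_group :: "('g, 'm) monoid_scheme \<Rightarrow> bool" where
  "amenable_group G \<longleftrightarrow> group G \<and>
     (\<exists>\<mu> :: 'g set \<Rightarrow> real.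
        (\<forall>A. A \<subseteq> carrier G \<longrightarrow> 0 \<le> \<mu> A) \<and>
        \<mu> (carrier G) = 1 \<and>
        (\<forall>A B. A \<subseteq> carrier G \<and> B \<subseteq> carrier G \<and> A \<inter> B = {} \<longrightarrow> \<mu> (A \<union> B) = \<mu> A + \<mu> B) \<and>
        (\<forall>g\<in>carrier G. \<forall>A. A \<subseteq> carrier G \<longrightarrow> \<mu> (g <#\<^bsub>G\<^esub> A) = \<mu> A))"

definition word_length :: "('g, 'm) monoid_scheme \<Rightarrow> 'g set \<Rightarrow> 'g \<Rightarrow> nat" where
  "word_length G S g =
     (LEAST n. \<exists>ws. length ws = n \<and> set ws \<subseteq> S \<union> (\<lambda>s. inv\<^bsub>G\<^esub> s) ` S \<and>
                    foldr (\<lambda>x y. x \<otimes>\<^bsub>G\<^esub> y) ws \<one>\<^bsub>G\<^esub> = g)"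

text \<open>
  The word metric is the left-invariant one (the path metric of the right Cayley graph). For a
  left action, adjacent translates \<open>g F\<close>, \<open>h F\<close> of a finite set \<open>F\<close> are at bounded distance for it.
\<close>

definition word_dist :: "('g, 'm) monoid_scheme \<Rightarrow> 'g set \<Rightarrow> 'g \<Rightarrow> 'g \<Rightarrow> nat" where
  "word_dist G S g h = word_length G S (inv\<^bsub>G\<^esub> g \<otimes>\<^bsub>G\<^esub> h)"

text \<open>Extended reals make the distance to the empty set infinite (relevant when \<open>G\<close> is finite).\<close>

definition word_setdist :: "('g, 'm) monoid_scheme \<Rightarrow> 'g set \<Rightarrow> 'g \<Rightarrow> 'g set \<Rightarrow> ereal" where
  "word_setdist G S g A = (INF h\<in>A. ereal (real (word_dist G S g h)))"

definition word_boundary :: "('g, 'm) monoid_scheme \<Rightarrow> 'g set \<Rightarrow> real \<Rightarrow> 'g set \<Rightarrow> 'g set" where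
  "word_boundary G S \<delta> A =
     {g \<in> carrier G. word_setdist G S g A < ereal \<delta> \<and> word_setdist G S g (carrier G - A) < ereal \<delta>}"

definition regular_exhaustion ::
    "('g, 'm) monoid_scheme \<Rightarrow> 'g set \<Rightarrow> (nat \<Rightarrow> 'g set) \<Rightarrow> bool" where
  "regular_exhaustion G S \<Lambda> \<longleftrightarrow>
     (\<forall>m. finite (\<Lambda> m) \<and> \<Lambda> m \<noteq> {} \<and> \<Lambda> m \<subseteq> \<Lambda> (Suc m)) \<and>
     (\<Union>m. \<Lambda> m) = carrier G \<and>
     (\<forall>\<delta>>0. (\<lambda>m. real (card (word_boundary G S \<delta> (\<Lambda> m))) / real (card (\<Lambda> m))) \<longlonglongrightarrow> 0)"


section \<open>Graphs with a free group action\<close>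

text \<open>
  Graphs are bidirected digraphs \<open>(X, rv)\<close>: \<open>arcs X\<close> are the oriented edges, \<open>rv\<close> is the
  fixed-point free reversal on them (extended by the identity), \<open>tail X\<close> is the origin and \<open>head X\<close> the terminus.
  The valence of \<open>v\<close> is \<open>in_degree X v\<close>.
\<close>

definition unoriented_edges :: "('v, 'e) pre_digraph \<Rightarrow> ('e \<Rightarrow> 'e) \<Rightarrow> 'e set set" where
  "unoriented_edges X rv = (\<lambda>e. {e, rv e}) ` arcs X"

definition edge_orientation :: "('v, 'e) pre_digraph \<Rightarrow> ('e \<Rightarrow> 'e) \<Rightarrow> 'e set \<Rightarrow> bool" where
  "edge_orientation X rv Ep \<longleftrightarrow>
     Ep \<subseteq> arcs X \<and> (\<forall>u\<in>unoriented_edges X rv. \<exists>!e. e \<in> u \<and> e \<in> Ep)"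

definition graph_action ::
    "('g, 'm) monoid_scheme \<Rightarrow> ('v, 'e) pre_digraph \<Rightarrow> ('e \<Rightarrow> 'e) \<Rightarrow>
     ('g \<Rightarrow> 'v \<Rightarrow> 'v) \<Rightarrow> ('g \<Rightarrow> 'e \<Rightarrow> 'e) \<Rightarrow> bool" where
  "graph_action G X rv \<phi> \<psi> \<longleftrightarrow>
     group_action G (verts X) \<phi> \<and> group_action G (arcs X) \<psi> \<and>
     (\<forall>g\<in>carrier G. \<forall>e\<in>arcs X.
        tail X (\<psi> g e) = \<phi> g (tail X e) \<and> head X (\<psi> g e) = \<phi> g (head X e) \<and>
        \<psi> g (rv e) = rv (\<psi> g e))"

text \<open>
  Freeness on the geometric realization; \<open>\<psi> g e \<noteq> rv e\<close> says that no midpoint of an edge is fixed.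
\<close>

definition free_graph_action ::
    "('g, 'm) monoid_scheme \<Rightarrow> ('v, 'e) pre_digraph \<Rightarrow> ('e \<Rightarrow> 'e) \<Rightarrow>
     ('g \<Rightarrow> 'v \<Rightarrow> 'v) \<Rightarrow> ('g \<Rightarrow> 'e \<Rightarrow> 'e) \<Rightarrow> bool" where
  "free_graph_action G X rv \<phi> \<psi> \<longleftrightarrow>
     graph_action G X rv \<phi> \<psi> \<and>
     (\<forall>g\<in>carrier G. g \<noteq> \<one>\<^bsub>G\<^esub> \<longrightarrow>
        (\<forall>v\<in>verts X. \<phi> g v \<noteq> v) \<and> (\<forall>e\<in>arcs X. \<psi> g e \<noteq> e \<and> \<psi> g e \<noteq> rv e))"

text \<open>A fundamental domain consists of its vertices \<open>FV\<close> and its unoriented edges \<open>FE\<close>.\<close>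

definition fundamental_domain ::
    "('g, 'm) monoid_scheme \<Rightarrow> ('v, 'e) pre_digraph \<Rightarrow> ('e \<Rightarrow> 'e) \<Rightarrow>
     ('g \<Rightarrow> 'v \<Rightarrow> 'v) \<Rightarrow> ('g \<Rightarrow> 'e \<Rightarrow> 'e) \<Rightarrow> 'v set \<Rightarrow> 'e set set \<Rightarrow> bool" where
  "fundamental_domain G X rv \<phi> \<psi> FV FE \<longleftrightarrow>
     finite FV \<and> FV \<subseteq> verts X \<and> finite FE \<and> FE \<subseteq> unoriented_edges X rv \<and>
     (\<forall>v\<in>verts X. \<exists>!w. w \<in> FV \<and> w \<in> Group_Action.orbit G \<phi> v) \<and>
     (\<forall>u\<in>unoriented_edges X rv. \<exists>!w. w \<in> FE \<and> w \<in> Group_Action.orbit G (\<lambda>g. (`) (\<psi> g)) u)"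

text \<open>
  The largest subgraph contained in \<open>\<Union>g\<in>L. g F\<close>: translates of \<open>F\<close> need not be subgraphs, so
  edges with an endpoint outside the union are dropped.
\<close>

definition exhaustion_subgraph ::
    "('v, 'e) pre_digraph \<Rightarrow> ('e \<Rightarrow> 'e) \<Rightarrow> ('g \<Rightarrow> 'v \<Rightarrow> 'v) \<Rightarrow> ('g \<Rightarrow> 'e \<Rightarrow> 'e) \<Rightarrow>
     'v set \<Rightarrow> 'e set set \<Rightarrow> 'g set \<Rightarrow> ('v, 'e) pre_digraph" where
  "exhaustion_subgraph X rv \<phi> \<psi> FV FE L =
     (let VL = (\<Union>g\<in>L. \<phi> g ` FV); EL = (\<Union>g\<in>L. (\<lambda>u. \<psi> g ` u) ` FE)
      in \<lparr> verts = VL,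
           arcs = {e \<in> arcs X. {e, rv e} \<in> EL \<and> tail X e \<in> VL \<and> head X e \<in> VL},
           tail = tail X, head = head X \<rparr>)"

lemma exhaustion_subgraph_largest:
  assumes "bidirected_digraph X rv" "graph_action G X rv \<phi> \<psi>"
    and "fundamental_domain G X rv \<phi> \<psi> FV FE" "L \<subseteq> carrier G"
  defines "Y \<equiv> exhaustion_subgraph X rv \<phi> \<psi> FV FE L"
  shows "subgraph Y X"
    and "e \<in> arcs Y \<Longrightarrow> rv e \<in> arcs Y"
    and "\<lbrakk> subgraph Z X; verts Z \<subseteq> (\<Union>g\<in>L. \<phi> g ` FV);
           \<forall>e\<in>arcs Z. {e, rv e} \<in> (\<Union>g\<in>L. (\<lambda>u. \<psi> g ` u) ` FE) \<rbrakk>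
         \<Longrightarrow> subgraph Z Y"
proof -
  interpret bidirected_digraph X rv by fact
  have V: "\<phi> g ` verts X = verts X" if "g \<in> L" for g
    using assms(2,4) that group_action.surj_prop[of G "verts X" \<phi> g]
    unfolding graph_action_def by auto
  have FV: "FV \<subseteq> verts X"
    using assms(3) unfolding fundamental_domain_def by auto
  have sub: "verts Y \<subseteq> verts X"
    using V FV unfolding Y_def exhaustion_subgraph_def Let_def by fastforce
  have wfY: "wf_digraph Y"
    unfolding wf_digraph_def Y_def exhaustion_subgraph_def Let_def by auto
  show 1: "subgraph Y X"
    using sub wfY wf_digraph_axioms
    unfolding subgraph_def compatible_def
    by (auto simp: Y_def exhaustion_subgraph_def Let_def)
  show "rv e \<in> arcs Y" if "e \<in> arcs Y"
    using that unfolding Y_def exhaustion_subgraph_def Let_def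
    by (auto simp: insert_commute)
  show "subgraph Z Y"
    if Z: "subgraph Z X" "verts Z \<subseteq> (\<Union>g\<in>L. \<phi> g ` FV)"
      "\<forall>e\<in>arcs Z. {e, rv e} \<in> (\<Union>g\<in>L. (\<lambda>u. \<psi> g ` u) ` FE)"
  proof -
    have wfZ: "wf_digraph Z" and c: "tail Z = tail X" "head Z = head X" and a: "arcs Z \<subseteq> arcs X"
      using Z(1) unfolding subgraph_def compatible_def by auto
    have "arcs Z \<subseteq> arcs Y"
    proof
      fix e assume e: "e \<in> arcs Z"
      have "tail X e \<in> verts Z" "head X e \<in> verts Z"
        using wf_digraph.tail_in_verts[OF wfZ e] wf_digraph.head_in_verts[OF wfZ e] c by auto
      hence "tail X e \<in> (\<Union>g\<in>L. \<phi> g ` FV)" "head X e \<in> (\<Union>g\<in>L. \<phi> g ` FV)"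
        using Z(2) by (blast dest: subsetD)+
      thus "e \<in> arcs Y"
        using e a Z(3) unfolding Y_def exhaustion_subgraph_def Let_def by auto
    qed
    moreover have "verts Z \<subseteq> verts Y"
      using Z(2) unfolding Y_def exhaustion_subgraph_def Let_def by simp
    ultimately show ?thesis
      using wfZ wfY c unfolding subgraph_def compatible_def
      by (simp add: Y_def exhaustion_subgraph_def Let_def)
  qed
qed


section \<open>Weight functions and discrete magnetic Laplacians\<close>

definition weight_function ::
    "('v, 'e) pre_digraph \<Rightarrow> ('e \<Rightarrow> 'e) \<Rightarrow> ('e \<Rightarrow> complex) \<Rightarrow> bool" where
  "weight_function X rv \<sigma> \<longleftrightarrow>
     (\<forall>e\<in>arcs X. cmod (\<sigma> e) = 1 \<and> \<sigma> (rv e) = inverse (\<sigma> e))"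

definition weakly_invariant ::
    "('g, 'm) monoid_scheme \<Rightarrow> ('v, 'e) pre_digraph \<Rightarrow> ('g \<Rightarrow> 'e \<Rightarrow> 'e) \<Rightarrow> ('e \<Rightarrow> complex) \<Rightarrow> bool" where
  "weakly_invariant G X \<psi> \<sigma> \<longleftrightarrow>
     (\<forall>g\<in>carrier G. \<exists>s :: 'v \<Rightarrow> complex.
        (\<forall>v\<in>verts X. cmod (s v) = 1) \<and>
        (\<forall>e\<in>arcs X. \<sigma> (\<psi> g e) = \<sigma> e * s (head X e) * cnj (s (tail X e))))"

text \<open>
  Functions on a vertex set \<open>V\<close> are represented by functions on the vertex type vanishing
  outside \<open>V\<close>.
\<close>

definition dml :: "('v, 'e) pre_digraph \<Rightarrow> 'e set \<Rightarrow> ('e \<Rightarrow> complex) \<Rightarrow>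
    ('v \<Rightarrow> complex) \<Rightarrow> ('v \<Rightarrow> complex)" where
  "dml X Ep \<sigma> f = (\<lambda>v. if v \<in> verts X then
       of_nat (in_degree X v) * f v
       - (\<Sum>e | e \<in> Ep \<and> head X e = v. \<sigma> e * f (tail X e))
       - (\<Sum>e | e \<in> Ep \<and> tail X e = v. cnj (\<sigma> e) * f (head X e))
     else 0)"

definition restrict_proj :: "'v set \<Rightarrow> ('v \<Rightarrow> complex) \<Rightarrow> ('v \<Rightarrow> complex)" where
  "restrict_proj W f = (\<lambda>v. if v \<in> W then f v else 0)"

datatype boundary_condition = Dirichlet | Neumann

definition restricted_dml :: "boundary_condition \<Rightarrow> ('v, 'e) pre_digraph \<Rightarrow> 'e set \<Rightarrow>
    ('e \<Rightarrow> complex) \<Rightarrow> ('v, 'e) pre_digraph \<Rightarrow> ('v \<Rightarrow> complex) \<Rightarrow> ('v \<Rightarrow> complex)" where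
  "restricted_dml bc X Ep \<sigma> Y =
     (case bc of
        Dirichlet \<Rightarrow> restrict_proj (verts Y) \<circ> dml X Ep \<sigma> \<circ> restrict_proj (verts Y)
      | Neumann \<Rightarrow> dml Y (Ep \<inter> arcs Y) \<sigma>)"

definition eigenspace :: "'v set \<Rightarrow> (('v \<Rightarrow> complex) \<Rightarrow> ('v \<Rightarrow> complex)) \<Rightarrow> real \<Rightarrow>
    ('v \<Rightarrow> complex) set" where
  "eigenspace W T \<mu> =
     {f. (\<forall>v. v \<notin> W \<longrightarrow> f v = 0) \<and> T f = (\<lambda>v. complex_of_real \<mu> * f v)}"

text \<open>
  Meant for finite \<open>W\<close> and \<open>T\<close> self-adjoint on the functions on \<open>W\<close>; then there are finitely many
  eigenvalues, all of them real, and geometric and algebraic multiplicities agree.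
\<close>

definition eigenvalue_count :: "'v set \<Rightarrow> (('v \<Rightarrow> complex) \<Rightarrow> ('v \<Rightarrow> complex)) \<Rightarrow> real \<Rightarrow> nat" where
  "eigenvalue_count W T l =
     (\<Sum>\<mu> | \<mu> \<le> l \<and> (\<exists>f\<in>eigenspace W T \<mu>. f \<noteq> 0).
        vector_space.dim (\<lambda>(c::complex) f v. c * f v) (eigenspace W T \<mu>))"


section \<open>Spectral projections on \<open>\<ell>\<^sup>2(V)\<close>\<close>

definition ell2 :: "'v set \<Rightarrow> ('v \<Rightarrow> complex) set" where
  "ell2 V = {f. (\<forall>v. v \<notin> V \<longrightarrow> f v = 0) \<and> (\<lambda>v. (cmod (f v))\<^sup>2) summable_on V}"

definition ell2_inner :: "'v set \<Rightarrow> ('v \<Rightarrow> complex) \<Rightarrow> ('v \<Rightarrow> complex) \<Rightarrow> complex" where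
  "ell2_inner V f g = (\<Sum>\<^sub>\<infinity>v\<in>V. f v * cnj (g v))"

definition delta_fun :: "'v \<Rightarrow> 'v \<Rightarrow> complex" where
  "delta_fun v = (\<lambda>w. if w = v then 1 else 0)"

definition bounded_operator :: "'v set \<Rightarrow> (('v \<Rightarrow> complex) \<Rightarrow> ('v \<Rightarrow> complex)) \<Rightarrow> bool" where
  "bounded_operator V A \<longleftrightarrow>
     (\<forall>f\<in>ell2 V. A f \<in> ell2 V) \<and>
     (\<forall>f\<in>ell2 V. \<forall>g\<in>ell2 V. A (\<lambda>v. f v + g v) = (\<lambda>v. A f v + A g v)) \<and>
     (\<forall>c. \<forall>f\<in>ell2 V. A (\<lambda>v. c * f v) = (\<lambda>v. c * A f v)) \<and>
     (\<exists>C. \<forall>f\<in>ell2 V. Re (ell2_inner V (A f) (A f)) \<le> C * Re (ell2_inner V f f))"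

definition orthogonal_projection :: "'v set \<Rightarrow> (('v \<Rightarrow> complex) \<Rightarrow> ('v \<Rightarrow> complex)) \<Rightarrow> bool" where
  "orthogonal_projection V P \<longleftrightarrow>
     bounded_operator V P \<and>
     (\<forall>f\<in>ell2 V. P (P f) = P f) \<and>
     (\<forall>f\<in>ell2 V. \<forall>g\<in>ell2 V. ell2_inner V (P f) g = ell2_inner V f (P g))"

definition projection_valued_measure ::
    "'v set \<Rightarrow> (real set \<Rightarrow> ('v \<Rightarrow> complex) \<Rightarrow> ('v \<Rightarrow> complex)) \<Rightarrow> bool" where
  "projection_valued_measure V P \<longleftrightarrow>
     (\<forall>B\<in>sets borel. orthogonal_projection V (P B)) \<and>
     (\<forall>f\<in>ell2 V. P UNIV f = f) \<and>
     (\<forall>B C. B \<in> sets borel \<and> C \<in> sets borel \<longrightarrow> (\<forall>f\<in>ell2 V. P (B \<inter> C) f = P B (P C f))) \<and>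
     (\<forall>B :: nat \<Rightarrow> real set. range B \<subseteq> sets borel \<and> disjoint_family B \<longrightarrow>
        (\<forall>f\<in>ell2 V. \<forall>g\<in>ell2 V.
           (\<lambda>n. ell2_inner V (P (B n) f) g) sums ell2_inner V (P (\<Union>n. B n) f) g))"

text \<open>The measure \<open>B \<mapsto> \<langle>P(B) f, f\<rangle>\<close> on the real line.\<close>

definition diagonal_measure ::
    "'v set \<Rightarrow> (real set \<Rightarrow> ('v \<Rightarrow> complex) \<Rightarrow> ('v \<Rightarrow> complex)) \<Rightarrow> ('v \<Rightarrow> complex) \<Rightarrow> real measure" where
  "diagonal_measure V P f =
     measure_of UNIV (sets borel) (\<lambda>B. ennreal (Re (ell2_inner V (P B f) f)))"

text \<open>
  \<open>P\<close> is the spectral measure of the bounded self-adjoint operator \<open>A\<close>: it has bounded support and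
  \<open>A = \<integral> t dP(t)\<close>, that is \<open>\<langle>A f, f\<rangle> = \<integral> t d\<langle>P(t) f, f\<rangle>\<close> for all \<open>f\<close>, which determines the
  sesquilinear form of \<open>A\<close> by polarization.
\<close>

definition is_spectral_measure ::
    "'v set \<Rightarrow> (('v \<Rightarrow> complex) \<Rightarrow> ('v \<Rightarrow> complex)) \<Rightarrow>
     (real set \<Rightarrow> ('v \<Rightarrow> complex) \<Rightarrow> ('v \<Rightarrow> complex)) \<Rightarrow> bool" where
  "is_spectral_measure V A P \<longleftrightarrow>
     projection_valued_measure V P \<and>
     (\<exists>R. \<forall>f\<in>ell2 V. P {-R..R} f = f) \<and>
     (\<forall>f\<in>ell2 V. ell2_inner V (A f) f = complex_of_real (\<integral>t. t \<partial>diagonal_measure V P f))"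

text \<open>
  \<open>spectral_projection V A B\<close> is \<open>\<chi>\<^sub>B(A)\<close>. By the spectral theorem, for bounded self-adjoint \<open>A\<close> the
  spectral measure exists and is unique on Borel sets \<open>B\<close> and on arguments in \<open>ell2 V\<close>, so the
  choice is immaterial there.
\<close>

definition spectral_projection ::
    "'v set \<Rightarrow> (('v \<Rightarrow> complex) \<Rightarrow> ('v \<Rightarrow> complex)) \<Rightarrow> real set \<Rightarrow> ('v \<Rightarrow> complex) \<Rightarrow> ('v \<Rightarrow> complex)" where
  "spectral_projection V A = (SOME P. is_spectral_measure V A P)"

definition vn_trace :: "'v set \<Rightarrow> 'v set \<Rightarrow> (('v \<Rightarrow> complex) \<Rightarrow> ('v \<Rightarrow> complex)) \<Rightarrow> complex" where
  "vn_trace V FV A = (\<Sum>v\<in>FV. ell2_inner V (A (delta_fun v)) (delta_fun v))"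

text \<open>The trace of a projection is real, so taking the real part loses nothing.\<close>

definition spectral_density ::
    "'v set \<Rightarrow> 'v set \<Rightarrow> (('v \<Rightarrow> complex) \<Rightarrow> ('v \<Rightarrow> complex)) \<Rightarrow> real \<Rightarrow> real" where
  "spectral_density V FV A l = Re (vn_trace V FV (spectral_projection V A {..l}))"

end

theory Submission
  imports Defs "HOL-Probability.Helly_Selection" "HOL-Probability.Probability_Mass_Function"
begin

text \<open>
  Both sides of the limit are distribution functions of finite measures on a common compact interval:
  \<open>E\<^sub>m / N\<^sub>m\<close> belongs to the averaged spectral measures of the vectors \<open>\<delta>\<^sub>v\<close> for the restricted operator,
  \<open>F\<close> to those of \<open>\<Delta>\<^sub>\<sigma>\<close> for \<open>v\<close> in the fundamental domain. By the Weierstrass theorem it suffices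
  that all moments converge. The \<open>k\<close>-th moment at \<open>v\<close> is \<open>\<langle>\<Delta>\<^sup>k \<delta>\<^sub>v, \<delta>\<^sub>v\<rangle>\<close>, which depends only on the
  graph near \<open>v\<close> and is invariant under magnetic translations; so only the vertices near the boundary of
  \<open>X\<^sub>m\<close> contribute an error, and by regularity of the exhaustion they are \<open>o(N\<^sub>m)\<close> many.

  The spectral measures themselves come from the Hausdorff moment problem: for \<open>0 \<le> A \<le> 1\<close> all
  \<open>A\<^sup>a (1 - A)\<^sup>b\<close> are positive, so \<open>\<langle>A\<^sup>k f, f\<rangle>\<close> is a moment sequence, and polarization turns
  the resulting measures into a projection-valued one.
\<close>

section \<open>Integration functionals\<close>

text \<open>\<open>spectral_projection\<close> is a \<open>SOME\<close>: nothing is known about it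
  until one spectral measure has been built, and nothing computed with that one applies until
  uniqueness shows that all spectral measures have the same diagonal values. Both halves rest on one
  principle: functionals on a common compact interval that agree on all monomials agree on all
  bounded Borel functions. Laws of functional calculus therefore only need checking on powers of the
  operator. The interval is uniform. By freeness every valence is at most the number D of arc
  orbits, and \<open>\<Delta>\<close>, its Dirichlet compressions and all Neumann operators lie
  between 0 and c = 2 D + 1 as quadratic forms. So c depends neither on the piece nor on the
  boundary condition, and c^k bounds the k-th moment also at the exceptional vertices. Convergence
  of moments yields convergence against continuous functions only; the indicator of a half-line is
  squeezed between ramps, and this is where continuity of \<open>F\<close> at the point
  enters.\<close>

definition bounded_borel :: "real \<Rightarrow> (real \<Rightarrow> real) set" where
  "bounded_borel R = {h \<in> borel_measurable borel. \<exists>C. \<forall>x\<in>{-R..R}. \<bar>h x\<bar> \<le> C}"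

text \<open>
  Linearity and bounded convergence on \<open>[-R, R]\<close> characterize integration against a finite (real or complex)
  measure supported there. Arguing with the functionals avoids handling complex measures.
\<close>

definition measure_functional :: "real \<Rightarrow> ((real \<Rightarrow> real) \<Rightarrow> 'b::real_normed_vector) \<Rightarrow> bool" where
  "measure_functional R \<Phi> \<longleftrightarrow>
     (\<forall>h\<in>bounded_borel R. \<forall>k\<in>bounded_borel R. \<Phi> (\<lambda>x. h x + k x) = \<Phi> h + \<Phi> k) \<and>
     (\<forall>c. \<forall>h\<in>bounded_borel R. \<Phi> (\<lambda>x. c * h x) = c *\<^sub>R \<Phi> h) \<and>
     (\<forall>H h C. (\<forall>n::nat. H n \<in> borel_measurable borel) \<longrightarrow> h \<in> borel_measurable borel \<longrightarrow>
        (\<forall>n. \<forall>x\<in>{-R..R}. \<bar>H n x\<bar> \<le> C) \<longrightarrow> (\<forall>x\<in>{-R..R}. (\<lambda>n. H n x) \<longlonglongrightarrow> h x) \<longrightarrow>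
        (\<lambda>n. \<Phi> (H n)) \<longlonglongrightarrow> \<Phi> h)"

definition positive_functional :: "real \<Rightarrow> ((real \<Rightarrow> real) \<Rightarrow> real) \<Rightarrow> bool" where
  "positive_functional R I \<longleftrightarrow> (\<forall>h\<in>bounded_borel R. (\<forall>x\<in>{-R..R}. 0 \<le> h x) \<longrightarrow> 0 \<le> I h)"

section \<open>Bounded Borel integrands\<close>

lemma bounded_borelI:
  assumes "h \<in> borel_measurable borel" "\<And>x. x \<in> {-R..R} \<Longrightarrow> \<bar>h x\<bar> \<le> C"
  shows "h \<in> bounded_borel R"
  using assms unfolding bounded_borel_def by blast

lemma bounded_borelE:
  assumes "h \<in> bounded_borel R"
  obtains C where "h \<in> borel_measurable borel" "0 \<le> C" "\<And>x. x \<in> {-R..R} \<Longrightarrow> \<bar>h x\<bar> \<le> C"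
proof -
  from assms obtain C where "h \<in> borel_measurable borel" "\<forall>x\<in>{-R..R}. \<bar>h x\<bar> \<le> C"
    unfolding bounded_borel_def by auto
  then show ?thesis by (intro that[of "max 0 C"]) fastforce+
qed

lemma bounded_borel_measurable: "h \<in> bounded_borel R \<Longrightarrow> h \<in> borel_measurable borel"
  by (auto simp: bounded_borel_def)

lemma bounded_borel_mono: "R \<le> R' \<Longrightarrow> h \<in> bounded_borel R' \<Longrightarrow> h \<in> bounded_borel R"
  unfolding bounded_borel_def by force

lemma bounded_borel_continuous: "continuous_on UNIV h \<Longrightarrow> h \<in> bounded_borel R"
proof -
  assume h: "continuous_on UNIV h"
  have "compact (h ` {-R..R})"
    by (intro compact_continuous_image continuous_on_subset[OF h]) auto
  then obtain C where "\<forall>x\<in>{-R..R}. norm (h x) \<le> C"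
    using compact_imp_bounded bounded_iff[of "h ` {-R..R}"] by fastforce
  then show ?thesis
    using h by (intro bounded_borelI[where C=C]) (auto intro: borel_measurable_continuous_onI)
qed

lemma bounded_borel_const [simp]: "(\<lambda>x. c) \<in> bounded_borel R"
  by (intro bounded_borel_continuous) (auto intro: continuous_intros)

text \<open>Boundedness is asked on \<open>[-R, R]\<close> only so that monomials are integrands and
  moments are values of the functionals, without truncation.\<close>

lemma bounded_borel_power [simp]: "(\<lambda>x. x ^ n) \<in> bounded_borel R"
  by (intro bounded_borel_continuous) (auto intro: continuous_intros)

lemma bounded_borel_id [simp]: "(\<lambda>x. x) \<in> bounded_borel R"
  by (intro bounded_borel_continuous) (auto intro: continuous_intros)

lemma bounded_borel_indicator [simp]: "B \<in> sets borel \<Longrightarrow> indicator B \<in> bounded_borel R"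
  by (intro bounded_borelI[where C=1]) (auto simp: indicator_def)

lemma bounded_borel_add [simp]:
  "h \<in> bounded_borel R \<Longrightarrow> k \<in> bounded_borel R \<Longrightarrow> (\<lambda>x. h x + k x) \<in> bounded_borel R"
proof (elim bounded_borelE)
  fix C D assume *: "h \<in> borel_measurable borel" "k \<in> borel_measurable borel"
    "\<And>x. x \<in> {-R..R} \<Longrightarrow> \<bar>h x\<bar> \<le> C" "\<And>x. x \<in> {-R..R} \<Longrightarrow> \<bar>k x\<bar> \<le> D"
  then show ?thesis
    by (intro bounded_borelI[where C="C+D"] borel_measurable_add abs_triangle_ineq[THEN order_trans] add_mono) auto
qed

lemma bounded_borel_mult [simp]:
  "h \<in> bounded_borel R \<Longrightarrow> k \<in> bounded_borel R \<Longrightarrow> (\<lambda>x. h x * k x) \<in> bounded_borel R"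
proof (elim bounded_borelE)
  fix C D assume *: "h \<in> borel_measurable borel" "k \<in> borel_measurable borel" "0 \<le> C" "0 \<le> D"
    "\<And>x. x \<in> {-R..R} \<Longrightarrow> \<bar>h x\<bar> \<le> C" "\<And>x. x \<in> {-R..R} \<Longrightarrow> \<bar>k x\<bar> \<le> D"
  then show ?thesis
    by (intro bounded_borelI[where C="C*D"] borel_measurable_times) (auto simp: abs_mult intro!: mult_mono)
qed

lemma bounded_borel_cmult [simp]: "h \<in> bounded_borel R \<Longrightarrow> (\<lambda>x. c * h x) \<in> bounded_borel R"
  by (intro bounded_borel_mult) auto

lemma bounded_borel_diff [simp]:
  "h \<in> bounded_borel R \<Longrightarrow> k \<in> bounded_borel R \<Longrightarrow> (\<lambda>x. h x - k x) \<in> bounded_borel R"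
  using bounded_borel_add[of h R "\<lambda>x. (-1) * k x"] bounded_borel_cmult[of k R "-1"] by simp

lemma bounded_borel_sum [simp]:
  "finite A \<Longrightarrow> (\<And>i. i \<in> A \<Longrightarrow> h i \<in> bounded_borel R) \<Longrightarrow> (\<lambda>x. \<Sum>i\<in>A. h i x) \<in> bounded_borel R"
  by (induction A rule: finite_induct) auto

section \<open>Calculus of measure functionals\<close>

context
  fixes R :: real and \<Phi> :: "(real \<Rightarrow> real) \<Rightarrow> 'b::real_normed_vector"
  assumes \<Phi>: "measure_functional R \<Phi>"
begin

lemma mf_add: "h \<in> bounded_borel R \<Longrightarrow> k \<in> bounded_borel R \<Longrightarrow> \<Phi> (\<lambda>x. h x + k x) = \<Phi> h + \<Phi> k"
  using \<Phi> unfolding measure_functional_def by blast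

lemma mf_scale: "h \<in> bounded_borel R \<Longrightarrow> \<Phi> (\<lambda>x. c * h x) = c *\<^sub>R \<Phi> h"
  using \<Phi> unfolding measure_functional_def by blast

lemma mf_limit:
  assumes "\<And>n::nat. H n \<in> borel_measurable borel" "h \<in> borel_measurable borel"
    "\<And>n x. x \<in> {-R..R} \<Longrightarrow> \<bar>H n x\<bar> \<le> C" "\<And>x. x \<in> {-R..R} \<Longrightarrow> (\<lambda>n. H n x) \<longlonglongrightarrow> h x"
  shows "(\<lambda>n. \<Phi> (H n)) \<longlonglongrightarrow> \<Phi> h"
  using \<Phi> assms unfolding measure_functional_def by blast

text \<open>Concentration on \<open>[-R, R]\<close> is contained in the limit clause: the constant
  sequence \<open>h\<close> converges to \<open>k\<close> on the interval, whatever happens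
  outside.\<close>

lemma mf_cong:
  assumes "h \<in> bounded_borel R" "k \<in> borel_measurable borel" "\<And>x. x \<in> {-R..R} \<Longrightarrow> h x = k x"
  shows "\<Phi> h = \<Phi> k"
proof -
  obtain C where C: "h \<in> borel_measurable borel" "\<And>x. x \<in> {-R..R} \<Longrightarrow> \<bar>h x\<bar> \<le> C"
    using bounded_borelE[OF assms(1)] by metis
  have "(\<lambda>n::nat. \<Phi> h) \<longlonglongrightarrow> \<Phi> k"
    by (rule mf_limit[where C=C]) (use C assms in auto)
  then show ?thesis by (simp add: LIMSEQ_const_iff)
qed

lemma mf_diff: "h \<in> bounded_borel R \<Longrightarrow> k \<in> bounded_borel R \<Longrightarrow> \<Phi> (\<lambda>x. h x - k x) = \<Phi> h - \<Phi> k"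
  using mf_add[of h "\<lambda>x. (-1) * k x"] mf_scale[of k "-1"] bounded_borel_cmult[of k R "-1"] by simp

lemma mf_zero: "\<Phi> (\<lambda>x. 0) = 0"
  using mf_scale[of "\<lambda>x. 0" 0] by simp

lemma mf_sum:
  "finite A \<Longrightarrow> (\<And>i. i \<in> A \<Longrightarrow> h i \<in> bounded_borel R) \<Longrightarrow> \<Phi> (\<lambda>x. \<Sum>i\<in>A. h i x) = (\<Sum>i\<in>A. \<Phi> (h i))"
  by (induction A rule: finite_induct) (auto simp: mf_zero mf_add)

text \<open>Lets functionals given on different intervals be compared on the larger one; convergence
  on a larger interval is the stronger premise, so the limit clause survives.\<close>

lemma mf_mono_interval: "R \<le> R' \<Longrightarrow> measure_functional R' \<Phi>"
  unfolding measure_functional_def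
proof (intro conjI ballI allI impI)
  fix H :: "nat \<Rightarrow> real \<Rightarrow> real" and h C assume *: "R \<le> R'" "\<forall>n. H n \<in> borel_measurable borel" "h \<in> borel_measurable borel"
    "\<forall>n. \<forall>x\<in>{-R'..R'}. \<bar>H n x\<bar> \<le> C" "\<forall>x\<in>{-R'..R'}. (\<lambda>n. H n x) \<longlonglongrightarrow> h x"
  show "(\<lambda>n. \<Phi> (H n)) \<longlonglongrightarrow> \<Phi> h"
    by (rule mf_limit[where C=C]) (use * in auto)
qed (auto intro: mf_add mf_scale bounded_borel_mono)

text \<open>The measure with density \<open>w\<close>. The spectral arguments take indicators and
  powers of t as densities.\<close>

lemma mf_weight:
  assumes "w \<in> bounded_borel R" shows "measure_functional R (\<lambda>h. \<Phi> (\<lambda>x. w x * h x))"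
  unfolding measure_functional_def
proof (intro conjI ballI allI impI)
  fix h k assume "h \<in> bounded_borel R" "k \<in> bounded_borel R"
  then show "\<Phi> (\<lambda>x. w x * (h x + k x)) = \<Phi> (\<lambda>x. w x * h x) + \<Phi> (\<lambda>x. w x * k x)"
    using assms mf_add[of "\<lambda>x. w x * h x" "\<lambda>x. w x * k x"] by (simp add: algebra_simps)
next
  fix c h assume "h \<in> bounded_borel R"
  then show "\<Phi> (\<lambda>x. w x * (c * h x)) = c *\<^sub>R \<Phi> (\<lambda>x. w x * h x)"
    using assms mf_scale[of "\<lambda>x. w x * h x" c] by (simp add: algebra_simps)
next
  fix H :: "nat \<Rightarrow> real \<Rightarrow> real" and h C assume *: "\<forall>n. H n \<in> borel_measurable borel" "h \<in> borel_measurable borel"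
    "\<forall>n. \<forall>x\<in>{-R..R}. \<bar>H n x\<bar> \<le> C" "\<forall>x\<in>{-R..R}. (\<lambda>n. H n x) \<longlonglongrightarrow> h x"
  obtain D where D: "w \<in> borel_measurable borel" "\<And>x. x \<in> {-R..R} \<Longrightarrow> \<bar>w x\<bar> \<le> D" "0 \<le> D"
    using bounded_borelE[OF assms(1)] by metis
  show "(\<lambda>n. \<Phi> (\<lambda>x. w x * H n x)) \<longlonglongrightarrow> \<Phi> (\<lambda>x. w x * h x)"
    using * D
    by (intro mf_limit[where C="D * C"]) (auto simp: abs_mult intro!: mult_mono tendsto_intros borel_measurable_times)
qed

lemma mf_bounded_linear:
  assumes "bounded_linear L" shows "measure_functional R (\<lambda>h. L (\<Phi> h))"
proof -
  interpret bounded_linear L by fact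
  show ?thesis
    unfolding measure_functional_def
  proof (intro conjI ballI allI impI)
    fix H :: "nat \<Rightarrow> real \<Rightarrow> real" and h C assume *: "\<forall>n. H n \<in> borel_measurable borel" "h \<in> borel_measurable borel"
      "\<forall>n. \<forall>x\<in>{-R..R}. \<bar>H n x\<bar> \<le> C" "\<forall>x\<in>{-R..R}. (\<lambda>n. H n x) \<longlonglongrightarrow> h x"
    show "(\<lambda>n. L (\<Phi> (H n))) \<longlonglongrightarrow> L (\<Phi> h)"
      by (rule tendsto, rule mf_limit[where C=C]) (use * in auto)
  qed (auto simp: mf_add mf_scale add scale)
qed

end

lemma mf_plus:
  fixes \<Phi> \<Psi> :: "(real \<Rightarrow> real) \<Rightarrow> 'b::real_normed_vector"
  assumes "measure_functional R \<Phi>" "measure_functional R \<Psi>"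
  shows "measure_functional R (\<lambda>h. \<Phi> h + \<Psi> h)"
  unfolding measure_functional_def
proof (intro conjI ballI allI impI)
  fix H :: "nat \<Rightarrow> real \<Rightarrow> real" and h C assume *: "\<forall>n. H n \<in> borel_measurable borel" "h \<in> borel_measurable borel"
    "\<forall>n. \<forall>x\<in>{-R..R}. \<bar>H n x\<bar> \<le> C" "\<forall>x\<in>{-R..R}. (\<lambda>n. H n x) \<longlonglongrightarrow> h x"
  show "(\<lambda>n. \<Phi> (H n) + \<Psi> (H n)) \<longlonglongrightarrow> \<Phi> h + \<Psi> h"
    by (intro tendsto_add mf_limit[OF assms(1), where C=C] mf_limit[OF assms(2), where C=C]) (use * in auto)
qed (use assms in \<open>auto simp: mf_add mf_scale algebra_simps\<close>)

lemma mf_const_zero: "measure_functional R (\<lambda>h. 0)"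
  by (simp add: measure_functional_def)

lemma mf_sum_functional:
  fixes \<Phi> :: "'i \<Rightarrow> (real \<Rightarrow> real) \<Rightarrow> 'b::real_normed_vector"
  assumes "finite A" "\<And>i. i \<in> A \<Longrightarrow> measure_functional R (\<Phi> i)"
  shows "measure_functional R (\<lambda>h. \<Sum>i\<in>A. \<Phi> i h)"
  using assms by (induction A rule: finite_induct) (auto simp: mf_const_zero mf_plus)

lemma mf_scaleR: "measure_functional R \<Phi> \<Longrightarrow> measure_functional R (\<lambda>h. c *\<^sub>R \<Phi> h)"
  by (erule mf_bounded_linear) (rule bounded_linear_scaleR_right)

lemma mf_cmult:
  fixes \<Phi> :: "(real \<Rightarrow> real) \<Rightarrow> 'b::real_normed_algebra"
  shows "measure_functional R \<Phi> \<Longrightarrow> measure_functional R (\<lambda>h. c * \<Phi> h)"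
  by (erule mf_bounded_linear) (rule bounded_linear_mult_right)

lemma mf_of_real:
  "measure_functional R \<Phi> \<Longrightarrow> measure_functional R (\<lambda>h. complex_of_real (\<Phi> h))"
  by (erule mf_bounded_linear) (rule bounded_linear_of_real)

lemma mf_minus:
  fixes \<Phi> \<Psi> :: "(real \<Rightarrow> real) \<Rightarrow> 'b::real_normed_vector"
  assumes "measure_functional R \<Phi>" "measure_functional R \<Psi>"
  shows "measure_functional R (\<lambda>h. \<Phi> h - \<Psi> h)"
  using mf_plus[OF assms(1) mf_scaleR[OF assms(2), of "-1"]] by simp

lemma measure_functional_integral:
  assumes "finite_measure M" "sets M = sets borel" "AE x in M. x \<in> {-R..R}"
  shows "measure_functional R (\<lambda>h. \<integral>x. h x \<partial>M)" "positive_functional R (\<lambda>h. \<integral>x. h x \<partial>M)"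
proof -
  interpret finite_measure M by fact
  have meas: "h \<in> borel_measurable M \<longleftrightarrow> h \<in> borel_measurable borel" for h :: "real \<Rightarrow> real"
    using measurable_cong_sets[OF assms(2) refl] by blast
  have int: "integrable M h" if h: "h \<in> bounded_borel R" for h
  proof -
    obtain C where C: "h \<in> borel_measurable borel" "\<And>x. x \<in> {-R..R} \<Longrightarrow> \<bar>h x\<bar> \<le> C"
      using bounded_borelE[OF h] by metis
    show ?thesis
    proof (rule integrable_const_bound[where B=C])
      show "AE x in M. norm (h x) \<le> C"
        using assms(3) by (rule eventually_mono) (use C in auto)
    qed (use C in \<open>simp add: meas\<close>)
  qed
  show "measure_functional R (\<lambda>h. \<integral>x. h x \<partial>M)"
    unfolding measure_functional_def
  proof (intro conjI ballI allI impI)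
    fix H :: "nat \<Rightarrow> real \<Rightarrow> real" and h C assume *: "\<forall>n. H n \<in> borel_measurable borel" "h \<in> borel_measurable borel"
      "\<forall>n. \<forall>x\<in>{-R..R}. \<bar>H n x\<bar> \<le> C" "\<forall>x\<in>{-R..R}. (\<lambda>n. H n x) \<longlonglongrightarrow> h x"
    show "(\<lambda>n. \<integral>x. H n x \<partial>M) \<longlonglongrightarrow> (\<integral>x. h x \<partial>M)"
    proof (rule integral_dominated_convergence[where w="\<lambda>_. C"])
      show "AE x in M. (\<lambda>n. H n x) \<longlonglongrightarrow> h x" "AE x in M. norm (H n x) \<le> C" for n
        using assms(3) by (rule eventually_mono; use * in auto)+
    qed (use * in \<open>auto simp: meas\<close>)
  qed (use int in auto)
  show "positive_functional R (\<lambda>h. \<integral>x. h x \<partial>M)"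
    unfolding positive_functional_def
    by (intro ballI impI integral_nonneg_AE eventually_mono[OF assms(3)]) auto
qed

section \<open>Uniqueness: determination by indicators and by moments\<close>

lemma measure_functional_zero_if_indicator:
  fixes \<Phi> :: "(real \<Rightarrow> real) \<Rightarrow> 'b::real_normed_vector"
  assumes \<Phi>: "measure_functional R \<Phi>" and 0: "\<And>B. B \<in> sets borel \<Longrightarrow> \<Phi> (indicator B) = 0"
    and h: "h \<in> bounded_borel R"
  shows "\<Phi> h = 0"
proof -
  have nonneg: "\<Phi> u = 0" if "u \<in> bounded_borel R" "\<And>x. 0 \<le> u x" for u
  proof -
    have "u \<in> borel_measurable borel" using that by (simp add: bounded_borel_measurable)
    then show ?thesis using that(2,1)
    proof (induction u rule: borel_measurable_induct_real)
      case (set A) then show ?case by (simp add: 0)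
    next
      case (mult u c)
      show ?case
      \<comment> \<open>With c = 0 the product is bounded although \<open>u\<close> need not be, so
        the induction hypothesis would not apply.\<close>
      proof (cases "c = 0")
        case True then show ?thesis by (simp add: mf_zero[OF \<Phi>])
      next
        case False
        then have "u \<in> bounded_borel R"
          using bounded_borel_cmult[OF mult.prems, of "1/c"] by simp
        then show ?thesis using mult by (simp add: mf_scale[OF \<Phi>])
      qed
    next
      case (add u v)
      \<comment> \<open>Both summands are nonnegative, so a bound for the sum bounds each of
        them.\<close>
      obtain C where C: "\<And>x. x \<in> {-R..R} \<Longrightarrow> \<bar>v x + u x\<bar> \<le> C"
        using bounded_borelE[OF add.prems] by metis
      have "\<bar>v x\<bar> \<le> C \<and> \<bar>u x\<bar> \<le> C" if "x \<in> {-R..R}" for x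
        using C[OF that] add.hyps(2,4)[of x] by linarith
      then have "u \<in> bounded_borel R" "v \<in> bounded_borel R"
        using add.hyps by (auto intro!: bounded_borelI[where C=C])
      then show ?case using add by (simp add: mf_add[OF \<Phi>])
    next
      case (seq U)
      obtain C where C: "u \<in> borel_measurable borel" "\<And>x. x \<in> {-R..R} \<Longrightarrow> \<bar>u x\<bar> \<le> C"
        using bounded_borelE[OF seq.prems] by metis
      have le: "U i x \<le> u x" for i x
        using seq by (intro incseq_le) (auto simp: incseq_def le_fun_def)
      have b: "\<bar>U i x\<bar> \<le> C" if "x \<in> {-R..R}" for i x
        using C(2)[OF that] le[of i x] seq.hyps(2)[of i x] by linarith
      have "(\<lambda>n. \<Phi> (U n)) \<longlonglongrightarrow> \<Phi> u"
        using seq b C by (intro mf_limit[OF \<Phi>, where C=C]) auto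
      moreover have "\<Phi> (U n) = 0" for n
        using seq.hyps(1) b by (intro seq.IH bounded_borelI[where C=C])
      ultimately show ?case by (simp add: LIMSEQ_const_iff)
    qed
  qed
  obtain C where C: "h \<in> borel_measurable borel" "\<And>x. x \<in> {-R..R} \<Longrightarrow> \<bar>h x\<bar> \<le> C" "0 \<le> C"
    using bounded_borelE[OF h] by metis
  have 1: "(\<lambda>x. max 0 (h x)) \<in> bounded_borel R" "(\<lambda>x. max 0 (- h x)) \<in> bounded_borel R"
    using C by (auto intro!: bounded_borelI[where C=C] borel_measurable_max) force+
  have "\<Phi> h = \<Phi> (\<lambda>x. max 0 (h x) - max 0 (- h x))"
    by (rule arg_cong[where f=\<Phi>]) (auto simp: max_def)
  also have "\<dots> = 0"
    using 1 nonneg[OF 1(1)] nonneg[OF 1(2)] by (simp add: mf_diff[OF \<Phi>])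
  finally show ?thesis .
qed

text \<open>The class of functions killed by the functional grows from polynomials to continuous
  functions by Weierstrass approximation, to closed half-lines by ramps, and to Borel sets by the
  pi-lambda theorem. Uniform approximation is a case of bounded pointwise convergence, so the limit
  clause replaces a total variation bound and the values may lie in any normed space.\<close>

theorem measure_functional_zero_if_moments:
  fixes \<Phi> :: "(real \<Rightarrow> real) \<Rightarrow> 'b::real_normed_vector"
  assumes \<Phi>: "measure_functional R \<Phi>" and 0: "\<And>n. \<Phi> (\<lambda>x. x ^ n) = 0"
    and h: "h \<in> bounded_borel R"
  shows "\<Phi> h = 0"
proof -
  have poly: "\<Phi> (\<lambda>x. \<Sum>i\<le>n. a i * x^i) = 0" for a and n :: nat
    by (simp add: mf_sum[OF \<Phi>] mf_scale[OF \<Phi>] 0)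
  have cont: "\<Phi> f = 0" if f: "continuous_on UNIV f" for f :: "real \<Rightarrow> real"
  proof -
    have "\<exists>g. real_polynomial_function g \<and> (\<forall>x\<in>{-R..R}. \<bar>f x - g x\<bar> < inverse (Suc n))" for n :: nat
      using Stone_Weierstrass_real_polynomial_function[of "{-R..R}" f "inverse (Suc n)"] f
      by (metis compact_Icc continuous_on_subset inverse_positive_iff_positive of_nat_0_less_iff
           subset_UNIV zero_less_Suc)
    then obtain g where g: "\<And>n. real_polynomial_function (g n)"
      "\<And>n x. x \<in> {-R..R} \<Longrightarrow> \<bar>f x - g n x\<bar> < inverse (Suc n)" by metis
    have g0: "\<Phi> (g n) = 0" for n
      using g(1)[of n] poly unfolding real_polynomial_function_iff_sum by auto
    have gc: "continuous_on UNIV (g n)" for n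
      using g(1)[of n] real_polynomial_function_eq by (auto intro!: continuous_on_polymonial_function)
    obtain C where C: "f \<in> borel_measurable borel" "\<And>x. x \<in> {-R..R} \<Longrightarrow> \<bar>f x\<bar> \<le> C"
      using bounded_borelE[OF bounded_borel_continuous[OF f]] by metis
    have "(\<lambda>n. \<Phi> (g n)) \<longlonglongrightarrow> \<Phi> f"
    proof (rule mf_limit[OF \<Phi>, where C="C+1"])
      show "\<bar>g n x\<bar> \<le> C + 1" if "x \<in> {-R..R}" for n x
      proof -
        have "inverse (real (Suc n)) \<le> 1" by (simp add: field_simps)
        then show ?thesis using g(2)[OF that, of n] C(2)[OF that] by linarith
      qed
      show "(\<lambda>n. g n x) \<longlonglongrightarrow> f x" if "x \<in> {-R..R}" for x
      proof (rule LIM_zero_cancel, rule Lim_null_comparison[OF _ LIMSEQ_inverse_real_of_nat])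
        show "\<forall>\<^sub>F n in sequentially. norm (g n x - f x) \<le> inverse (real (Suc n))"
          using g(2)[OF that] by (auto simp: abs_minus_commute less_imp_le)
      qed
    qed (use gc f in \<open>auto intro: borel_measurable_continuous_onI\<close>)
    then show ?thesis by (simp add: g0 LIMSEQ_const_iff)
  qed
  have half: "\<Phi> (indicator {..a}) = 0" for a
  proof -
    \<comment> \<open>A ramp equal to 1 up to \<open>a\<close> and, for n > 0, equal to 0 from a +
      1/n on; it decreases to the indicator of the closed half-line.\<close>
    define H where "H n x = max 0 (min 1 (1 - real n * (x - a)))" for n :: nat and x
    have "(\<lambda>n. \<Phi> (H n)) \<longlonglongrightarrow> \<Phi> (indicator {..a})"
    proof (rule mf_limit[OF \<Phi>, where C=1])
      show "H n \<in> borel_measurable borel" for n unfolding H_def by measurable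
      show "(\<lambda>n. H n x) \<longlonglongrightarrow> indicator {..a} x" for x
      proof (cases "x \<le> a")
        case True
        then have "H n x = 1" for n
          by (auto simp: H_def mult_nonneg_nonpos max_def min_def)
        then show ?thesis using True by simp
      next
        case False
        then obtain N :: nat where N: "1 / (x - a) \<le> real N" using real_arch_simple by blast
        have "H n x = 0" if "n \<ge> N" for n
        proof -
          have "1 \<le> real n * (x - a)"
            using N that False by (simp add: pos_divide_le_eq) (smt (verit) mult_right_mono of_nat_mono)
          then show ?thesis by (simp add: H_def)
        qed
        then have "\<forall>\<^sub>F n in sequentially. H n x = 0" by (auto simp: eventually_sequentially)
        then show ?thesis using False by (simp add: tendsto_eventually)
      qed
    qed (auto simp: H_def)
    moreover have "\<Phi> (H n) = 0" for n
      unfolding H_def by (intro cont continuous_intros)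
    ultimately show ?thesis by (simp add: LIMSEQ_const_iff)
  qed
  have ind: "\<Phi> (indicator B) = 0" if "B \<in> sets borel" for B
  proof -
    have "Int_stable (range (\<lambda>a::real. {..a}))"
      by (auto simp: Int_stable_def)
    moreover have "range (\<lambda>a::real. {..a}) \<subseteq> Pow UNIV" by simp
    moreover have "B \<in> sigma_sets UNIV (range (\<lambda>a::real. {..a}))"
      using that unfolding borel_eq_atMost by simp
    ultimately show ?thesis
    proof (induction B rule: sigma_sets_induct_disjoint)
      case (compl A)
      then have A: "A \<in> sets borel" unfolding borel_eq_atMost by simp
      have "indicator (UNIV - A) = (\<lambda>x. 1 - indicator A x :: real)"
        by (auto simp: indicator_def)
      \<comment> \<open>The total mass is the moment of order 0, hence zero.\<close>
      then show ?case using compl A 0[of 0] by (simp add: mf_diff[OF \<Phi>])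
    next
      case (union A)
      then have A: "A i \<in> sets borel" for i unfolding borel_eq_atMost by (auto simp: image_subset_iff)
      have "(\<lambda>n. \<Phi> (indicator (\<Union>i<n. A i))) \<longlonglongrightarrow> \<Phi> (indicator (\<Union>i. A i))"
        using A by (intro mf_limit[OF \<Phi>, where C=1] LIMSEQ_indicator_UN borel_measurable_indicator)
          (auto simp: indicator_def)
      moreover have "\<Phi> (indicator (\<Union>i<n. A i)) = 0" for n
      proof -
        have "indicator (\<Union>i<n. A i) = (\<lambda>x. \<Sum>i<n. indicator (A i) x :: real)"
          using union(1) by (intro ext indicator_UN_disjoint) (auto simp: disjoint_family_on_def)
        then show ?thesis using A union by (simp add: mf_sum[OF \<Phi>])
      qed
      ultimately show ?case by (simp add: LIMSEQ_const_iff)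
    next
      case (basic A) then show ?case using half by auto
    next
      case empty
      have "indicator {} = (\<lambda>x::real. 0 :: real)" by auto
      then show ?case by (simp only: mf_zero[OF \<Phi>])
    qed
  qed
  show ?thesis by (rule measure_functional_zero_if_indicator[OF \<Phi> ind h])
qed

lemma measure_functional_eqI_indicator:
  fixes \<Phi> \<Psi> :: "(real \<Rightarrow> real) \<Rightarrow> 'b::real_normed_vector"
  assumes "measure_functional R \<Phi>" "measure_functional R \<Psi>"
    "\<And>B. B \<in> sets borel \<Longrightarrow> \<Phi> (indicator B) = \<Psi> (indicator B)" "h \<in> bounded_borel R"
  shows "\<Phi> h = \<Psi> h"
  using measure_functional_zero_if_indicator[OF mf_minus[OF assms(1,2)] _ assms(4)] assms(3) by simp

lemma measure_functional_eqI_moments: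
  fixes \<Phi> \<Psi> :: "(real \<Rightarrow> real) \<Rightarrow> 'b::real_normed_vector"
  assumes "measure_functional R \<Phi>" "measure_functional R \<Psi>"
    "\<And>n. \<Phi> (\<lambda>x. x ^ n) = \<Psi> (\<lambda>x. x ^ n)" "h \<in> bounded_borel R"
  shows "\<Phi> h = \<Psi> h"
  using measure_functional_zero_if_moments[OF mf_minus[OF assms(1,2)] _ assms(4)] assms(3) by simp

section \<open>Positive functionals and convergence of distribution functions\<close>

lemma positive_functional_mono:
  assumes "measure_functional R I" "positive_functional R I"
    "h \<in> bounded_borel R" "k \<in> bounded_borel R" "\<And>x. x \<in> {-R..R} \<Longrightarrow> h x \<le> k x"
  shows "I h \<le> I k"
proof -
  have "0 \<le> I (\<lambda>x. k x - h x)"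
    using assms by (auto simp: positive_functional_def)
  then show ?thesis using assms by (simp add: mf_diff)
qed

lemma positive_functional_abs:
  assumes "measure_functional R I" "positive_functional R I"
    "h \<in> bounded_borel R" "\<And>x. x \<in> {-R..R} \<Longrightarrow> \<bar>h x\<bar> \<le> C"
  shows "\<bar>I h\<bar> \<le> C * I (\<lambda>x. 1)"
proof -
  have "I h \<le> I (\<lambda>x. C * 1)" "I (\<lambda>x. (-C) * 1) \<le> I h"
    using assms(4) by (force intro!: positive_functional_mono[OF assms(1,2)] assms(3))+
  then show ?thesis
    using mf_scale[OF assms(1), of "\<lambda>x. 1" C] mf_scale[OF assms(1), of "\<lambda>x. 1" "-C"] by auto
qed

text \<open>Positivity bounds \<open>L m h\<close> by the supremum of |h| times the mass of
  \<open>L m\<close>, and the masses converge, being moments of order 0. Hence polynomial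
  approximation of continuous functions is uniform in m, and two ramps around \<open>l\<close>
  squeeze the indicator.\<close>

theorem moments_imp_distribution_convergence:
  fixes L :: "nat \<Rightarrow> (real \<Rightarrow> real) \<Rightarrow> real"
  assumes Lm: "\<And>m. measure_functional R (L m)" "\<And>m. positive_functional R (L m)"
    and I: "measure_functional R I" "positive_functional R I"
    and mom: "\<And>n. (\<lambda>m. L m (\<lambda>x. x ^ n)) \<longlonglongrightarrow> I (\<lambda>x. x ^ n)"
    and cont: "isCont (\<lambda>l. I (indicator {..l})) l"
  shows "(\<lambda>m. L m (indicator {..l})) \<longlonglongrightarrow> I (indicator {..l})"
proof -
  have poly: "(\<lambda>m. L m (\<lambda>x. \<Sum>i\<le>n. a i * x^i)) \<longlonglongrightarrow> I (\<lambda>x. \<Sum>i\<le>n. a i * x^i)" for a and n :: nat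
    using mom by (auto simp: mf_sum[OF Lm(1)] mf_scale[OF Lm(1)] mf_sum[OF I(1)] mf_scale[OF I(1)]
        intro!: tendsto_intros)
  have mass: "(\<lambda>m. L m (\<lambda>x. 1)) \<longlonglongrightarrow> I (\<lambda>x. 1)" using mom[of 0] by simp
  have cts: "(\<lambda>m. L m f) \<longlonglongrightarrow> I f" if f: "continuous_on UNIV f" for f :: "real \<Rightarrow> real"
  proof (rule LIMSEQ_I)
    fix r :: real assume r: "0 < r"
    \<comment> \<open>Once the mass of \<open>L m\<close> is within 1 of that of \<open>I\<close>,
      the two masses add up to at most K - 1; with e = r / (2 K) the two approximation errors
      together are at most r/2.\<close>
    define K where "K = 2 * \<bar>I (\<lambda>x. 1)\<bar> + 2"
    have K: "K > 0" by (simp add: K_def)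
    define e where "e = r / (2 * K)"
    have e: "e > 0" using r K by (simp add: e_def)
    obtain g where g: "real_polynomial_function g" "\<And>x. x \<in> {-R..R} \<Longrightarrow> \<bar>f x - g x\<bar> < e"
      using Stone_Weierstrass_real_polynomial_function[of "{-R..R}" f e] f e
      by (metis compact_Icc continuous_on_subset subset_UNIV)
    have bf: "f \<in> bounded_borel R" using f by (rule bounded_borel_continuous)
    have bg: "g \<in> bounded_borel R"
      using g(1) real_polynomial_function_eq
      by (auto intro!: bounded_borel_continuous continuous_on_polymonial_function)
    have "(\<lambda>m. L m g) \<longlonglongrightarrow> I g"
      using g(1) poly unfolding real_polynomial_function_iff_sum by auto
    then have "\<forall>\<^sub>F m in sequentially. \<bar>L m g - I g\<bar> < r/4"
      using tendstoD[of _ "I g" sequentially "r/4"] r by (auto simp: dist_real_def)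
    moreover have "\<forall>\<^sub>F m in sequentially. \<bar>L m (\<lambda>x. 1) - I (\<lambda>x. 1)\<bar> < 1"
      using tendstoD[OF mass, of 1] by (auto simp: dist_real_def)
    ultimately have "\<forall>\<^sub>F m in sequentially. norm (L m f - I f) < r"
    proof eventually_elim
      case (elim m)
      have 1: "\<bar>L m (\<lambda>x. f x - g x)\<bar> \<le> e * L m (\<lambda>x. 1)"
        by (rule positive_functional_abs[OF Lm]) (use bf bg g(2) in \<open>auto simp: less_imp_le\<close>)
      have 2: "\<bar>I (\<lambda>x. f x - g x)\<bar> \<le> e * I (\<lambda>x. 1)"
        by (rule positive_functional_abs[OF I]) (use bf bg g(2) in \<open>auto simp: less_imp_le\<close>)
      have "e * L m (\<lambda>x. 1) + e * I (\<lambda>x. 1) \<le> e * (K - 1)"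
        unfolding distrib_left[symmetric] using elim(2) e
        by (intro mult_left_mono) (auto simp: K_def)
      also have "\<dots> \<le> e * K" using e by simp
      also have "\<dots> = r/2" using K by (simp add: e_def)
      finally have "\<bar>L m (\<lambda>x. f x - g x)\<bar> + \<bar>I (\<lambda>x. f x - g x)\<bar> \<le> r/2" using 1 2 by linarith
      then have "\<bar>L m f - L m g\<bar> + \<bar>I f - I g\<bar> \<le> r/2"
        using bf bg by (simp add: mf_diff[OF Lm(1)] mf_diff[OF I(1)])
      then show ?case using elim(1) r unfolding real_norm_def by linarith
    qed
    then show "\<exists>no. \<forall>n\<ge>no. norm (L n f - I f) < r" by (simp add: eventually_sequentially)
  qed
  define step where "step a b x = max 0 (min 1 ((b - x) / (b - a)))" for a b x :: real
  have step_cont: "continuous_on UNIV (step a b)" if "a < b" for a b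
    unfolding step_def using that by (intro continuous_intros) auto
  have step_ge: "indicator {..a} x \<le> step a b x" if "a < b" for a b x
    using that by (auto simp: step_def indicator_def field_simps)
  have step_le: "step a b x \<le> indicator {..b} x" if "a < b" for a b x
    using that by (auto simp: step_def indicator_def field_simps)
  show ?thesis
  proof (rule LIMSEQ_I)
    fix r :: real assume r: "0 < r"
    obtain d where d: "d > 0" "\<And>x. \<bar>x - l\<bar> < d \<Longrightarrow> \<bar>I (indicator {..x}) - I (indicator {..l})\<bar> < r/2"
      using cont r unfolding continuous_at_eps_delta dist_real_def by (metis half_gt_zero)
    \<comment> \<open>Each ramp lies between two half-line indicators, with end points
      \<open>l\<close> and \<open>l + d/2\<close>, or \<open>l - d/2\<close> and \<open>l\<close>.
      Using d/2 keeps these end points strictly inside the continuity neighbourhood.\<close>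
    define up where "up = step l (l + d/2)"
    define lo where "lo = step (l - d/2) l"
    have bup: "continuous_on UNIV up" "continuous_on UNIV lo"
      using d by (auto simp: up_def lo_def intro!: step_cont)
    have bb: "up \<in> bounded_borel R" "lo \<in> bounded_borel R"
      using bup by (auto intro: bounded_borel_continuous)
    have near: "\<bar>I (indicator {..l + d/2}) - I (indicator {..l})\<bar> < r/2"
      "\<bar>I (indicator {..l - d/2}) - I (indicator {..l})\<bar> < r/2"
      using d(1) by - (rule d(2); simp)+
    have "I up \<le> I (indicator {..l + d/2})"
      unfolding up_def using d bb by (intro positive_functional_mono[OF I]) (auto simp: up_def step_le)
    then have Iup: "I up < I (indicator {..l}) + r/2" using near(1) by linarith
    have "I (indicator {..l - d/2}) \<le> I lo"
      unfolding lo_def using d bb by (intro positive_functional_mono[OF I]) (auto simp: lo_def step_ge)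
    then have Ilo: "I lo > I (indicator {..l}) - r/2" using near(2) by linarith
    have "\<forall>\<^sub>F m in sequentially. \<bar>L m up - I up\<bar> < r/2"
      using tendstoD[OF cts[OF bup(1)], of "r/2"] r by (auto simp: dist_real_def)
    moreover have "\<forall>\<^sub>F m in sequentially. \<bar>L m lo - I lo\<bar> < r/2"
      using tendstoD[OF cts[OF bup(2)], of "r/2"] r by (auto simp: dist_real_def)
    ultimately have "\<forall>\<^sub>F m in sequentially. norm (L m (indicator {..l}) - I (indicator {..l})) < r"
    proof eventually_elim
      case (elim m)
      have "L m (indicator {..l}) \<le> L m up"
        unfolding up_def using d bb by (intro positive_functional_mono[OF Lm]) (auto simp: up_def step_ge)
      moreover have "L m lo \<le> L m (indicator {..l})"
        unfolding lo_def using d bb by (intro positive_functional_mono[OF Lm]) (auto simp: lo_def step_le)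
      ultimately show ?case using elim Iup Ilo unfolding real_norm_def by linarith
    qed
    then show "\<exists>no. \<forall>n\<ge>no. norm (L n (indicator {..l}) - I (indicator {..l})) < r"
      by (simp add: eventually_sequentially)
  qed
qed

section \<open>The Hausdorff moment problem\<close>

text \<open>The linear functional on polynomials that sends x^i to \<open>m i\<close>, also called
  the Riesz functional of the sequence.\<close>

definition poly_moment :: "(nat \<Rightarrow> real) \<Rightarrow> real poly \<Rightarrow> real" where
  "poly_moment m p = (\<Sum>i\<le>degree p. coeff p i * m i)"

lemma poly_moment_eq: "degree p \<le> n \<Longrightarrow> poly_moment m p = (\<Sum>i\<le>n. coeff p i * m i)"
  unfolding poly_moment_def by (rule sum.mono_neutral_left) (auto simp: coeff_eq_0)

lemma poly_moment_add: "poly_moment m (p + q) = poly_moment m p + poly_moment m q"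
proof -
  define n where "n = max (degree p) (degree q)"
  have "degree (p + q) \<le> n" "degree p \<le> n" "degree q \<le> n"
    by (auto simp: n_def degree_add_le_max)
  then show ?thesis by (simp add: poly_moment_eq[of _ n] algebra_simps sum.distrib)
qed

lemma poly_moment_smult: "poly_moment m (smult c p) = c * poly_moment m p"
  using poly_moment_eq[of "smult c p" "degree p" m]
  by (simp add: poly_moment_def degree_smult_le sum_distrib_left mult.assoc)

lemma poly_moment_0: "poly_moment m 0 = 0"
  by (simp add: poly_moment_def)

lemma poly_moment_sum: "finite A \<Longrightarrow> poly_moment m (\<Sum>i\<in>A. p i) = (\<Sum>i\<in>A. poly_moment m (p i))"
  by (induction A rule: finite_induct) (auto simp: poly_moment_add poly_moment_0)

lemma poly_moment_monom: "poly_moment m (monom c n) = c * m n"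
proof -
  have "poly_moment m (monom c n) = (\<Sum>i\<le>n. if n = i then c * m i else 0)"
    unfolding poly_moment_eq[OF degree_monom_le] by (intro sum.cong) auto
  then show ?thesis by simp
qed

lemma poly_moment_pCons0: "poly_moment m (pCons 0 p) = poly_moment (\<lambda>i. m (Suc i)) p"
proof -
  have "poly_moment m (pCons 0 p) = (\<Sum>i\<le>Suc (degree p). coeff (pCons 0 p) i * m i)"
    by (intro poly_moment_eq) (simp add: degree_pCons_le)
  then show ?thesis
    unfolding sum.atMost_Suc_shift by (simp add: poly_moment_def)
qed

text \<open>Bernstein basis polynomials without the binomial coefficient; nonnegativity of
  \<open>poly_moment m\<close> on all of them is Hausdorff's condition of complete
  monotonicity.\<close>

definition bernstein_poly :: "nat \<Rightarrow> nat \<Rightarrow> real poly" where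
  "bernstein_poly a b = [:0,1:] ^ a * [:1,-1:] ^ b"

lemma smult_sum_right: "smult c (\<Sum>i\<in>A. p i) = (\<Sum>i\<in>A. smult c (p i))"
  by (induction A rule: infinite_finite_induct) (auto simp: smult_add_right)

text \<open>Trinomial revision C(n,k) C(k,j) = C(n,j) C(n-j,k-j) pulls out x^j, and what remains is
  the binomial expansion of (x + (1 - x))^(n-j) = 1. In probabilistic terms this is the mean of
  C(K,j) for a binomial variable K.\<close>

lemma sum_choose_bernstein_poly:
  assumes "j \<le> n"
  shows "(\<Sum>k\<le>n. smult (real (n choose k) * real (k choose j)) (bernstein_poly k (n - k)))
       = smult (real (n choose j)) (monom 1 j)"
proof -
  let ?x = "[:0,1:] :: real poly" and ?y = "[:1,-1:] :: real poly"
  have "(\<Sum>k\<le>n. smult (real (n choose k) * real (k choose j)) (bernstein_poly k (n - k)))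
      = (\<Sum>k=j..n. smult (real (n choose k) * real (k choose j)) (bernstein_poly k (n - k)))"
    by (rule sum.mono_neutral_right) (auto simp: binomial_eq_0)
  also have "\<dots> = (\<Sum>i=0..n-j. smult (real (n choose (i+j)) * real ((i+j) choose j)) (bernstein_poly (i+j) (n - (i+j))))"
    using sum.shift_bounds_cl_nat_ivl[of "\<lambda>k. smult (real (n choose k) * real (k choose j)) (bernstein_poly k (n - k))" 0 j "n-j"] assms
    by simp
  also have "\<dots> = (\<Sum>i=0..n-j. smult (real (n choose j)) (monom 1 j * (of_nat ((n-j) choose i) * ?x ^ i * ?y ^ (n - j - i))))"
  proof (rule sum.cong[OF refl])
    fix i assume i: "i \<in> {0..n-j}"
    have "(n choose (i+j)) * ((i+j) choose j) = (n choose j) * ((n-j) choose i)"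
      using choose_mult[of j "i+j" n] i assms by simp
    then have "real (n choose (i+j)) * real ((i+j) choose j) = real (n choose j) * real ((n-j) choose i)"
      by (metis of_nat_mult)
    moreover have "bernstein_poly (i+j) (n - (i+j)) = monom 1 j * (?x ^ i * ?y ^ (n - j - i))"
      by (simp add: bernstein_poly_def power_add monom_altdef mult_ac add.commute)
    ultimately show "smult (real (n choose (i+j)) * real ((i+j) choose j)) (bernstein_poly (i+j) (n - (i+j)))
      = smult (real (n choose j)) (monom 1 j * (of_nat ((n-j) choose i) * ?x ^ i * ?y ^ (n - j - i)))"
      by (simp add: of_nat_poly mult_ac)
  qed
  also have "\<dots> = smult (real (n choose j)) (monom 1 j * (?x + ?y) ^ (n - j))"
    unfolding binomial_ring atLeast0AtMost sum_distrib_left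
    by (simp only: smult_sum_right)
  also have "?x + ?y = 1" by simp
  finally show ?thesis by simp
qed

text \<open>C(k,j) / C(n,j) is the product of (k-i) / (n-i) over i < j. These factors and k/n have
  modulus at most 1, so the two products differ by at most the sum of the j factorwise differences,
  each at most 2 j / n because n - i >= n/2.\<close>

lemma choose_ratio_approx:
  assumes k: "k \<le> n" and j: "2 * j \<le> n" and n: "0 < n"
  shows "\<bar>real (k choose j) / real (n choose j) - (real k / real n) ^ j\<bar> \<le> 2 * real j ^ 2 / real n"
proof -
  have ne: "real n - real i \<noteq> 0" if "i < j" for i using that j by linarith
  have "real (k choose j) / real (n choose j)
      = (\<Prod>i<j. real k - real i) / (\<Prod>i<j. real n - real i)"
    unfolding binomial_gbinomial gbinomial_prod_rev by (simp add: atLeast0LessThan)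
  also have "\<dots> = (\<Prod>i<j. (real k - real i) / (real n - real i))"
    by (simp add: prod_dividef)
  finally have eq: "real (k choose j) / real (n choose j) - (real k / real n) ^ j
    = (\<Prod>i<j. (real k - real i) / (real n - real i)) - (\<Prod>i<j. real k / real n)" by simp
  have "norm ((\<Prod>i<j. (real k - real i) / (real n - real i)) - (\<Prod>i<j. real k / real n))
      \<le> (\<Sum>i<j. norm ((real k - real i) / (real n - real i) - real k / real n))"
  proof (rule norm_prod_diff)
    fix i assume i: "i \<in> {..<j}"
    \<comment> \<open>For k < i the numerator is negative; 2 j <= n then gives i - k <= n -
      i.\<close>
    then have "\<bar>real k - real i\<bar> \<le> real n - real i" using k j by auto
    moreover have "i < n" using i j by auto
    ultimately show "norm ((real k - real i) / (real n - real i)) \<le> 1"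
      by (simp add: abs_divide)
    show "norm (real k / real n) \<le> 1" using k n by (simp add: divide_le_eq_1)
  qed
  also have "\<dots> \<le> (\<Sum>i<j. 2 * real j / real n)"
  proof (rule sum_mono)
    fix i assume i: "i \<in> {..<j}"
    then have pos: "real n - real i > 0" "2 * (real n - real i) \<ge> real n" using j n by auto
    have "(real k - real i) / (real n - real i) - real k / real n
        = - (real i * (real n - real k) / (real n * (real n - real i)))"
      using pos n by (simp add: field_simps)
    then have "norm ((real k - real i) / (real n - real i) - real k / real n)
        = real i * (real n - real k) / (real n * (real n - real i))"
      using pos k by (simp add: abs_divide abs_mult)
    also have "\<dots> \<le> real j * real n / (real n * (real n / 2))"
      using i k pos n by (intro frac_le mult_mono) auto
    also have "\<dots> = 2 * real j / real n" using n by simp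
    finally show "norm ((real k - real i) / (real n - real i) - real k / real n) \<le> 2 * real j / real n" .
  qed
  finally show ?thesis unfolding eq by (simp add: power2_eq_square mult_ac)
qed

text \<open>Bernstein's discretization: \<open>w n k\<close> is the probability that a solution
  measure, taken as the law of a random success rate, would give to k successes in n trials. Placing
  these masses at k/n yields tight probability measures whose moments tend to \<open>m\<close>,
  since their binomial moments are known exactly; Helly selection provides the limit.\<close>

theorem Hausdorff_moment_problem:
  fixes m :: "nat \<Rightarrow> real"
  assumes pos: "\<And>a b. 0 \<le> poly_moment m (bernstein_poly a b)" and m0: "m 0 = 1"
  obtains M where "prob_space M" "sets M = sets borel" "AE x in M. x \<in> {0..1}"
    "\<And>j. (\<integral>x. x ^ j \<partial>M) = m j"
proof -
  define w where "w n k = real (n choose k) * poly_moment m (bernstein_poly k (n - k))" for n k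
  have w0: "0 \<le> w n k" for n k by (simp add: w_def pos)
  have wsum: "(\<Sum>k\<le>n. w n k * real (k choose j)) = real (n choose j) * m j" if "j \<le> n" for n j
  proof -
    have "(\<Sum>k\<le>n. w n k * real (k choose j))
        = poly_moment m (\<Sum>k\<le>n. smult (real (n choose k) * real (k choose j)) (bernstein_poly k (n - k)))"
      by (simp add: w_def poly_moment_sum poly_moment_smult mult_ac)
    then show ?thesis
      by (simp add: sum_choose_bernstein_poly[OF that] poly_moment_smult poly_moment_monom)
  qed
  have w1: "(\<Sum>k\<le>n. w n k) = 1" for n using wsum[of 0 n] m0 by simp
  define f where "f n k = (if k \<le> n then w n k else 0)" for n k
  have nn: "(\<integral>\<^sup>+x. ennreal (f n x) \<partial>count_space UNIV) = 1" for n
  proof -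
    have "(\<integral>\<^sup>+x. ennreal (f n x) \<partial>count_space UNIV) = (\<Sum>k\<le>n. ennreal (f n k))"
      by (rule nn_integral_count_space') (auto simp: f_def)
    also have "\<dots> = ennreal (\<Sum>k\<le>n. f n k)" by (rule sum_ennreal) (auto simp: f_def w0)
    also have "(\<Sum>k\<le>n. f n k) = 1" using w1[of n] by (simp add: f_def)
    finally show ?thesis by simp
  qed
  have f0: "0 \<le> f n x" for n x by (simp add: f_def w0)
  define p where "p n = embed_pmf (f n)" for n
  have p: "pmf (p n) k = f n k" "set_pmf (p n) \<subseteq> {..n}" for n k
  proof -
    show "pmf (p n) k = f n k" unfolding p_def by (rule pmf_embed_pmf[OF f0 nn])
    show "set_pmf (p n) \<subseteq> {..n}" unfolding p_def set_embed_pmf[OF f0 nn] by (auto simp: f_def)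
  qed
  define \<mu> where "\<mu> n = distr (measure_pmf (p n)) borel (\<lambda>k. real k / real n)" for n
  have \<mu>: "real_distribution (\<mu> n)" for n
    unfolding \<mu>_def by (intro prob_space.real_distribution_distr) (auto intro: measure_pmf.prob_space_axioms)
  have int: "(\<integral>x. h x \<partial>\<mu> n) = (\<Sum>k\<le>n. h (real k / real n) * w n k)"
    if h: "h \<in> borel_measurable borel" for h :: "real \<Rightarrow> real" and n
  proof -
    have "(\<integral>x. h x \<partial>\<mu> n) = (\<integral>k. h (real k / real n) \<partial>measure_pmf (p n))"
      unfolding \<mu>_def by (rule integral_distr) (use h in auto)
    also have "\<dots> = (\<Sum>k\<le>n. h (real k / real n) * pmf (p n) k)"
      by (rule integral_measure_pmf_real) (use p(2)[of n] in auto)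
    finally show ?thesis by (simp add: p(1) f_def)
  qed
  have "tight \<mu>"
    unfolding tight_def
  proof (intro conjI allI impI \<mu>)
    fix e :: real assume e: "e > 0"
    \<comment> \<open>\<open>tight\<close> uses intervals open on the left, so the left end has to
      lie below the possible atom at 0. For n = 0 the only atom is 0/0 = 0.\<close>
    have "measure (\<mu> n) {-1<..1} = 1" for n
    proof -
      have "measure (\<mu> n) {-1<..1} = measure_pmf.prob (p n) ((\<lambda>k. real k / real n) -` {-1<..1})"
        unfolding \<mu>_def by (subst measure_distr) auto
      also have "\<dots> = 1"
        by (subst measure_pmf.prob_eq_1)
           (use p(2)[of n] in \<open>auto simp: AE_measure_pmf_iff divide_le_eq_1 intro: less_le_trans[of _ 0]\<close>)
      finally show ?thesis .
    qed
    then show "\<exists>a b. a < b \<and> (\<forall>n. 1 - e < measure (\<mu> n) {a<..b})"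
      using e by (intro exI[of _ "-1"] exI[of _ 1]) auto
  qed
  then obtain r M where r: "strict_mono (r :: nat \<Rightarrow> nat)" and M: "real_distribution M"
    and wc: "weak_conv_m (\<mu> \<circ> id \<circ> r) M"
    using tight_imp_convergent_subsubsequence[of \<mu> id] by (auto simp: strict_mono_def)
  interpret M: real_distribution M by fact
  have lim: "(\<lambda>n. \<Sum>k\<le>r n. h (real k / real (r n)) * w (r n) k) \<longlonglongrightarrow> (\<integral>x. h x \<partial>M)"
    if h: "continuous_on UNIV h" "\<And>x. norm (h x) \<le> B" for h :: "real \<Rightarrow> real" and B
  proof -
    have "(\<lambda>n. integral\<^sup>L ((\<mu> \<circ> id \<circ> r) n) h) \<longlonglongrightarrow> integral\<^sup>L M h"
    proof (rule weak_conv_imp_integral_bdd_continuous_conv[OF _ M wc])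
      show "isCont h x" for x using h(1) by (simp add: continuous_on_eq_continuous_at)
    qed (use \<mu> h in auto)
    then show ?thesis using int[OF borel_measurable_continuous_onI[OF h(1)]] by simp
  qed
  have range01: "real k / real n \<in> {0..1}" if "k \<le> n" for k n :: nat
    using that by (auto simp: divide_le_eq_1)
  have AE01: "AE x in M. x \<in> {0..1}"
  proof -
    \<comment> \<open>Bounded, continuous and zero exactly on [0,1]: its integral vanishes along the
      approximating sequence, hence in the limit.\<close>
    define h where "h x = min 1 (max (-x) (max 0 (x-1)))" for x :: real
    have hc: "continuous_on UNIV h" unfolding h_def by (intro continuous_intros)
    have hb: "norm (h x) \<le> 1" "0 \<le> h x" for x by (auto simp: h_def)
    have hm: "h \<in> borel_measurable M" using borel_measurable_continuous_onI[OF hc] by simp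
    have "h (real k / real n) = 0" if "k \<le> n" for k n
      using range01[OF that] by (auto simp: h_def)
    then have "(\<integral>x. h x \<partial>M) = 0" using lim[OF hc hb(1)] by (simp add: LIMSEQ_const_iff)
    moreover have "integrable M h"
      by (rule M.integrable_const_bound[where B=1]) (use hb hm in auto)
    ultimately have "AE x in M. h x = 0"
      using hb(2) by (subst (asm) integral_nonneg_eq_0_iff_AE) auto
    then show ?thesis by (rule eventually_mono) (auto simp: h_def max_def min_def split: if_splits)
  qed
  have "(\<integral>x. x ^ j \<partial>M) = m j" for j
  proof -
    \<comment> \<open>Weak convergence tests bounded continuous functions only, so the power is
      truncated outside [0,1], where none of these measures has mass.\<close>
    define h where "h x = (max 0 (min 1 x)) ^ j" for x :: real
    have hc: "continuous_on UNIV h" unfolding h_def by (intro continuous_intros)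
    have hb: "norm (h x) \<le> 1" for x by (auto simp: h_def intro!: power_le_one)
    have "(\<integral>x. x ^ j \<partial>M) = (\<integral>x. h x \<partial>M)"
    proof (rule integral_cong_AE)
      show "h \<in> borel_measurable M" using borel_measurable_continuous_onI[OF hc] by simp
      show "AE x in M. x ^ j = h x"
        using AE01 by (rule eventually_mono) (auto simp: h_def)
    qed simp
    moreover have "(\<lambda>n. \<Sum>k\<le>r n. h (real k / real (r n)) * w (r n) k) \<longlonglongrightarrow> m j"
    proof -
      have "(\<lambda>n. \<Sum>k\<le>n. h (real k / real n) * w n k) \<longlonglongrightarrow> m j"
      proof (rule LIM_zero_cancel, rule Lim_null_comparison)
        show "\<forall>\<^sub>F n in sequentially. norm ((\<Sum>k\<le>n. h (real k / real n) * w n k) - m j) \<le> 2 * real j ^ 2 / real n"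
        \<comment> \<open>From here on both 2 j <= n and 0 < n hold, as
          \<open>choose_ratio_approx\<close> requires.\<close>
        proof (rule eventually_sequentiallyI[of "2 * j + 1"])
          fix n assume n: "2 * j + 1 \<le> n"
          have c: "real (n choose j) > 0" using n by simp
          have "m j = (\<Sum>k\<le>n. w n k * (real (k choose j) / real (n choose j)))"
            using wsum[of j n] n c by (simp add: field_simps sum_divide_distrib[symmetric])
          then have "(\<Sum>k\<le>n. h (real k / real n) * w n k) - m j
            = (\<Sum>k\<le>n. w n k * (h (real k / real n) - real (k choose j) / real (n choose j)))"
            by (simp add: sum_subtractf algebra_simps)
          also have "norm \<dots> \<le> (\<Sum>k\<le>n. w n k * (2 * real j ^ 2 / real n))"
          proof (rule sum_norm_le)
            fix k assume k: "k \<in> {..n}"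
            have "h (real k / real n) = (real k / real n) ^ j"
              using range01[of k n] k by (simp add: h_def)
            then have "\<bar>h (real k / real n) - real (k choose j) / real (n choose j)\<bar> \<le> 2 * real j ^ 2 / real n"
              using choose_ratio_approx[of k n j] k n by (simp add: abs_minus_commute)
            then show "norm (w n k * (h (real k / real n) - real (k choose j) / real (n choose j)))
               \<le> w n k * (2 * real j ^ 2 / real n)"
              using w0[of n k] by (simp only: real_norm_def abs_mult abs_of_nonneg mult_left_mono)
          qed
          also have "\<dots> = 2 * real j ^ 2 / real n"
            using w1[of n] by (simp only: sum_distrib_right[symmetric] mult_1)
          finally show "norm ((\<Sum>k\<le>n. h (real k / real n) * w n k) - m j) \<le> 2 * real j ^ 2 / real n" .
        qed
        show "(\<lambda>n. 2 * real j ^ 2 / real n) \<longlonglongrightarrow> 0"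
          by (intro tendsto_divide_0[OF tendsto_const] filterlim_real_sequentially[THEN filterlim_at_top_imp_at_infinity])
      qed
      from LIMSEQ_subseq_LIMSEQ[OF this r] show ?thesis by (simp add: o_def)
    qed
    ultimately show ?thesis using lim[OF hc hb] LIMSEQ_unique by force
  qed
  then show ?thesis using that AE01 M.prob_space_axioms M.events_eq_borel by blast
qed

section \<open>Square-summable functions and spectral measures\<close>

definition ell2_sq :: "'v set \<Rightarrow> ('v \<Rightarrow> complex) \<Rightarrow> real" where
  "ell2_sq V f = Re (ell2_inner V f f)"

lemma ell2_zero_outside: "f \<in> ell2 V \<Longrightarrow> v \<notin> V \<Longrightarrow> f v = 0"
  by (simp add: ell2_def)

lemma ell2_summable: "f \<in> ell2 V \<Longrightarrow> (\<lambda>v. (cmod (f v))\<^sup>2) summable_on V"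
  by (simp add: ell2_def)

lemma ell2_inner_summable:
  assumes "f \<in> ell2 V" "g \<in> ell2 V"
  shows "(\<lambda>v. f v * cnj (g v)) summable_on V"
proof (rule abs_summable_summable, rule Infinite_Sum.abs_summable_on_comparison_test')
  show "(\<lambda>v. (cmod (f v))\<^sup>2 + (cmod (g v))\<^sup>2) summable_on V"
    using assms by (intro summable_on_add ell2_summable)
  show "norm (f v * cnj (g v)) \<le> (cmod (f v))\<^sup>2 + (cmod (g v))\<^sup>2" for v
    using sum_squares_bound[of "cmod (f v)" "cmod (g v)"]
      mult_nonneg_nonneg[OF norm_ge_zero norm_ge_zero, of "f v" "g v"]
    unfolding norm_mult complex_mod_cnj by linarith
qed

lemma ell2_add:
  assumes "f \<in> ell2 V" "g \<in> ell2 V" shows "(\<lambda>v. f v + g v) \<in> ell2 V"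
proof -
  have "(\<lambda>v. 2 * (cmod (f v))\<^sup>2 + 2 * (cmod (g v))\<^sup>2) summable_on V"
    using assms by (intro summable_on_add summable_on_cmult_right ell2_summable)
  moreover have "(cmod (f v + g v))\<^sup>2 \<le> 2 * (cmod (f v))\<^sup>2 + 2 * (cmod (g v))\<^sup>2" for v
  proof -
    have "(cmod (f v + g v))\<^sup>2 \<le> (cmod (f v) + cmod (g v))\<^sup>2"
      by (intro power_mono norm_triangle_ineq) auto
    also have "\<dots> \<le> 2 * (cmod (f v))\<^sup>2 + 2 * (cmod (g v))\<^sup>2"
      using sum_squares_bound[of "cmod (f v)" "cmod (g v)"] by (simp add: power2_sum)
    finally show ?thesis .
  qed
  ultimately have "(\<lambda>v. (cmod (f v + g v))\<^sup>2) summable_on V"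
    by (rule summable_on_comparison_test) auto
  then show ?thesis using assms by (simp add: ell2_def)
qed

lemma ell2_scale:
  assumes "f \<in> ell2 V" shows "(\<lambda>v. c * f v) \<in> ell2 V"
  using summable_on_cmult_right[OF ell2_summable[OF assms], of "(cmod c)\<^sup>2"] assms
  by (simp add: ell2_def norm_mult power_mult_distrib)

lemma ell2_diff:
  assumes "f \<in> ell2 V" "g \<in> ell2 V" shows "(\<lambda>v. f v - g v) \<in> ell2 V"
  using ell2_add[OF assms(1) ell2_scale[OF assms(2), of "-1"]] by simp

lemma ell2_zero [simp]: "(\<lambda>v. 0) \<in> ell2 V"
  by (simp add: ell2_def)

lemma ell2_finite_support:
  assumes "finite W" "W \<subseteq> V" "\<And>v. v \<notin> W \<Longrightarrow> f v = 0" shows "f \<in> ell2 V"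
proof -
  have "(\<lambda>v. (cmod (f v))\<^sup>2) summable_on V \<longleftrightarrow> (\<lambda>v. (cmod (f v))\<^sup>2) summable_on W"
    using assms by (intro summable_on_cong_neutral) auto
  then show ?thesis using assms by (auto simp: ell2_def)
qed

lemma ell2_delta [simp]: "v \<in> V \<Longrightarrow> delta_fun v \<in> ell2 V"
  by (rule ell2_finite_support[of "{v}"]) (auto simp: delta_fun_def)

lemma ell2_inner_finite_support:
  assumes "finite W" "W \<subseteq> V" "\<And>v. v \<in> V - W \<Longrightarrow> f v * cnj (g v) = 0"
  shows "ell2_inner V f g = (\<Sum>v\<in>W. f v * cnj (g v))"
proof -
  have "ell2_inner V f g = (\<Sum>\<^sub>\<infinity>v\<in>W. f v * cnj (g v))"
    unfolding ell2_inner_def by (rule infsum_cong_neutral) (use assms in auto)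
  then show ?thesis using assms(1) by simp
qed

lemma ell2_inner_delta: "v \<in> V \<Longrightarrow> ell2_inner V f (delta_fun v) = f v"
  by (subst ell2_inner_finite_support[of "{v}"]) (auto simp: delta_fun_def)

lemma ell2_inner_add_left:
  "f \<in> ell2 V \<Longrightarrow> g \<in> ell2 V \<Longrightarrow> h \<in> ell2 V \<Longrightarrow>
    ell2_inner V (\<lambda>v. f v + g v) h = ell2_inner V f h + ell2_inner V g h"
  unfolding ell2_inner_def
  by (subst infsum_add[symmetric]) (auto simp: ell2_inner_summable algebra_simps)

lemma ell2_inner_scale_left:
  "f \<in> ell2 V \<Longrightarrow> h \<in> ell2 V \<Longrightarrow> ell2_inner V (\<lambda>v. c * f v) h = c * ell2_inner V f h"
  unfolding ell2_inner_def
  by (subst infsum_cmult_right[symmetric]) (auto simp: ell2_inner_summable mult.assoc)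

lemma ell2_inner_cnj: "ell2_inner V g f = cnj (ell2_inner V f g)"
  unfolding ell2_inner_def by (simp add: infsum_cnj[symmetric] mult.commute del: infsum_cnj)

lemma ell2_inner_add_right:
  "f \<in> ell2 V \<Longrightarrow> g \<in> ell2 V \<Longrightarrow> h \<in> ell2 V \<Longrightarrow>
    ell2_inner V h (\<lambda>v. f v + g v) = ell2_inner V h f + ell2_inner V h g"
  by (simp add: ell2_inner_cnj[of V h] ell2_inner_add_left)

lemma ell2_inner_scale_right:
  "f \<in> ell2 V \<Longrightarrow> h \<in> ell2 V \<Longrightarrow> ell2_inner V h (\<lambda>v. c * f v) = cnj c * ell2_inner V h f"
  by (simp add: ell2_inner_cnj[of V h] ell2_inner_scale_left)

lemma ell2_inner_diff_left:
  assumes "f \<in> ell2 V" "g \<in> ell2 V" "h \<in> ell2 V"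
  shows "ell2_inner V (\<lambda>v. f v - g v) h = ell2_inner V f h - ell2_inner V g h"
  using ell2_inner_add_left[OF assms(1) ell2_scale[OF assms(2), of "-1"] assms(3)]
    ell2_inner_scale_left[OF assms(2,3), of "-1"] by simp

lemma ell2_inner_diff_right:
  assumes "f \<in> ell2 V" "g \<in> ell2 V" "h \<in> ell2 V"
  shows "ell2_inner V h (\<lambda>v. f v - g v) = ell2_inner V h f - ell2_inner V h g"
  using assms by (simp add: ell2_inner_cnj[of V h] ell2_inner_diff_left)

lemma ell2_inner_zero [simp]: "ell2_inner V (\<lambda>v. 0) g = 0" "ell2_inner V g (\<lambda>v. 0) = 0"
  by (simp_all add: ell2_inner_def)

text \<open>True for every \<open>f\<close>: without summability both infinite sums take the default
  value 0.\<close>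

lemma ell2_inner_self: "ell2_inner V f f = complex_of_real (\<Sum>\<^sub>\<infinity>v\<in>V. (cmod (f v))\<^sup>2)"
proof (cases "(\<lambda>v. (cmod (f v))\<^sup>2) summable_on V")
  case True
  then show ?thesis
    unfolding ell2_inner_def complex_norm_square[symmetric]
    by (intro infsumI has_sum_of_real has_sum_infsum)
next
  case False
  then have "\<not> (\<lambda>v. complex_of_real ((cmod (f v))\<^sup>2)) summable_on V"
    using summable_on_Re[of "\<lambda>v. complex_of_real ((cmod (f v))\<^sup>2)" V] by auto
  then show ?thesis
    using False unfolding ell2_inner_def complex_norm_square[symmetric]
    by (simp add: infsum_not_exists del: of_real_power)
qed

lemma ell2_sq_eq: "ell2_sq V f = (\<Sum>\<^sub>\<infinity>v\<in>V. (cmod (f v))\<^sup>2)"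
  by (simp add: ell2_sq_def ell2_inner_self)

lemma ell2_inner_self_sq: "ell2_inner V f f = complex_of_real (ell2_sq V f)"
  by (simp add: ell2_sq_eq ell2_inner_self)

lemma ell2_sq_nonneg [simp]: "0 \<le> ell2_sq V f"
  unfolding ell2_sq_eq by (rule infsum_nonneg) auto

lemma ell2_sq_scale: "ell2_sq V (\<lambda>v. c * f v) = (cmod c)\<^sup>2 * ell2_sq V f"
  unfolding ell2_sq_eq by (simp add: norm_mult power_mult_distrib infsum_cmult_right')

lemma ell2_sq_delta [simp]: "v \<in> V \<Longrightarrow> ell2_sq V (delta_fun v) = 1"
  by (simp add: ell2_sq_def ell2_inner_delta) (simp add: delta_fun_def)

lemma ell2_sq_eq_0:
  assumes "f \<in> ell2 V" "ell2_sq V f = 0" shows "f = (\<lambda>v. 0)"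
proof
  fix v show "f v = 0"
  proof (cases "v \<in> V")
    case True
    have "(cmod (f v))\<^sup>2 = 0"
      by (rule nonneg_infsum_le_0D[of "\<lambda>v. (cmod (f v))\<^sup>2" V])
         (use assms True in \<open>auto simp: ell2_sq_eq ell2_summable\<close>)
    then show ?thesis by simp
  qed (use assms(1) in \<open>simp add: ell2_zero_outside\<close>)
qed

lemma ell2_eqI:
  assumes "f \<in> ell2 V" "g \<in> ell2 V" "\<And>h. h \<in> ell2 V \<Longrightarrow> ell2_inner V f h = ell2_inner V g h"
  shows "f = g"
proof
  fix v show "f v = g v"
    using assms(3)[of "delta_fun v"] ell2_zero_outside[OF assms(1)] ell2_zero_outside[OF assms(2)]
    by (cases "v \<in> V") (auto simp: ell2_inner_delta)
qed

section \<open>Linear maps on square-summable functions and polarization\<close>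

definition ell2_linear :: "'v set \<Rightarrow> (('v \<Rightarrow> complex) \<Rightarrow> ('v \<Rightarrow> complex)) \<Rightarrow> bool" where
  "ell2_linear V A \<longleftrightarrow>
     (\<forall>f\<in>ell2 V. A f \<in> ell2 V) \<and>
     (\<forall>f\<in>ell2 V. \<forall>g\<in>ell2 V. A (\<lambda>v. f v + g v) = (\<lambda>v. A f v + A g v)) \<and>
     (\<forall>c. \<forall>f\<in>ell2 V. A (\<lambda>v. c * f v) = (\<lambda>v. c * A f v))"

lemma
  assumes "ell2_linear V A" "f \<in> ell2 V"
  shows ell2_linear_closed: "A f \<in> ell2 V"
    and ell2_linear_scale: "A (\<lambda>v. c * f v) = (\<lambda>v. c * A f v)"
    and ell2_linear_add: "g \<in> ell2 V \<Longrightarrow> A (\<lambda>v. f v + g v) = (\<lambda>v. A f v + A g v)"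
  using assms unfolding ell2_linear_def by blast+

lemma ell2_linear_diff:
  assumes "ell2_linear V A" "f \<in> ell2 V" "g \<in> ell2 V"
  shows "A (\<lambda>v. f v - g v) = (\<lambda>v. A f v - A g v)"
  using ell2_linear_add[OF assms(1,2) ell2_scale[OF assms(3), of "-1"]]
    ell2_linear_scale[OF assms(1,3), of "-1"] by simp

lemma ell2_linear_funpow: "ell2_linear V A \<Longrightarrow> ell2_linear V (A ^^ n)"
  by (induction n) (auto simp: ell2_linear_def)

text \<open>\<open>Q\<close> is an arbitrary real-valued function because it will be the value of a
  diagonal functional on a fixed integrand, which is not yet known to be a quadratic form in the
  vector.\<close>

definition polar :: "(('v \<Rightarrow> complex) \<Rightarrow> real) \<Rightarrow> ('v \<Rightarrow> complex) \<Rightarrow> ('v \<Rightarrow> complex) \<Rightarrow> complex" where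
  "polar Q f g = (of_real (Q (\<lambda>v. f v + g v)) - of_real (Q (\<lambda>v. f v - g v))
      + \<i> * of_real (Q (\<lambda>v. f v + \<i> * g v)) - \<i> * of_real (Q (\<lambda>v. f v - \<i> * g v))) / 4"

lemma polarization:
  assumes A: "ell2_linear V A" and real: "\<And>f. f \<in> ell2 V \<Longrightarrow> Im (ell2_inner V (A f) f) = 0"
    and Q: "\<And>f. f \<in> ell2 V \<Longrightarrow> Q f = Re (ell2_inner V (A f) f)"
    and fg: "f \<in> ell2 V" "g \<in> ell2 V"
  shows "polar Q f g = ell2_inner V (A f) g"
proof -
  have Q': "of_real (Q h) = ell2_inner V (A h) h" if "h \<in> ell2 V" for h
    using Q[OF that] real[OF that] by (simp add: complex_eq_iff)
  note ig = ell2_scale[OF fg(2), of \<i>]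
  note cl = ell2_linear_closed[OF A]
  show ?thesis
    unfolding polar_def
    using fg ig
    by (simp add: Q' ell2_add ell2_diff ell2_linear_add[OF A] ell2_linear_diff[OF A] ell2_linear_scale[OF A]
        ell2_inner_add_left ell2_inner_diff_left ell2_inner_add_right ell2_inner_diff_right cl
        ell2_inner_scale_left ell2_inner_scale_right ell2_scale)
      (simp add: algebra_simps)
qed

lemma measure_functional_polar:
  assumes J: "\<And>f. f \<in> ell2 V \<Longrightarrow> measure_functional R (J f)" and fg: "f \<in> ell2 V" "g \<in> ell2 V"
  shows "measure_functional R (\<lambda>h. polar (\<lambda>f. J f h) f g)"
proof -
  have eq: "(\<lambda>h. polar (\<lambda>f. J f h) f g) =
    (\<lambda>h. (1/4) * (((of_real (J (\<lambda>v. f v + g v) h) - of_real (J (\<lambda>v. f v - g v) h))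
      + \<i> * of_real (J (\<lambda>v. f v + \<i> * g v) h)) - \<i> * of_real (J (\<lambda>v. f v - \<i> * g v) h)))"
    by (simp add: polar_def)
  show ?thesis
    unfolding eq using fg ell2_scale[OF fg(2), of \<i>]
    by (intro mf_cmult mf_minus mf_plus mf_of_real J ell2_add ell2_diff) auto
qed

section \<open>Projection-valued measures and their diagonal functionals\<close>

definition spectral_support :: "'v set \<Rightarrow> (real set \<Rightarrow> ('v \<Rightarrow> complex) \<Rightarrow> ('v \<Rightarrow> complex)) \<Rightarrow> real \<Rightarrow> bool" where
  "spectral_support V P R \<longleftrightarrow> (\<forall>f\<in>ell2 V. P {-R..R} f = f)"

context
  fixes V :: "'v set" and P
  assumes P: "projection_valued_measure V P"
begin

lemma pvm_projection: "B \<in> sets borel \<Longrightarrow> orthogonal_projection V (P B)"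
  using P unfolding projection_valued_measure_def by blast

lemma pvm_linear: "B \<in> sets borel \<Longrightarrow> ell2_linear V (P B)"
  using pvm_projection[of B] unfolding orthogonal_projection_def bounded_operator_def ell2_linear_def by blast

lemma pvm_closed: "B \<in> sets borel \<Longrightarrow> f \<in> ell2 V \<Longrightarrow> P B f \<in> ell2 V"
  using ell2_linear_closed[OF pvm_linear] .

lemma pvm_Int: "B \<in> sets borel \<Longrightarrow> C \<in> sets borel \<Longrightarrow> f \<in> ell2 V \<Longrightarrow> P B (P C f) = P (B \<inter> C) f"
  using P unfolding projection_valued_measure_def by auto

lemma pvm_sym: "B \<in> sets borel \<Longrightarrow> f \<in> ell2 V \<Longrightarrow> g \<in> ell2 V \<Longrightarrow>
    ell2_inner V (P B f) g = ell2_inner V f (P B g)"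
  using pvm_projection[of B] unfolding orthogonal_projection_def by blast

lemma pvm_UNIV: "f \<in> ell2 V \<Longrightarrow> P UNIV f = f"
  using P unfolding projection_valued_measure_def by blast

lemma pvm_sums: "(\<And>n::nat. B n \<in> sets borel) \<Longrightarrow> disjoint_family B \<Longrightarrow> f \<in> ell2 V \<Longrightarrow> g \<in> ell2 V \<Longrightarrow>
    (\<lambda>n. ell2_inner V (P (B n) f) g) sums ell2_inner V (P (\<Union>n. B n) f) g"
  using P unfolding projection_valued_measure_def by blast

lemma pvm_form: "B \<in> sets borel \<Longrightarrow> f \<in> ell2 V \<Longrightarrow> ell2_inner V (P B f) f = of_real (ell2_sq V (P B f))"
  using pvm_sym[of B f "P B f"] pvm_Int[of B B f] pvm_closed[of B f]
    pvm_sym[of B "P B f" f] ell2_inner_self_sq[of V "P B f"]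
  by simp

lemma diagonal_measure:
  assumes f: "f \<in> ell2 V"
  shows "sets (diagonal_measure V P f) = sets borel" (is ?s)
    and "B \<in> sets borel \<Longrightarrow> emeasure (diagonal_measure V P f) B = ennreal (Re (ell2_inner V (P B f) f))"
    and "finite_measure (diagonal_measure V P f)"
proof -
  define M where "M = diagonal_measure V P f"
  have nonneg: "0 \<le> Re (ell2_inner V (P B f) f)" if "B \<in> sets borel" for B
    using pvm_form[OF that f] by simp
  \<comment> \<open>No clause of the definition treats the empty set; countable additivity over
    copies of it makes a constant series converge, so the constant is 0.\<close>
  have empty: "Re (ell2_inner V (P {} f) f) = 0"
  proof -
    have "(\<lambda>n::nat. ell2_inner V (P {} f) f) sums ell2_inner V (P {} f) f"
      using pvm_sums[of "\<lambda>n. {}" f f] f by (simp add: disjoint_family_on_def)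
    then have "(\<lambda>n::nat. ell2_inner V (P {} f) f) \<longlonglongrightarrow> 0" by (intro summable_LIMSEQ_zero sums_summable)
    then show ?thesis by (simp add: LIMSEQ_const_iff)
  qed
  have s: "sets M = sets borel"
    unfolding M_def diagonal_measure_def
    by (subst sets_measure_of) (auto simp: sets.sigma_sets_eq[of borel, unfolded space_borel])
  show ?s using s unfolding M_def .
  have em: "emeasure M B = ennreal (Re (ell2_inner V (P B f) f))" if "B \<in> sets borel" for B
  proof (rule emeasure_measure_of[OF diagonal_measure_def[of V P f, folded M_def]])
    show "positive (sets M) (\<lambda>B. ennreal (Re (ell2_inner V (P B f) f)))"
      by (simp add: positive_def empty)
    show "countably_additive (sets M) (\<lambda>B. ennreal (Re (ell2_inner V (P B f) f)))"
    proof (rule countably_additiveI)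
      fix B :: "nat \<Rightarrow> real set" assume B: "range B \<subseteq> sets M" "disjoint_family B"
      have *: "(\<lambda>n. Re (ell2_inner V (P (B n) f) f)) sums Re (ell2_inner V (P (\<Union>n. B n) f) f)"
        by (rule sums_Re, rule pvm_sums) (use B f in \<open>auto simp: s\<close>)
      then show "(\<Sum>i. ennreal (Re (ell2_inner V (P (B i) f) f))) = ennreal (Re (ell2_inner V (P (\<Union>i. B i) f) f))"
        by (rule suminf_ennreal_eq[rotated]) (use B in \<open>auto simp: s intro!: nonneg\<close>)
    qed
  qed (use that s in auto)
  then show "B \<in> sets borel \<Longrightarrow> emeasure (diagonal_measure V P f) B = ennreal (Re (ell2_inner V (P B f) f))"
    by (simp add: M_def)
  show "finite_measure (diagonal_measure V P f)"
    using em[of UNIV] by (intro finite_measureI) (simp add: M_def[symmetric] sets_eq_imp_space_eq[OF s])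
qed

lemma diagonal_functional:
  assumes f: "f \<in> ell2 V" and R: "spectral_support V P R"
  defines "J \<equiv> \<lambda>h. \<integral>t. h t \<partial>diagonal_measure V P f"
  shows "measure_functional R J"
    and "B \<in> sets borel \<Longrightarrow> J (indicator B) = Re (ell2_inner V (P B f) f)"
proof -
  define M where "M = diagonal_measure V P f"
  interpret M: finite_measure M using diagonal_measure(3)[OF f] by (simp add: M_def)
  have sM: "sets M = sets borel" using diagonal_measure(1)[OF f] by (simp add: M_def)
  have spM: "space M = UNIV" using sets_eq_imp_space_eq[OF sM] by simp
  have meas: "measure M B = Re (ell2_inner V (P B f) f)" if "B \<in> sets borel" for B
    unfolding measure_def M_def using diagonal_measure(2)[OF f that] pvm_form[OF that f] by simp
  show "J (indicator B) = Re (ell2_inner V (P B f) f)" if "B \<in> sets borel"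
    unfolding J_def M_def[symmetric] using meas[OF that] that by (simp add: spM sM)
  have "measure M {-R..R} = measure M (space M)"
    using R f pvm_UNIV[OF f] meas[of UNIV] meas[of "{-R..R}"] by (simp add: spectral_support_def spM)
  then have "measure M (space M - {-R..R}) = 0"
    by (subst M.finite_measure_compl) (auto simp: sM)
  then have "AE x in M. x \<in> {-R..R}"
    by (intro AE_I[of _ _ "space M - {-R..R}"]) (auto simp: M.emeasure_eq_measure sM spM)
  then show "measure_functional R J"
    unfolding J_def M_def[symmetric] by (intro measure_functional_integral sM M.finite_measure_axioms)
qed

end

text \<open>A spectral measure recovers the moments \<open>\<langle>A\<^sup>n f, f\<rangle>\<close>: with \<open>\<Phi> f g\<close> the complex measure
  \<open>B \<mapsto> \<langle>P(B) f, g\<rangle>\<close>, multiplicativity of \<open>P\<close> gives \<open>\<Phi> (A f) g = t \<cdot> \<Phi> f g\<close>.\<close>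

lemma spectral_measure_moments:
  assumes A: "ell2_linear V A" and A_real: "\<And>f. f \<in> ell2 V \<Longrightarrow> Im (ell2_inner V (A f) f) = 0"
    and P: "is_spectral_measure V A P" and R: "spectral_support V P R" and f: "f \<in> ell2 V"
  shows "(\<integral>t. t ^ n \<partial>diagonal_measure V P f) = Re (ell2_inner V ((A ^^ n) f) f)"
proof -
  have pvm: "projection_valued_measure V P" using P by (simp add: is_spectral_measure_def)
  define J where "J f h = (\<integral>t. h t \<partial>diagonal_measure V P f)" for f and h :: "real \<Rightarrow> real"
  have J: "measure_functional R (J f)" "\<And>B. B \<in> sets borel \<Longrightarrow> J f (indicator B) = Re (ell2_inner V (P B f) f)"
    if "f \<in> ell2 V" for f
    using diagonal_functional[OF pvm that R] unfolding J_def by auto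
  have J_id: "J f (\<lambda>t. t) = Re (ell2_inner V (A f) f)" if "f \<in> ell2 V" for f
    using P that unfolding is_spectral_measure_def J_def by (metis Re_complex_of_real)
  define \<Phi> where "\<Phi> f g h = polar (\<lambda>f. J f h) f g" for f g h
  have \<Phi>: "measure_functional R (\<Phi> f g)" if "f \<in> ell2 V" "g \<in> ell2 V" for f g
    unfolding \<Phi>_def by (rule measure_functional_polar[OF J(1)]) (use that in auto)
  have \<Phi>_ind: "\<Phi> f g (indicator B) = ell2_inner V (P B f) g"
    if "f \<in> ell2 V" "g \<in> ell2 V" "B \<in> sets borel" for f g B
    unfolding \<Phi>_def
    by (rule polarization[OF pvm_linear[OF pvm]]) (use that J in \<open>auto simp: pvm_form[OF pvm]\<close>)
  have \<Phi>_id: "\<Phi> f g (\<lambda>t. t) = ell2_inner V (A f) g" if "f \<in> ell2 V" "g \<in> ell2 V" for f g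
    unfolding \<Phi>_def by (rule polarization[OF A A_real]) (use that in \<open>auto simp: J_id\<close>)
  \<comment> \<open>Self-adjointness and multiplicativity of \<open>P\<close> let a projection on
    the right enter as a density. With h = t this expresses <A f, P(C) g> through the measure of the
    pair (f, g).\<close>
  have step1: "\<Phi> f (P C g) h = \<Phi> f g (\<lambda>t. indicator C t * h t)"
    if f: "f \<in> ell2 V" and g: "g \<in> ell2 V" and C: "C \<in> sets borel" and h: "h \<in> bounded_borel R" for f g C h
  proof -
    have Pg: "P C g \<in> ell2 V" using pvm_closed[OF pvm C g] .
    show ?thesis
    proof (rule measure_functional_eqI_indicator[OF \<Phi> mf_weight[OF \<Phi>] _ h])
      fix B :: "real set" assume B: "B \<in> sets borel"
      have "(\<lambda>t. indicator C t * indicator B t) = (indicator (C \<inter> B) :: real \<Rightarrow> real)"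
        by (auto simp: indicator_def)
      then show "\<Phi> f (P C g) (indicator B) = \<Phi> f g (\<lambda>t. indicator C t * indicator B t)"
        using f g B C Pg pvm_sym[OF pvm C pvm_closed[OF pvm B f] g] pvm_Int[OF pvm C B f]
        by (simp add: \<Phi>_ind)
    qed (use f g Pg C in auto)
  qed
  have step2: "\<Phi> (A f) g h = \<Phi> f g (\<lambda>t. t * h t)"
    if f: "f \<in> ell2 V" and g: "g \<in> ell2 V" and h: "h \<in> bounded_borel R" for f g h
  proof -
    have Af: "A f \<in> ell2 V" using ell2_linear_closed[OF A f] .
    show ?thesis
    proof (rule measure_functional_eqI_indicator[OF \<Phi> mf_weight[OF \<Phi>] _ h])
      fix C :: "real set" assume C: "C \<in> sets borel"
      have "\<Phi> (A f) g (indicator C) = ell2_inner V (A f) (P C g)"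
        using \<Phi>_ind[OF Af g C] pvm_sym[OF pvm C Af g] by simp
      also have "\<dots> = \<Phi> f (P C g) (\<lambda>t. t)"
        using \<Phi>_id[OF f pvm_closed[OF pvm C g]] by simp
      also have "\<dots> = \<Phi> f g (\<lambda>t. t * indicator C t)"
        using step1[OF f g C, of "\<lambda>t. t"] by (simp add: mult.commute)
      finally show "\<Phi> (A f) g (indicator C) = \<Phi> f g (\<lambda>t. t * indicator C t)" .
    qed (use f g Af in auto)
  qed
  have mom: "\<Phi> f g (\<lambda>t. t ^ n) = ell2_inner V ((A ^^ n) f) g" if "f \<in> ell2 V" "g \<in> ell2 V" for f g n
    using that(1)
  proof (induction n arbitrary: f)
    case 0
    then show ?case using \<Phi>_ind[of f g UNIV] that(2) pvm_UNIV[OF pvm] by (simp add: indicator_def)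
  next
    case (Suc n)
    have "\<Phi> f g (\<lambda>t. t ^ Suc n) = \<Phi> (A f) g (\<lambda>t. t ^ n)"
      using step2[OF Suc.prems that(2), of "\<lambda>t. t ^ n"] by simp
    also have "\<dots> = ell2_inner V ((A ^^ n) (A f)) g"
      using Suc ell2_linear_closed[OF A] by blast
    finally show ?case by (simp add: funpow_swap1)
  qed
  have "\<Phi> f f (\<lambda>t. t ^ n) = of_real (J f (\<lambda>t. t ^ n))"
  proof (rule measure_functional_eqI_indicator[OF \<Phi> mf_of_real[OF J(1)] _ bounded_borel_power])
    show "\<Phi> f f (indicator B) = complex_of_real (J f (indicator B))" if "B \<in> sets borel" for B
      using \<Phi>_ind[OF f f that] J(2)[OF f that] pvm_form[OF pvm that f] by simp
  qed (use f in auto)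
  then have "complex_of_real (J f (\<lambda>t. t ^ n)) = ell2_inner V ((A ^^ n) f) f"
    using mom[OF f f] by simp
  then show ?thesis unfolding J_def by (metis Re_complex_of_real)
qed

section \<open>The spectral theorem for positive bounded operators\<close>

text \<open>The condition 0 <= A <= c on quadratic forms, the shape in which positivity of the
  Bernstein expressions in A/c is proved.\<close>

locale psd_operator =
  fixes V :: "'v set" and A :: "('v \<Rightarrow> complex) \<Rightarrow> 'v \<Rightarrow> complex" and c :: real
  assumes c_pos: "0 < c" and linear: "ell2_linear V A"
    and sym: "\<And>f g. f \<in> ell2 V \<Longrightarrow> g \<in> ell2 V \<Longrightarrow> ell2_inner V (A f) g = ell2_inner V f (A g)"
    and nonneg: "\<And>f. f \<in> ell2 V \<Longrightarrow> 0 \<le> Re (ell2_inner V (A f) f)"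
    and le: "\<And>f. f \<in> ell2 V \<Longrightarrow> Re (ell2_inner V (A f) f) \<le> c * ell2_sq V f"
begin

section \<open>Moments of a positive operator\<close>

lemmas closed = ell2_linear_closed[OF linear]
lemmas linear_pow = ell2_linear_funpow[OF linear]
lemmas closed_pow = ell2_linear_closed[OF linear_pow]

lemma sym_pow: "f \<in> ell2 V \<Longrightarrow> g \<in> ell2 V \<Longrightarrow> ell2_inner V ((A ^^ n) f) g = ell2_inner V f ((A ^^ n) g)"
  by (induction n arbitrary: f g) (auto simp: sym closed_pow closed funpow_swap1)

lemma pow_real:
  assumes "f \<in> ell2 V" shows "Im (ell2_inner V ((A ^^ n) f) f) = 0"
proof -
  have "cnj (ell2_inner V ((A ^^ n) f) f) = ell2_inner V ((A ^^ n) f) f"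
    using sym_pow[OF assms assms, of n] by (simp add: ell2_inner_cnj[of V f "(A ^^ n) f"])
  then show ?thesis by (simp add: complex_eq_iff)
qed

lemma A_real: "f \<in> ell2 V \<Longrightarrow> Im (ell2_inner V (A f) f) = 0"
  using pow_real[of f 1] by simp

definition moment :: "('v \<Rightarrow> complex) \<Rightarrow> nat \<Rightarrow> real" where
  "moment f n = Re (ell2_inner V ((A ^^ n) f) f)"

lemma moment_0: "moment f 0 = ell2_sq V f"
  by (simp add: moment_def ell2_sq_def)

text \<open>One factor \<open>A\<close> moves to the right-hand argument: this is how a factor x^2
  is absorbed into the vector.\<close>

lemma moment_shift2: "f \<in> ell2 V \<Longrightarrow> moment f (Suc (Suc n)) = moment (A f) n"
  by (simp add: moment_def funpow_swap1 sym closed closed_pow)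
     (simp add: funpow_swap1[symmetric] sym[symmetric] closed closed_pow)

text \<open>Passing to (1 - r A) f inserts the density (1 - r t)^2; with r = 1/c this absorbs a
  factor (1 - x)^2 on the scale of [0,1].\<close>

lemma moment_diff:
  fixes r :: real
  assumes f: "f \<in> ell2 V"
  shows "moment (\<lambda>v. f v - of_real r * A f v) n = moment f n - 2 * r * moment f (Suc n) + r\<^sup>2 * moment f (Suc (Suc n))"
proof -
  let ?B = "A ^^ n"
  have Af: "A f \<in> ell2 V" using closed[OF f] .
  have 1: "?B (\<lambda>v. f v - of_real r * A f v) = (\<lambda>v. ?B f v - of_real r * ?B (A f) v)"
    using ell2_linear_diff[OF linear_pow[of n] f ell2_scale[OF Af]] ell2_linear_scale[OF linear_pow[of n] Af] by simp
  have 2: "ell2_inner V (?B (A f)) f = ell2_inner V (?B f) (A f)"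
    using sym[OF closed_pow[OF f] f] by (simp add: funpow_swap1)
  have "ell2_inner V (?B (\<lambda>v. f v - of_real r * A f v)) (\<lambda>v. f v - of_real r * A f v)
    = ell2_inner V (?B f) f - r * ell2_inner V (?B (A f)) f - r * ell2_inner V (?B f) (A f)
      + r * (r * ell2_inner V (?B (A f)) (A f))"
    unfolding 1
    by (simp add: ell2_inner_diff_left ell2_inner_diff_right ell2_inner_scale_left ell2_inner_scale_right
        f Af closed_pow ell2_scale ell2_diff algebra_simps)
  from arg_cong[OF this, of Re] show ?thesis
    using moment_shift2[OF f, of n]
    by (simp add: moment_def 2[symmetric] funpow_swap1 power2_eq_square algebra_simps)
qed

text \<open>
  Even exponents are absorbed by symmetry of \<open>A\<close>; the mixed case uses
  \<open>x (1 - x) = x\<^sup>2 (1 - x) + (1 - x)\<^sup>2 x\<close>.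
\<close>

lemma bernstein_nonneg:
  assumes "f \<in> ell2 V" shows "0 \<le> poly_moment (\<lambda>i. moment f i / c ^ i) (bernstein_poly a b)"
  using assms
proof (induction "a + b" arbitrary: a b f rule: less_induct)
  case less
  define g where "g f v = f v - of_real (1 / c) * A f v" for f v
  have g: "g f \<in> ell2 V" if "f \<in> ell2 V" for f
    unfolding g_def using that by (intro ell2_diff ell2_scale closed)
  have xx: "poly_moment (\<lambda>i. moment f i / c ^ i) (bernstein_poly (Suc (Suc a)) b)
      = poly_moment (\<lambda>i. moment (A f) i / c ^ i) (bernstein_poly a b) / c\<^sup>2" if "f \<in> ell2 V" for f a b
  proof -
    have "bernstein_poly (Suc (Suc a)) b = pCons 0 (pCons 0 (bernstein_poly a b))"
      by (simp add: bernstein_poly_def mult.assoc)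
    then show ?thesis
      using that c_pos
      by (simp only: poly_moment_pCons0 moment_shift2)
         (simp add: poly_moment_def sum_divide_distrib power2_eq_square field_simps)
  qed
  have yy: "poly_moment (\<lambda>i. moment f i / c ^ i) (bernstein_poly a (Suc (Suc b)))
      = poly_moment (\<lambda>i. moment (g f) i / c ^ i) (bernstein_poly a b)" if f: "f \<in> ell2 V" for f a b
  proof -
    let ?p = "bernstein_poly a b" and ?m = "\<lambda>i. moment f i / c ^ i"
    have "bernstein_poly a (Suc (Suc b)) = ?p + (smult (-1) (pCons 0 ?p) + (smult (-1) (pCons 0 ?p) + pCons 0 (pCons 0 ?p)))"
      by (simp add: bernstein_poly_def algebra_simps)
    then have "poly_moment ?m (bernstein_poly a (Suc (Suc b)))
       = poly_moment ?m ?p - 2 * poly_moment (\<lambda>i. ?m (Suc i)) ?p + poly_moment (\<lambda>i. ?m (Suc (Suc i))) ?p"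
      by (simp only: poly_moment_add poly_moment_smult poly_moment_pCons0)
    also have "\<dots> = poly_moment (\<lambda>i. moment (g f) i / c ^ i) ?p"
    proof -
      have "moment (g f) i / c ^ i = ?m i - 2 * ?m (Suc i) + ?m (Suc (Suc i))" for i
        unfolding g_def using moment_diff[OF f, of "1/c" i] c_pos
        by (simp add: field_simps power2_eq_square)
      then show ?thesis
        by (simp only: poly_moment_def) (simp add: sum.distrib sum_subtractf sum_distrib_left algebra_simps)
    qed
    finally show ?thesis .
  qed
  have x1: "0 \<le> poly_moment (\<lambda>i. moment f i / c ^ i) (bernstein_poly 1 0)" if "f \<in> ell2 V" for f
    using nonneg[OF that] c_pos by (simp add: bernstein_poly_def poly_moment_def moment_def)
  have y1: "0 \<le> poly_moment (\<lambda>i. moment f i / c ^ i) (bernstein_poly 0 1)" if "f \<in> ell2 V" for f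
    using le[OF that] c_pos by (simp add: bernstein_poly_def poly_moment_def moment_0) (simp add: moment_def field_simps)
  consider a' where "a = Suc (Suc a')" | b' where "b = Suc (Suc b')" | "a = 0" "b = 0"
    | "a = 1" "b = 0" | "a = 0" "b = 1" | "a = 1" "b = 1"
    by (metis One_nat_def not0_implies_Suc)
  then show ?case
  proof cases
    case 1
    then have "0 \<le> poly_moment (\<lambda>i. moment (A f) i / c ^ i) (bernstein_poly a' b)"
      using less closed by simp
    then show ?thesis using xx[OF less.prems] 1 by simp
  next
    case 2
    then have "0 \<le> poly_moment (\<lambda>i. moment (g f) i / c ^ i) (bernstein_poly a b')"
      using less g by simp
    then show ?thesis using yy[OF less.prems] 2 by simp
  next
    case 3
    then show ?thesis by (simp add: bernstein_poly_def poly_moment_def moment_0)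
  next
    case 6
    \<comment> \<open>The degree rises to 3, beyond the induction hypothesis; absorbing the squares
      leaves only the base cases of degree 1.\<close>
    have "bernstein_poly 1 1 = bernstein_poly 2 1 + bernstein_poly 1 2"
      by (simp add: bernstein_poly_def power2_eq_square)
    then have "poly_moment (\<lambda>i. moment f i / c ^ i) (bernstein_poly 1 1)
      = poly_moment (\<lambda>i. moment (A f) i / c ^ i) (bernstein_poly 0 1) / c\<^sup>2
        + poly_moment (\<lambda>i. moment (g f) i / c ^ i) (bernstein_poly 1 0)"
      using xx[OF less.prems, of 0 1] yy[OF less.prems, of 1 0]
      by (simp add: poly_moment_add numeral_2_eq_2)
    then show ?thesis using 6 x1[OF g[OF less.prems]] y1[OF closed[OF less.prems]] by simp
  qed (use x1 y1 less.prems in auto)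
qed

text \<open>The moment problem is solved on [0,1] with mass 1. So the moments are divided by c^n and
  by the squared norm of \<open>f\<close>, and the solution is pushed forward under multiplication
  by c and multiplied by the norm again; the zero vector is treated apart because of that
  division.\<close>

lemma spectral_functional_exists:
  assumes f: "f \<in> ell2 V"
  shows "\<exists>I. measure_functional c I \<and> positive_functional c I \<and> (\<forall>n. I (\<lambda>t. t ^ n) = moment f n)"
proof (cases "ell2_sq V f = 0")
  case True
  have "moment (\<lambda>v. 0) n = 0" for n by (simp add: moment_def)
  then show ?thesis using ell2_sq_eq_0[OF f True]
    by (intro exI[of _ "\<lambda>h. 0"]) (auto simp: mf_const_zero positive_functional_def)
next
  case False
  define s where "s = ell2_sq V f"
  have s: "s > 0" using False by (simp add: s_def less_le)
  define m where "m n = moment f n / c ^ n / s" for n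
  have pm: "poly_moment m p = poly_moment (\<lambda>i. moment f i / c ^ i) p / s" for p
    by (simp add: poly_moment_def m_def sum_divide_distrib)
  obtain M where M: "prob_space M" "sets M = sets borel" "AE x in M. x \<in> {0..1}" "\<And>j. (\<integral>x. x ^ j \<partial>M) = m j"
  proof (rule Hausdorff_moment_problem[of m])
    show "0 \<le> poly_moment m (bernstein_poly a b)" for a b
      using bernstein_nonneg[OF f] s by (simp add: pm)
    show "m 0 = 1" using s by (simp add: m_def moment_0 s_def)
  qed auto
  interpret M: prob_space M by fact
  define N where "N = distr M borel (\<lambda>x. c * x)"
  have mc: "(\<lambda>x. c * x) \<in> borel_measurable M" unfolding measurable_cong_sets[OF M(2) refl] by measurable
  interpret N: prob_space N unfolding N_def by (rule M.prob_space_distr[OF mc])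
  have AE: "AE x in N. x \<in> {-c..c}"
  proof -
    have "AE x in M. c * x \<in> {-c..c}"
      using M(3)
    proof (rule eventually_mono)
      fix x :: real assume "x \<in> {0..1}"
      then have "0 \<le> c * x" "c * x \<le> c * 1" using c_pos by (auto intro: mult_left_mono simp del: mult_1_right)
      then show "c * x \<in> {-c..c}" using c_pos by auto
    qed
    then show ?thesis unfolding N_def by (subst AE_distr_iff[OF mc]) auto
  qed
  have mom: "(\<integral>x. x ^ n \<partial>N) = moment f n / s" for n
  proof -
    have "(\<integral>x. x ^ n \<partial>N) = (\<integral>x. (c * x) ^ n \<partial>M)" unfolding N_def by (rule integral_distr[OF mc]) auto
    also have "\<dots> = c ^ n * m n" by (simp add: power_mult_distrib M(4))
    finally show ?thesis using c_pos by (simp add: m_def)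
  qed
  note N = measure_functional_integral[OF N.finite_measure_axioms _ AE]
  have sN: "sets N = sets borel" by (simp add: N_def)
  show ?thesis
  proof (intro exI conjI allI)
    show "measure_functional c (\<lambda>h. s *\<^sub>R (\<integral>x. h x \<partial>N))" by (intro mf_scaleR N sN)
    show "positive_functional c (\<lambda>h. s *\<^sub>R (\<integral>x. h x \<partial>N))"
      using N(2)[OF sN] s by (simp add: positive_functional_def)
    show "s *\<^sub>R (\<integral>x. x ^ n \<partial>N) = moment f n" for n using mom s by simp
  qed
qed

text \<open>A choice, but its values on \<open>bounded_borel c\<close> are forced by the moments, so
  identities about it can be checked on monomials.\<close>

definition spectral_functional :: "('v \<Rightarrow> complex) \<Rightarrow> (real \<Rightarrow> real) \<Rightarrow> real" where
  "spectral_functional f = (SOME I. measure_functional c I \<and> positive_functional c I \<and> (\<forall>n. I (\<lambda>t. t ^ n) = moment f n))"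

lemma
  assumes "f \<in> ell2 V"
  shows spectral_functional: "measure_functional c (spectral_functional f)"
    and spectral_functional_pos: "positive_functional c (spectral_functional f)"
    and spectral_functional_moment: "spectral_functional f (\<lambda>t. t ^ n) = moment f n"
  using someI_ex[OF spectral_functional_exists[OF assms]] unfolding spectral_functional_def by auto

text \<open>Plays the role of <h(A) f, g> before h(A) exists as an operator.\<close>

definition spectral_form :: "('v \<Rightarrow> complex) \<Rightarrow> ('v \<Rightarrow> complex) \<Rightarrow> (real \<Rightarrow> real) \<Rightarrow> complex" where
  "spectral_form f g h = polar (\<lambda>f. spectral_functional f h) f g"

section \<open>Laws of the spectral form\<close>

lemma spectral_form: "f \<in> ell2 V \<Longrightarrow> g \<in> ell2 V \<Longrightarrow> measure_functional c (spectral_form f g)"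
  unfolding spectral_form_def by (rule measure_functional_polar[OF spectral_functional])

lemma spectral_form_moment:
  "f \<in> ell2 V \<Longrightarrow> g \<in> ell2 V \<Longrightarrow> spectral_form f g (\<lambda>t. t ^ n) = ell2_inner V ((A ^^ n) f) g"
  unfolding spectral_form_def
  by (rule polarization[OF linear_pow pow_real]) (auto simp: spectral_functional_moment moment_def)

lemma spectral_form_one: "f \<in> ell2 V \<Longrightarrow> g \<in> ell2 V \<Longrightarrow> spectral_form f g (\<lambda>t. 1) = ell2_inner V f g"
  using spectral_form_moment[of f g 0] by simp

text \<open>Both sides are functionals of \<open>h\<close>, so monomials suffice, and there the
  claim is linearity of \<open>A ^^ n\<close>. The laws that follow are obtained in the same way or
  by conjugation.\<close>

lemma spectral_form_add_left:
  assumes "f \<in> ell2 V" "g \<in> ell2 V" "k \<in> ell2 V" "h \<in> bounded_borel c"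
  shows "spectral_form (\<lambda>v. f v + g v) k h = spectral_form f k h + spectral_form g k h"
proof (rule measure_functional_eqI_moments[OF spectral_form mf_plus[OF spectral_form spectral_form] _ assms(4)])
  show "spectral_form (\<lambda>v. f v + g v) k (\<lambda>x. x ^ n) = spectral_form f k (\<lambda>x. x ^ n) + spectral_form g k (\<lambda>x. x ^ n)" for n
    using assms by (simp add: spectral_form_moment ell2_add ell2_linear_add[OF linear_pow] ell2_inner_add_left closed_pow)
qed (use assms in \<open>auto simp: ell2_add\<close>)

lemma spectral_form_scale_left:
  assumes "f \<in> ell2 V" "k \<in> ell2 V" "h \<in> bounded_borel c"
  shows "spectral_form (\<lambda>v. a * f v) k h = a * spectral_form f k h"
proof (rule measure_functional_eqI_moments[OF spectral_form mf_cmult[OF spectral_form] _ assms(3)])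
  show "spectral_form (\<lambda>v. a * f v) k (\<lambda>x. x ^ n) = a * spectral_form f k (\<lambda>x. x ^ n)" for n
    using assms by (simp add: spectral_form_moment ell2_scale ell2_linear_scale[OF linear_pow] ell2_inner_scale_left closed_pow)
qed (use assms in \<open>auto simp: ell2_scale\<close>)

lemma spectral_form_cnj:
  assumes "f \<in> ell2 V" "g \<in> ell2 V" "h \<in> bounded_borel c"
  shows "spectral_form g f h = cnj (spectral_form f g h)"
proof (rule measure_functional_eqI_moments[OF spectral_form mf_bounded_linear[OF spectral_form bounded_linear_cnj] _ assms(3)])
  show "spectral_form g f (\<lambda>x. x ^ n) = cnj (spectral_form f g (\<lambda>x. x ^ n))" for n
    using assms by (simp add: spectral_form_moment ell2_inner_cnj[of V g "(A ^^ n) f"] sym_pow)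
qed (use assms in auto)

lemma spectral_form_self:
  assumes "f \<in> ell2 V" "h \<in> bounded_borel c"
  shows "spectral_form f f h = of_real (spectral_functional f h)"
proof (rule measure_functional_eqI_moments[OF spectral_form mf_of_real[OF spectral_functional] _ assms(2)])
  show "spectral_form f f (\<lambda>x. x ^ n) = of_real (spectral_functional f (\<lambda>x. x ^ n))" for n
    using assms pow_real[of f n]
    by (simp add: spectral_form_moment spectral_functional_moment moment_def complex_eq_iff)
qed (use assms in auto)

lemma spectral_form_pow_left:
  assumes "f \<in> ell2 V" "g \<in> ell2 V" "h \<in> bounded_borel c"
  shows "spectral_form ((A ^^ n) f) g h = spectral_form f g (\<lambda>t. t ^ n * h t)"
proof (rule measure_functional_eqI_moments[OF spectral_form mf_weight[OF spectral_form] _ assms(3)])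
  show "spectral_form ((A ^^ n) f) g (\<lambda>x. x ^ j) = spectral_form f g (\<lambda>x. x ^ n * x ^ j)" for j
    using assms by (simp add: spectral_form_moment closed_pow power_add[symmetric] funpow_add[symmetric, unfolded o_def, THEN fun_cong] add.commute)
qed (use assms in \<open>auto simp: closed_pow\<close>)

lemma spectral_form_add_right:
  assumes "f \<in> ell2 V" "g \<in> ell2 V" "k \<in> ell2 V" "h \<in> bounded_borel c"
  shows "spectral_form k (\<lambda>v. f v + g v) h = spectral_form k f h + spectral_form k g h"
  using assms by (simp add: spectral_form_cnj[of _ k] spectral_form_add_left ell2_add)

lemma spectral_form_scale_right:
  assumes "f \<in> ell2 V" "k \<in> ell2 V" "h \<in> bounded_borel c"
  shows "spectral_form k (\<lambda>v. a * f v) h = cnj a * spectral_form k f h"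
  using assms by (simp add: spectral_form_cnj[of _ k] spectral_form_scale_left ell2_scale)

text \<open>Restricted to finite combinations because continuity in the second argument only becomes
  available with \<open>spectral_form_Cauchy_Schwarz\<close>.\<close>

lemma spectral_form_finite_right:
  assumes "f \<in> ell2 V" "h \<in> bounded_borel c" "finite W" "W \<subseteq> V"
  shows "spectral_form f (\<lambda>v. if v \<in> W then a v else 0) h = (\<Sum>v\<in>W. cnj (a v) * spectral_form f (delta_fun v) h)"
  using assms(3,4)
proof (induction W rule: finite_induct)
  case empty
  then show ?case using spectral_form_scale_right[OF ell2_zero assms(1,2), of 0] by simp
next
  case (insert w W)
  have W: "(\<lambda>v. if v \<in> W then a v else 0) \<in> ell2 V"
    using insert by (intro ell2_finite_support[of W]) auto
  have "(\<lambda>v. if v \<in> insert w W then a v else 0) = (\<lambda>v. a w * delta_fun w v + (if v \<in> W then a v else 0))"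
    using insert by (auto simp: delta_fun_def)
  then show ?case
    using insert W assms(1,2)
    by (simp add: spectral_form_add_right spectral_form_scale_right ell2_scale)
qed

lemma spectral_functional_indicator_le:
  assumes "f \<in> ell2 V" "B \<in> sets borel"
  shows "0 \<le> spectral_functional f (indicator B)" "spectral_functional f (indicator B) \<le> ell2_sq V f"
proof -
  show "0 \<le> spectral_functional f (indicator B)"
    using spectral_functional_pos[OF assms(1)] assms(2) by (simp add: positive_functional_def)
  have "spectral_functional f (indicator B) \<le> spectral_functional f (\<lambda>t. 1)"
    using assms by (intro positive_functional_mono[OF spectral_functional spectral_functional_pos]) (auto simp: indicator_def)
  also have "\<dots> = ell2_sq V f" using spectral_functional_moment[OF assms(1), of 0] by (simp add: moment_0)
  finally show "spectral_functional f (indicator B) \<le> ell2_sq V f" .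
qed

text \<open>Expand the nonnegative value of the form at (f - g, f - g).\<close>

lemma spectral_form_diff_self:
  assumes "f \<in> ell2 V" "g \<in> ell2 V" "B \<in> sets borel"
  shows "2 * Re (spectral_form f g (indicator B)) \<le> spectral_functional f (indicator B) + spectral_functional g (indicator B)"
proof -
  let ?h = "indicator B :: real \<Rightarrow> real"
  have h: "?h \<in> bounded_borel c" using assms by simp
  define g' where "g' v = (-1) * g v" for v
  let ?k = "\<lambda>v. f v + g' v"
  have g': "g' \<in> ell2 V" using ell2_scale[OF assms(2), of "-1"] by (simp add: g'_def[abs_def])
  have neg: "spectral_form g' k ?h = - spectral_form g k ?h" "spectral_form k g' ?h = - spectral_form k g ?h"
    if "k \<in> ell2 V" for k
    using spectral_form_scale_left[OF assms(2) that h, of "-1"] spectral_form_scale_right[OF assms(2) that h, of "-1"]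
    by (simp_all add: g'_def[abs_def])
  have "complex_of_real (spectral_functional ?k ?h) = spectral_form ?k ?k ?h"
    by (rule spectral_form_self[symmetric]) (use assms(1) g' h in \<open>auto intro: ell2_add\<close>)
  also have "\<dots> = spectral_form f f ?h - spectral_form f g ?h - spectral_form g f ?h + spectral_form g g ?h"
    using assms(1,2) g' h
    by (simp add: ell2_add spectral_form_add_left spectral_form_add_right neg)
  finally have "complex_of_real (spectral_functional ?k ?h)
      = spectral_form f f ?h - spectral_form f g ?h - spectral_form g f ?h + spectral_form g g ?h" .
  moreover have "Re (spectral_form g f ?h) = Re (spectral_form f g ?h)"
    using spectral_form_cnj[OF assms(1,2) h] by simp
  moreover have "0 \<le> spectral_functional ?k ?h"
    using assms g' by (intro spectral_functional_indicator_le ell2_add) auto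
  ultimately show ?thesis
    using assms h by (simp add: spectral_form_self complex_eq_iff)
qed

text \<open>Apply \<open>spectral_form_diff_self\<close> to t u f and g, with a phase u that makes
  the form real and an optimal scale t. The purpose is continuity in the second argument.\<close>

lemma spectral_form_Cauchy_Schwarz:
  assumes f: "f \<in> ell2 V" and g: "g \<in> ell2 V" and B: "B \<in> sets borel"
  shows "(cmod (spectral_form f g (indicator B)))\<^sup>2 \<le> ell2_sq V f * ell2_sq V g"
proof -
  let ?h = "indicator B :: real \<Rightarrow> real"
  have h: "?h \<in> bounded_borel c" using B by simp
  define s where "s = cmod (spectral_form f g ?h)"
  have key: "2 * t * s \<le> t\<^sup>2 * ell2_sq V f + ell2_sq V g" if t: "t > 0" for t :: real
  proof -
    \<comment> \<open>The conjugate phase of the form. It is 0 when the form vanishes, hence only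
      cmod u <= 1 is claimed below.\<close>
    define u where "u = cnj (sgn (spectral_form f g ?h))"
    have u: "u * spectral_form f g ?h = of_real s"
      by (simp add: u_def s_def sgn_eq power2_eq_square complex_norm_square[symmetric] mult.commute[of "cnj _"])
    have uf: "(\<lambda>v. (of_real t * u) * f v) \<in> ell2 V" by (rule ell2_scale[OF f])
    have "spectral_form (\<lambda>v. (of_real t * u) * f v) g ?h = of_real t * (u * spectral_form f g ?h)"
      using spectral_form_scale_left[OF f g h, of "of_real t * u"] by (simp only: mult.assoc)
    then have "2 * Re (spectral_form (\<lambda>v. (of_real t * u) * f v) g ?h) = 2 * t * s"
      by (simp only: u) simp
    then have "2 * t * s \<le> ell2_sq V (\<lambda>v. (of_real t * u) * f v) + ell2_sq V g"
      using spectral_form_diff_self[OF uf g B] spectral_functional_indicator_le(2)[OF uf B]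
        spectral_functional_indicator_le(2)[OF g B] by linarith
    also have "ell2_sq V (\<lambda>v. (of_real t * u) * f v) \<le> t\<^sup>2 * ell2_sq V f"
    proof -
      have "cmod u \<le> 1" by (simp add: u_def norm_sgn)
      then have "(cmod (of_real t * u))\<^sup>2 \<le> t\<^sup>2"
        using t by (simp add: norm_mult power_mult_distrib mult_left_le power_le_one)
      then show ?thesis unfolding ell2_sq_scale by (intro mult_right_mono) auto
    qed
    finally show ?thesis by simp
  qed
  have "s\<^sup>2 \<le> ell2_sq V f * ell2_sq V g"
  proof (cases "s = 0 \<or> ell2_sq V f = 0")
    case True
    have "s = 0"
    proof (rule ccontr)
      assume "s \<noteq> 0"
      then have "s > 0" "ell2_sq V f = 0" using True by (auto simp: s_def)
      \<comment> \<open>This t would give 2 (q + 1) <= q for q = \<open>ell2_sq V g\<close>.\<close>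
      then show False using key[of "(ell2_sq V g + 1) / s"] ell2_sq_nonneg[of V g] by (simp add: add_pos_nonneg add_nonneg_pos)
    qed
    then show ?thesis by simp
  next
    case False
    define a where "a = ell2_sq V f"
    have a: "a > 0" "s > 0" using False by (auto simp: a_def s_def less_le)
    \<comment> \<open>The scale t = s/a minimizes t^2 a - 2 t s.\<close>
    then have "2 * (s / a) * s \<le> (s / a)\<^sup>2 * a + ell2_sq V g" using key[of "s/a"] by (simp add: a_def)
    moreover have "(s / a)\<^sup>2 * a = s\<^sup>2 / a" "2 * (s / a) * s = 2 * (s\<^sup>2 / a)"
      using a by (auto simp: power2_eq_square field_simps)
    ultimately have "s\<^sup>2 / a \<le> ell2_sq V g" by linarith
    then show ?thesis using a by (simp add: a_def[symmetric] field_simps)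
  qed
  then show ?thesis by (simp add: s_def)
qed

text \<open>Given by the coordinates <P(B) f, delta_v> instead of a representation theorem for
  bounded forms; square-summability of these coordinates is a separate claim.\<close>

definition spectral_proj :: "real set \<Rightarrow> ('v \<Rightarrow> complex) \<Rightarrow> 'v \<Rightarrow> complex" where
  "spectral_proj B f v = (if v \<in> V then spectral_form f (delta_fun v) (indicator B) else 0)"

text \<open>Let u be the truncation of the candidate to a finite \<open>W\<close> and S its squared
  norm. The form at (f, u) also equals S, so \<open>spectral_form_diff_self\<close> gives 2 S <=
  \<open>ell2_sq V f\<close> + S. Thus all finite partial sums are bounded by the squared norm of
  \<open>f\<close>.\<close>

lemma
  assumes f: "f \<in> ell2 V" and B: "B \<in> sets borel"
  shows spectral_proj_closed: "spectral_proj B f \<in> ell2 V"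
    and spectral_proj_sq_le: "ell2_sq V (spectral_proj B f) \<le> ell2_sq V f"
proof -
  have h: "indicator B \<in> bounded_borel c" using B by simp
  have bound: "(\<Sum>v\<in>W. (cmod (spectral_proj B f v))\<^sup>2) \<le> ell2_sq V f" if W: "finite W" "W \<subseteq> V" for W
  proof -
    define S where "S = (\<Sum>v\<in>W. (cmod (spectral_proj B f v))\<^sup>2)"
    define u where "u v = (if v \<in> W then spectral_proj B f v else 0)" for v
    have u: "u \<in> ell2 V" using W by (intro ell2_finite_support[of W]) (auto simp: u_def)
    have "spectral_form f u (indicator B) = (\<Sum>v\<in>W. cnj (spectral_proj B f v) * spectral_proj B f v)"
      unfolding u_def spectral_form_finite_right[OF f h W]
      using W by (intro sum.cong) (auto simp: spectral_proj_def)
    also have "\<dots> = of_real S"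
      by (simp add: S_def complex_norm_square mult.commute del: of_real_power)
    finally have 1: "spectral_form f u (indicator B) = of_real S" .
    have "ell2_sq V u = S"
      unfolding ell2_sq_def using W
      by (subst ell2_inner_finite_support[of W])
         (auto simp: u_def S_def complex_norm_square[symmetric] simp del: of_real_power)
    then show ?thesis
      using spectral_form_diff_self[OF f u B] spectral_functional_indicator_le(2)[OF f B]
        spectral_functional_indicator_le(2)[OF u B] 1 by (simp add: S_def[symmetric])
  qed
  have sm: "(\<lambda>v. (cmod (spectral_proj B f v))\<^sup>2) summable_on V"
    by (rule nonneg_bdd_above_summable_on) (auto intro!: bdd_aboveI2[where M="ell2_sq V f"] bound)
  then show "spectral_proj B f \<in> ell2 V" by (simp add: ell2_def spectral_proj_def)
  show "ell2_sq V (spectral_proj B f) \<le> ell2_sq V f"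
    unfolding ell2_sq_eq[of V "spectral_proj B f"] using sm bound by (rule infsum_le_finite_sums)
qed

text \<open>Clear for the truncation of \<open>g\<close> to a finite set. The error is the form at
  \<open>f\<close> and the remaining tail of \<open>g\<close>, which
  \<open>spectral_form_Cauchy_Schwarz\<close> sends to 0.\<close>

lemma spectral_proj_inner:
  assumes f: "f \<in> ell2 V" and g: "g \<in> ell2 V" and B: "B \<in> sets borel"
  shows "ell2_inner V (spectral_proj B f) g = spectral_form f g (indicator B)"
proof -
  let ?h = "indicator B :: real \<Rightarrow> real"
  have h: "?h \<in> bounded_borel c" using B by simp
  define gW where "gW W v = (if v \<in> W then g v else 0)" for W v
  have 1: "(\<Sum>v\<in>W. spectral_proj B f v * cnj (g v)) = spectral_form f (gW W) ?h" if "finite W" "W \<subseteq> V" for W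
    unfolding gW_def spectral_form_finite_right[OF f h that]
    using that by (intro sum.cong) (auto simp: spectral_proj_def)
  have sq: "ell2_sq V (\<lambda>v. g v - gW W v) = ell2_sq V g - (\<Sum>v\<in>W. (cmod (g v))\<^sup>2)" if W: "finite W" "W \<subseteq> V" for W
  proof -
    have "(\<Sum>\<^sub>\<infinity>v\<in>V. (cmod (g v))\<^sup>2) = (\<Sum>\<^sub>\<infinity>v\<in>W \<union> (V - W). (cmod (g v))\<^sup>2)"
      using W by (simp add: Un_absorb1)
    also have "\<dots> = (\<Sum>\<^sub>\<infinity>v\<in>W. (cmod (g v))\<^sup>2) + (\<Sum>\<^sub>\<infinity>v\<in>V - W. (cmod (g v))\<^sup>2)"
      using W by (intro infsum_Un_disjoint summable_on_subset_banach[OF ell2_summable[OF g]]) auto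
    also have "(\<Sum>\<^sub>\<infinity>v\<in>V - W. (cmod (g v))\<^sup>2) = (\<Sum>\<^sub>\<infinity>v\<in>V. (cmod (g v - gW W v))\<^sup>2)"
      by (rule infsum_cong_neutral) (auto simp: gW_def)
    finally show ?thesis using W by (simp add: ell2_sq_eq)
  qed
  have "((\<lambda>W. \<Sum>v\<in>W. spectral_proj B f v * cnj (g v)) \<longlongrightarrow> spectral_form f g ?h) (finite_subsets_at_top V)"
  proof (rule Lim_null[THEN iffD2], rule Lim_null_comparison)
    show "\<forall>\<^sub>F W in finite_subsets_at_top V. norm ((\<Sum>v\<in>W. spectral_proj B f v * cnj (g v)) - spectral_form f g ?h)
        \<le> sqrt (ell2_sq V f * (ell2_sq V g - (\<Sum>v\<in>W. (cmod (g v))\<^sup>2)))"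
    proof (rule eventually_finite_subsets_at_top_weakI)
      fix W assume W: "finite W" "W \<subseteq> V"
      have gW: "gW W \<in> ell2 V" using W by (intro ell2_finite_support[of W]) (auto simp: gW_def)
      have d: "(\<lambda>v. g v - gW W v) \<in> ell2 V" by (rule ell2_diff[OF g gW])
      have "spectral_form f g ?h = spectral_form f (\<lambda>v. (g v - gW W v) + gW W v) ?h" by simp
      also have "\<dots> = spectral_form f (\<lambda>v. g v - gW W v) ?h + spectral_form f (gW W) ?h"
        by (rule spectral_form_add_right[OF d gW f h])
      finally have "norm ((\<Sum>v\<in>W. spectral_proj B f v * cnj (g v)) - spectral_form f g ?h)
          = cmod (spectral_form f (\<lambda>v. g v - gW W v) ?h)"
        using 1[OF W] by (simp add: norm_minus_commute)
      also have "\<dots> \<le> sqrt (ell2_sq V f * ell2_sq V (\<lambda>v. g v - gW W v))"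
        by (rule real_le_rsqrt) (rule spectral_form_Cauchy_Schwarz[OF f d B])
      finally show "norm ((\<Sum>v\<in>W. spectral_proj B f v * cnj (g v)) - spectral_form f g ?h)
        \<le> sqrt (ell2_sq V f * (ell2_sq V g - (\<Sum>v\<in>W. (cmod (g v))\<^sup>2)))" using sq[OF W] by simp
    qed
    have "((\<lambda>W. \<Sum>v\<in>W. (cmod (g v))\<^sup>2) \<longlongrightarrow> ell2_sq V g) (finite_subsets_at_top V)"
      unfolding ell2_sq_eq by (rule infsum_tendsto[OF ell2_summable[OF g]])
    then have "((\<lambda>W. sqrt (ell2_sq V f * (ell2_sq V g - (\<Sum>v\<in>W. (cmod (g v))\<^sup>2)))) \<longlongrightarrow>
        sqrt (ell2_sq V f * (ell2_sq V g - ell2_sq V g))) (finite_subsets_at_top V)"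
      by (intro tendsto_intros)
    then show "((\<lambda>W. sqrt (ell2_sq V f * (ell2_sq V g - (\<Sum>v\<in>W. (cmod (g v))\<^sup>2)))) \<longlongrightarrow> 0) (finite_subsets_at_top V)"
      by simp
  qed
  moreover have "((\<lambda>W. \<Sum>v\<in>W. spectral_proj B f v * cnj (g v)) \<longlongrightarrow> ell2_inner V (spectral_proj B f) g) (finite_subsets_at_top V)"
    unfolding ell2_inner_def
    by (rule infsum_tendsto[OF ell2_inner_summable[OF spectral_proj_closed[OF f B] g]])
  ultimately show ?thesis
    using tendsto_unique[OF finite_subsets_at_top_neq_bot] by blast
qed

text \<open>On t^n the left side pairs \<open>(A ^^ n) f\<close> with the projection; conjugating
  moves the projection into an indicator, and A^n comes back as the density t^n. Multiplicativity of
  the projections follows from this.\<close>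

lemma spectral_form_proj_right:
  assumes f: "f \<in> ell2 V" and g: "g \<in> ell2 V" and C: "C \<in> sets borel" and h: "h \<in> bounded_borel c"
  shows "spectral_form f (spectral_proj C g) h = spectral_form f g (\<lambda>t. indicator C t * h t)"
proof -
  have Pg: "spectral_proj C g \<in> ell2 V" by (rule spectral_proj_closed[OF g C])
  have iC: "indicator C \<in> bounded_borel c" using C by simp
  show ?thesis
  proof (rule measure_functional_eqI_moments[OF spectral_form mf_weight[OF spectral_form] _ h])
    fix n
    have Af: "(A ^^ n) f \<in> ell2 V" by (rule closed_pow[OF f])
    have "spectral_form f (spectral_proj C g) (\<lambda>t. t ^ n) = ell2_inner V ((A ^^ n) f) (spectral_proj C g)"
      by (rule spectral_form_moment[OF f Pg])
    also have "\<dots> = cnj (spectral_form g ((A ^^ n) f) (indicator C))"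
      by (subst ell2_inner_cnj) (simp add: spectral_proj_inner[OF g Af C])
    also have "\<dots> = spectral_form ((A ^^ n) f) g (indicator C)"
      using spectral_form_cnj[OF g Af iC] by simp
    also have "\<dots> = spectral_form f g (\<lambda>t. t ^ n * indicator C t)"
      by (rule spectral_form_pow_left[OF f g iC])
    finally show "spectral_form f (spectral_proj C g) (\<lambda>t. t ^ n) = spectral_form f g (\<lambda>t. indicator C t * t ^ n)"
      by (simp add: mult.commute)
  qed (use f g Pg C in auto)
qed

lemma spectral_proj_sym:
  assumes "f \<in> ell2 V" "g \<in> ell2 V" "B \<in> sets borel"
  shows "ell2_inner V (spectral_proj B f) g = ell2_inner V f (spectral_proj B g)"
  using assms spectral_form_cnj[of f g "indicator B"]
  by (simp add: spectral_proj_inner ell2_inner_cnj[of V f "spectral_proj B g"])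

lemma spectral_proj_Int:
  assumes f: "f \<in> ell2 V" and B: "B \<in> sets borel" and C: "C \<in> sets borel"
  shows "spectral_proj (B \<inter> C) f = spectral_proj B (spectral_proj C f)"
proof (rule ell2_eqI)
  fix g assume g: "g \<in> ell2 V"
  have Pf: "spectral_proj C f \<in> ell2 V" by (rule spectral_proj_closed[OF f C])
  have Pg: "spectral_proj B g \<in> ell2 V" by (rule spectral_proj_closed[OF g B])
  have "ell2_inner V (spectral_proj B (spectral_proj C f)) g = ell2_inner V (spectral_proj C f) (spectral_proj B g)"
    by (rule spectral_proj_sym[OF Pf g B])
  also have "\<dots> = spectral_form f (spectral_proj B g) (indicator C)"
    by (rule spectral_proj_inner[OF f Pg C])
  also have "\<dots> = spectral_form f g (\<lambda>t. indicator B t * indicator C t)"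
    by (rule spectral_form_proj_right[OF f g B]) (use C in simp)
  also have "(\<lambda>t. indicator B t * indicator C t) = (indicator (B \<inter> C) :: real \<Rightarrow> real)"
    by (auto simp: indicator_def)
  also have "spectral_form f g (indicator (B \<inter> C)) = ell2_inner V (spectral_proj (B \<inter> C) f) g"
    using spectral_proj_inner[OF f g, of "B \<inter> C"] B C by simp
  finally show "ell2_inner V (spectral_proj (B \<inter> C) f) g = ell2_inner V (spectral_proj B (spectral_proj C f)) g" ..
qed (use assms in \<open>auto intro!: spectral_proj_closed\<close>)

lemma spectral_proj_linear:
  assumes B: "B \<in> sets borel" shows "ell2_linear V (spectral_proj B)"
  unfolding ell2_linear_def
  using B by (auto simp: spectral_proj_closed spectral_proj_def spectral_form_add_left spectral_form_scale_left intro!: ext)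

lemma spectral_proj_pvm: "projection_valued_measure V spectral_proj"
  unfolding projection_valued_measure_def
proof (intro conjI ballI allI impI)
  fix B :: "real set" assume B: "B \<in> sets borel"
  have "bounded_operator V (spectral_proj B)"
    unfolding bounded_operator_def using spectral_proj_linear[OF B] spectral_proj_sq_le[OF _ B]
    by (auto simp: ell2_linear_def ell2_sq_def intro!: exI[of _ 1])
  then show "orthogonal_projection V (spectral_proj B)"
    unfolding orthogonal_projection_def
    using spectral_proj_Int[OF _ B B] spectral_proj_sym[OF _ _ B] by auto
next
  fix f assume f: "f \<in> ell2 V"
  have "indicator UNIV = (\<lambda>t::real. 1::real)" by auto
  then show "spectral_proj UNIV f = f"
    using f spectral_form_one[OF f] by (auto simp: spectral_proj_def ell2_inner_delta ell2_zero_outside intro!: ext)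
next
  fix B :: "nat \<Rightarrow> real set" and f g
  assume B: "range B \<subseteq> sets borel \<and> disjoint_family B" and f: "f \<in> ell2 V" and g: "g \<in> ell2 V"
  have Bs: "B n \<in> sets borel" for n using B by auto
  have "(\<lambda>n. spectral_form f g (indicator (\<Union>i<n. B i))) \<longlonglongrightarrow> spectral_form f g (indicator (\<Union>i. B i))"
    using Bs by (intro mf_limit[OF spectral_form[OF f g], where C=1] LIMSEQ_indicator_UN borel_measurable_indicator)
       (auto simp: indicator_def)
  moreover have "spectral_form f g (indicator (\<Union>i<n. B i)) = (\<Sum>i<n. spectral_form f g (indicator (B i)))" for n
  proof -
    have "indicator (\<Union>i<n. B i) = (\<lambda>x. \<Sum>i<n. indicator (B i) x :: real)"
      using B by (intro ext indicator_UN_disjoint) (auto simp: disjoint_family_on_def)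
    then show ?thesis using Bs by (simp add: mf_sum[OF spectral_form[OF f g]])
  qed
  ultimately show "(\<lambda>n. ell2_inner V (spectral_proj (B n) f) g) sums ell2_inner V (spectral_proj (\<Union>n. B n) f) g"
    using Bs f g by (simp add: sums_def spectral_proj_inner)
qed (auto simp: spectral_proj_Int)

lemma spectral_proj_support: "spectral_support V spectral_proj c"
  unfolding spectral_support_def
proof
  fix f assume f: "f \<in> ell2 V"
  have "spectral_form f (delta_fun v) (indicator {-c..c}) = f v" if v: "v \<in> V" for v
  proof -
    have "spectral_form f (delta_fun v) (indicator {-c..c}) = spectral_form f (delta_fun v) (\<lambda>t. 1)"
      by (rule mf_cong[OF spectral_form]) (use f v in auto)
    then show ?thesis using f v by (simp add: spectral_form_one ell2_inner_delta)
  qed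
  then show "spectral_proj {-c..c} f = f"
    using f by (auto simp: spectral_proj_def ell2_zero_outside intro!: ext)
qed

theorem spectral_proj_spectral_measure: "is_spectral_measure V A spectral_proj"
  unfolding is_spectral_measure_def
proof (intro conjI ballI exI[of _ c])
  show "projection_valued_measure V spectral_proj" by (rule spectral_proj_pvm)
  show "spectral_proj {-c..c} f = f" if "f \<in> ell2 V" for f
    using spectral_proj_support that by (simp add: spectral_support_def)
  fix f assume f: "f \<in> ell2 V"
  note J = diagonal_functional[OF spectral_proj_pvm f spectral_proj_support]
  have "(\<integral>t. t \<partial>diagonal_measure V spectral_proj f) = spectral_functional f (\<lambda>t. t)"
  proof (rule measure_functional_eqI_indicator[OF J(1) spectral_functional[OF f]])
    fix B :: "real set" assume B: "B \<in> sets borel"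
    show "(\<integral>t. indicator B t \<partial>diagonal_measure V spectral_proj f) = spectral_functional f (indicator B)"
      using J(2)[OF B] spectral_proj_inner[OF f f B] spectral_form_self[OF f, of "indicator B"] B by simp
  qed simp
  moreover have "spectral_functional f (\<lambda>t. t) = Re (ell2_inner V (A f) f)"
    using spectral_functional_moment[OF f, of 1] by (simp add: moment_def)
  ultimately show "ell2_inner V (A f) f = complex_of_real (\<integral>t. t \<partial>diagonal_measure V spectral_proj f)"
    using A_real[OF f] by (simp add: complex_eq_iff)
qed

lemma spectral_projection_spectral_measure: "is_spectral_measure V A (spectral_projection V A)"
  using someI[of "is_spectral_measure V A", OF spectral_proj_spectral_measure]
  unfolding spectral_projection_def .

text \<open>Uniqueness on the diagonal, which makes the choice in \<open>spectral_projection\<close>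
  harmless. The support radius R of \<open>P\<close> may differ from c, so the two functionals are
  compared on the larger interval.\<close>

theorem spectral_measure_form:
  assumes P: "is_spectral_measure V A P" and f: "f \<in> ell2 V" and B: "B \<in> sets borel"
  shows "ell2_inner V (P B f) f = of_real (spectral_functional f (indicator B))"
proof -
  have pvm: "projection_valued_measure V P" using P by (simp add: is_spectral_measure_def)
  obtain R where R: "spectral_support V P R" using P by (auto simp: is_spectral_measure_def spectral_support_def)
  define R' where "R' = max R c"
  note J = diagonal_functional[OF pvm f R]
  have "(\<integral>t. indicator B t \<partial>diagonal_measure V P f) = spectral_functional f (indicator B)"
  proof (rule measure_functional_eqI_moments[OF mf_mono_interval[OF J(1), of R'] mf_mono_interval[OF spectral_functional[OF f], of R']])
    show "(\<integral>t. t ^ n \<partial>diagonal_measure V P f) = spectral_functional f (\<lambda>t. t ^ n)" for n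
      using spectral_measure_moments[OF linear A_real P R f, of n] spectral_functional_moment[OF f, of n]
      by (simp add: moment_def)
  qed (use B in \<open>auto simp: R'_def\<close>)
  then show ?thesis using J(2)[OF B] pvm_form[OF pvm B f] by simp
qed

end

section \<open>Eigenvalue counting on finite sets\<close>

text \<open>
  Traces of projections are integers, and this alone forces the spectral measure of an operator on a
  finite set to be atomic: no diagonalization is needed.
\<close>

lemma integer_valued_functional_atomic:
  assumes I: "measure_functional R I" "positive_functional R I"
    and int: "\<And>B. B \<in> sets borel \<Longrightarrow> \<exists>k::nat. I (indicator B) = real k"
  shows "finite {x. I (indicator {x}) \<noteq> 0}"
    and "B \<in> sets borel \<Longrightarrow> I (indicator B) = (\<Sum>x | x \<in> B \<and> I (indicator {x}) \<noteq> 0. I (indicator {x}))"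
proof -
  define J where "J = {x. I (indicator {x}) \<noteq> 0}"
  have ge1: "1 \<le> I (indicator B)" if B: "B \<in> sets borel" "I (indicator B) \<noteq> 0" for B
    using int[OF B(1)] B(2) by auto
  have mono: "I (indicator B) \<le> I (indicator C)" if "B \<in> sets borel" "C \<in> sets borel" "B \<subseteq> C" for B C
    using that by (intro positive_functional_mono[OF I]) (auto simp: indicator_def)
  have sum: "I (indicator G) = (\<Sum>x\<in>G. I (indicator {x}))" if "finite G" for G
  proof -
    have "indicator G = (\<lambda>t. \<Sum>x\<in>G. indicator {x} t :: real)"
      using that by (auto simp: indicator_def)
    then show ?thesis using that by (simp add: mf_sum[OF I(1)])
  qed
  have J: "finite J"
  proof -
    obtain N :: nat where N: "I (indicator UNIV) = real N" using int[of UNIV] by auto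
    \<comment> \<open>Each atom has mass at least 1, so the total mass bounds the number of
      atoms.\<close>
    have "card G \<le> N" if G: "G \<subseteq> J" "finite G" for G
    proof -
      have "real (card G) = (\<Sum>x\<in>G. 1)" by simp
      also have "\<dots> \<le> (\<Sum>x\<in>G. I (indicator {x}))"
        using G by (intro sum_mono ge1) (auto simp: J_def)
      also have "\<dots> \<le> real N"
        using mono[OF borel_closed[OF finite_imp_closed[OF G(2)]], of UNIV] sum[OF G(2)] N by simp
      finally show ?thesis by simp
    qed
    then show ?thesis using finite_if_finite_subsets_card_bdd by blast
  qed
  then show "finite {x. I (indicator {x}) \<noteq> 0}" by (simp add: J_def)
  assume B: "B \<in> sets borel"
  have Jb: "J \<in> sets borel" using finite_imp_closed[OF J] by (rule borel_closed)
  define B' where "B' = B - J"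
  have B': "B' \<in> sets borel" using B Jb by (auto simp: B'_def)
  have "I (indicator B') = 0"
  proof (rule ccontr)
    assume nz: "I (indicator B') \<noteq> 0"
    \<comment> \<open>Distribution function of the remainder without atoms. Its values are natural
      numbers, so it jumps from 0 to at least 1 at x0 = Inf S; the jump is the mass of the single
      point x0 in B', yet B' contains no atom.\<close>
    define g where "g x = I (indicator (B' \<inter> {..x}))" for x
    have gmono: "x \<le> y \<Longrightarrow> g x \<le> g y" for x y
      unfolding g_def using B' by (intro mono) auto
    define S where "S = {x. 1 \<le> g x}"
    have "g R = I (indicator B')"
      unfolding g_def by (rule mf_cong[OF I(1)]) (use B' in \<open>auto simp: indicator_def\<close>)
    then have "R \<in> S" using ge1[OF B' nz] by (simp add: S_def)
    have low: "-R \<le> x" if "x \<in> S" for x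
    proof (rule ccontr)
      assume "\<not> -R \<le> x"
      then have "g x = I (\<lambda>t. 0)"
        unfolding g_def by (intro mf_cong[OF I(1)]) (use B' in \<open>auto simp: indicator_def\<close>)
      then show False using that mf_zero[OF I(1)] by (simp add: S_def)
    qed
    define x0 where "x0 = Inf S"
    have bdd: "bdd_below S" using low by (rule bdd_belowI)
    have above: "1 \<le> g x" if x: "x0 < x" for x
    proof -
      obtain s where "s \<in> S" "s < x" using x \<open>R \<in> S\<close> bdd unfolding x0_def by (metis cInf_less_iff empty_iff)
      then show ?thesis using gmono[of s x] by (simp add: S_def)
    qed
    have below: "g x = 0" if x: "x < x0" for x
    proof (rule ccontr)
      assume "g x \<noteq> 0"
      then have "x \<in> S" using ge1[of "B' \<inter> {..x}"] B' by (simp add: S_def g_def)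
      then show False using x cInf_lower[OF _ bdd] by (force simp: x0_def)
    qed
    have "(\<lambda>n. g (x0 + inverse (real (Suc n)))) \<longlonglongrightarrow> I (indicator (B' \<inter> {..x0}))"
      unfolding g_def
    proof (rule mf_limit[OF I(1), where C=1])
      fix t :: real
      show "(\<lambda>n. indicat_real (B' \<inter> {..x0 + inverse (real (Suc n))}) t) \<longlonglongrightarrow> indicat_real (B' \<inter> {..x0}) t"
      proof (cases "t \<le> x0")
        case True
        then have "t \<le> x0 + inverse (real (Suc n))" for n by (smt (verit) inverse_nonnegative_iff_nonnegative of_nat_0_le_iff)
        then show ?thesis using True by (simp add: indicator_def)
      next
        case False
        then have "\<forall>\<^sub>F n in sequentially. inverse (real (Suc n)) < t - x0"
          using order_tendstoD(2)[OF LIMSEQ_inverse_real_of_nat, of "t - x0"] by simp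
        then have "\<forall>\<^sub>F n in sequentially. indicat_real (B' \<inter> {..x0 + inverse (real (Suc n))}) t = 0"
          by eventually_elim (auto simp: indicator_def)
        then show ?thesis using False by (simp add: tendsto_eventually)
      qed
    qed (use B' in \<open>auto simp: indicator_def\<close>)
    then have "1 \<le> I (indicator (B' \<inter> {..x0}))"
      by (rule LIMSEQ_le_const) (auto intro!: above)
    moreover have "(\<lambda>n. g (x0 - inverse (real (Suc n)))) \<longlonglongrightarrow> I (indicator (B' \<inter> {..<x0}))"
      unfolding g_def
    proof (rule mf_limit[OF I(1), where C=1])
      fix t :: real
      show "(\<lambda>n. indicat_real (B' \<inter> {..x0 - inverse (real (Suc n))}) t) \<longlonglongrightarrow> indicat_real (B' \<inter> {..<x0}) t"
      proof (cases "t < x0")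
        case False
        then have "\<not> t \<le> x0 - inverse (real (Suc n))" for n by (smt (verit) inverse_positive_iff_positive of_nat_0_less_iff zero_less_Suc)
        then show ?thesis using False by (simp add: indicator_def)
      next
        case True
        then have "\<forall>\<^sub>F n in sequentially. inverse (real (Suc n)) < x0 - t"
          using order_tendstoD(2)[OF LIMSEQ_inverse_real_of_nat, of "x0 - t"] by simp
        then have "\<forall>\<^sub>F n in sequentially. indicat_real (B' \<inter> {..x0 - inverse (real (Suc n))}) t = indicat_real (B' \<inter> {..<x0}) t"
          by eventually_elim (use True in \<open>auto simp: indicator_def\<close>)
        then show ?thesis by (simp add: tendsto_eventually)
      qed
    qed (use B' in \<open>auto simp: indicator_def\<close>)
    then have "I (indicator (B' \<inter> {..<x0})) = 0"
      by (simp add: below LIMSEQ_const_iff)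
    moreover have "I (indicator (B' \<inter> {..x0})) = I (indicator (B' \<inter> {..<x0})) + I (indicator (B' \<inter> {x0}))"
    proof -
      have "indicator (B' \<inter> {..x0}) = (\<lambda>t. indicator (B' \<inter> {..<x0}) t + indicator (B' \<inter> {x0}) t :: real)"
        by (intro ext) (auto simp: indicator_def)
      then show ?thesis using B' by (simp add: mf_add[OF I(1)])
    qed
    ultimately have 1: "1 \<le> I (indicator (B' \<inter> {x0}))" by simp
    show False
    proof (cases "x0 \<in> B'")
      case True
      then have "B' \<inter> {x0} = {x0}" by auto
      then show False using 1 True by (auto simp: B'_def J_def)
    next
      case False
      then have "indicator (B' \<inter> {x0}) = (\<lambda>t::real. 0::real)" by (auto simp: indicator_def)
      then show False using 1 mf_zero[OF I(1)] by simp
    qed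
  qed
  moreover have "I (indicator B) = I (indicator B') + I (indicator (B \<inter> J))"
  proof -
    have "indicator B = (\<lambda>t. indicator B' t + indicator (B \<inter> J) t :: real)"
      by (auto simp: indicator_def B'_def)
    then show ?thesis using B B' Jb by (simp add: mf_add[OF I(1)])
  qed
  ultimately show "I (indicator B) = (\<Sum>x | x \<in> B \<and> I (indicator {x}) \<noteq> 0. I (indicator {x}))"
    using sum[of "B \<inter> J"] J by (simp add: J_def Int_def)
qed

section \<open>Orthogonal projections in finite dimension\<close>

definition ell2_projection :: "'v set \<Rightarrow> (('v \<Rightarrow> complex) \<Rightarrow> 'v \<Rightarrow> complex) \<Rightarrow> bool" where
  "ell2_projection V Q \<longleftrightarrow> ell2_linear V Q \<and> (\<forall>f\<in>ell2 V. Q (Q f) = Q f) \<and>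
     (\<forall>f\<in>ell2 V. \<forall>g\<in>ell2 V. ell2_inner V (Q f) g = ell2_inner V f (Q g))"

lemma ell2_sum:
  "finite U \<Longrightarrow> U \<subseteq> ell2 V \<Longrightarrow> (\<lambda>v. \<Sum>u\<in>U. a u * u v) \<in> ell2 V"
  by (induction U rule: finite_induct) (auto intro!: ell2_add ell2_scale)

lemma ell2_inner_sum_left:
  "finite U \<Longrightarrow> U \<subseteq> ell2 V \<Longrightarrow> g \<in> ell2 V \<Longrightarrow>
    ell2_inner V (\<lambda>v. \<Sum>u\<in>U. a u * u v) g = (\<Sum>u\<in>U. a u * ell2_inner V u g)"
  by (induction U rule: finite_induct) (auto simp: ell2_inner_add_left ell2_inner_scale_left ell2_scale ell2_sum)

text \<open>Induction on the trace: splitting off a unit vector of the range lowers it by one.\<close>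

lemma projection_orthonormal_basis:
  assumes V: "finite V" and Q: "ell2_projection V Q"
  shows "\<exists>U. finite U \<and> U \<subseteq> ell2 V \<and> (\<forall>u\<in>U. \<forall>w\<in>U. ell2_inner V u w = (if u = w then 1 else 0)) \<and>
    (\<forall>f\<in>ell2 V. Q f = (\<lambda>v. \<Sum>u\<in>U. ell2_inner V f u * u v)) \<and>
    real (card U) = (\<Sum>v\<in>V. Re (ell2_inner V (Q (delta_fun v)) (delta_fun v)))"
proof -
  define tr where "tr Q = (\<Sum>v\<in>V. Re (ell2_inner V (Q (delta_fun v)) (delta_fun v)))" for Q
  \<comment> \<open>The trace is not yet known to be an integer, so the induction runs over a strict
    integer upper bound; for the bound 0 it contradicts nonnegativity of the trace.\<close>
  have "\<exists>U. finite U \<and> U \<subseteq> ell2 V \<and> (\<forall>u\<in>U. \<forall>w\<in>U. ell2_inner V u w = (if u = w then 1 else 0)) \<and>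
    (\<forall>f\<in>ell2 V. Q f = (\<lambda>v. \<Sum>u\<in>U. ell2_inner V f u * u v)) \<and> real (card U) = tr Q"
    if "tr Q < real n" "ell2_projection V Q" for n
    using that
  proof (induction n arbitrary: Q)
    case 0
    have Q: "ell2_linear V Q" "\<And>f. f \<in> ell2 V \<Longrightarrow> Q (Q f) = Q f"
      "\<And>f g. f \<in> ell2 V \<Longrightarrow> g \<in> ell2 V \<Longrightarrow> ell2_inner V (Q f) g = ell2_inner V f (Q g)"
      using 0 by (auto simp: ell2_projection_def)
    have "0 \<le> Re (ell2_inner V (Q f) f)" if f: "f \<in> ell2 V" for f
      using Q(3)[OF ell2_linear_closed[OF Q(1) f] f] Q(2)[OF f] by (simp add: ell2_inner_self_sq)
    then have "0 \<le> tr Q" unfolding tr_def by (intro sum_nonneg) auto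
    then show ?case using 0 by simp
  next
    case (Suc n)
    have Q: "ell2_linear V Q" "\<And>f. f \<in> ell2 V \<Longrightarrow> Q (Q f) = Q f"
      "\<And>f g. f \<in> ell2 V \<Longrightarrow> g \<in> ell2 V \<Longrightarrow> ell2_inner V (Q f) g = ell2_inner V f (Q g)"
      using Suc.prems by (auto simp: ell2_projection_def)
    note cl = ell2_linear_closed[OF Q(1)]
    show ?case
    proof (cases "\<forall>f\<in>ell2 V. Q f = (\<lambda>v. 0)")
      case True
      then have "tr Q = 0" unfolding tr_def by (intro sum.neutral) auto
      then show ?thesis using True by (intro exI[of _ "{}"]) auto
    next
      case False
      then obtain g where g: "g \<in> ell2 V" "Q g \<noteq> (\<lambda>v. 0)" by auto
      define s where "s = sqrt (ell2_sq V (Q g))"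
      have s: "s > 0" "s\<^sup>2 = ell2_sq V (Q g)"
        using g ell2_sq_eq_0[OF cl[OF g(1)]] ell2_sq_nonneg[of V "Q g"] by (auto simp: s_def less_le)
      define u where "u v = of_real (1 / s) * Q g v" for v
      have u: "u \<in> ell2 V" unfolding u_def using g cl by (intro ell2_scale)
      have Qu: "Q u = u"
        unfolding u_def using ell2_linear_scale[OF Q(1) cl[OF g(1)], of "of_real (1/s)"] Q(2)[OF g(1)] by simp
      have uu: "ell2_inner V u u = 1"
        using s unfolding ell2_inner_self_sq u_def ell2_sq_scale s(2)[symmetric]
        by (simp add: norm_divide power_divide)
      define Q' where "Q' f v = Q f v - ell2_inner V f u * u v" for f v
      have cl': "Q' f \<in> ell2 V" if "f \<in> ell2 V" for f
        unfolding Q'_def using that u cl by (intro ell2_diff ell2_scale)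
      have lin': "ell2_linear V Q'"
        unfolding ell2_linear_def
      proof (intro conjI ballI allI)
        show "Q' f \<in> ell2 V" if "f \<in> ell2 V" for f by (rule cl'[OF that])
        show "Q' (\<lambda>v. f v + h v) = (\<lambda>v. Q' f v + Q' h v)" if "f \<in> ell2 V" "h \<in> ell2 V" for f h
          unfolding Q'_def using that u
          by (simp add: ell2_linear_add[OF Q(1)] ell2_inner_add_left algebra_simps)
        show "Q' (\<lambda>v. c * f v) = (\<lambda>v. c * Q' f v)" if "f \<in> ell2 V" for f c
          unfolding Q'_def using that u
          by (simp add: ell2_linear_scale[OF Q(1)] ell2_inner_scale_left algebra_simps)
      qed
      have Q'u: "Q' u = (\<lambda>v. 0)" by (intro ext) (simp add: Q'_def Qu uu)
      have Q'eq: "Q' f = Q f" if "f \<in> ell2 V" "ell2_inner V f u = 0" for f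
        using that by (intro ext) (simp add: Q'_def)
      have orth: "ell2_inner V (Q' f) u = 0" if f: "f \<in> ell2 V" for f
      proof -
        have "ell2_inner V (Q' f) u = ell2_inner V (Q f) u - ell2_inner V f u * ell2_inner V u u"
          unfolding Q'_def using f u cl by (simp add: ell2_inner_diff_left ell2_inner_scale_left ell2_scale)
        then show ?thesis using Q(3)[OF f u] by (simp add: Qu uu)
      qed
      have proj': "ell2_projection V Q'"
        unfolding ell2_projection_def
      proof (intro conjI ballI)
        show "ell2_linear V Q'" by (rule lin')
        show "Q' (Q' f) = Q' f" if f: "f \<in> ell2 V" for f
        proof -
          have "Q' (Q' f) = Q (Q' f)" by (rule Q'eq[OF cl'[OF f] orth[OF f]])
          also have "\<dots> = (\<lambda>v. Q (Q f) v - ell2_inner V f u * Q u v)"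
            unfolding Q'_def using f u cl
            by (simp add: ell2_linear_diff[OF Q(1)] ell2_linear_scale[OF Q(1)] ell2_scale)
          finally show ?thesis by (simp add: Q(2)[OF f] Qu Q'_def[abs_def])
        qed
        show "ell2_inner V (Q' f) h = ell2_inner V f (Q' h)" if "f \<in> ell2 V" "h \<in> ell2 V" for f h
          unfolding Q'_def using that u cl
          by (simp add: ell2_inner_diff_left ell2_inner_diff_right ell2_inner_scale_left ell2_inner_scale_right ell2_scale Q(3)
              ell2_inner_cnj[of V u h])
      qed
      have trQ': "tr Q' = tr Q - 1"
      proof -
        have "Re (ell2_inner V (Q' (delta_fun v)) (delta_fun v))
            = Re (ell2_inner V (Q (delta_fun v)) (delta_fun v)) - Re (u v * cnj (u v))" if v: "v \<in> V" for v
          unfolding Q'_def using v u cl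
          by (simp add: ell2_inner_delta ell2_inner_cnj[of V "delta_fun v" u] mult.commute)
        then have "tr Q' = tr Q - (\<Sum>v\<in>V. Re (u v * cnj (u v)))"
          unfolding tr_def by (simp add: sum_subtractf)
        also have "(\<Sum>v\<in>V. Re (u v * cnj (u v))) = Re (ell2_inner V u u)"
          using V by (simp add: ell2_inner_def)
        finally show ?thesis by (simp add: uu)
      qed
      then have "tr Q' < real n" using Suc.prems by simp
      then obtain U where U: "finite U" "U \<subseteq> ell2 V"
        "\<And>u w. u \<in> U \<Longrightarrow> w \<in> U \<Longrightarrow> ell2_inner V u w = (if u = w then 1 else 0)"
        "\<And>f. f \<in> ell2 V \<Longrightarrow> Q' f = (\<lambda>v. \<Sum>u\<in>U. ell2_inner V f u * u v)" "real (card U) = tr Q'"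
        using Suc.IH[OF _ proj'] by blast
      have wu: "ell2_inner V w u = 0" "ell2_inner V u w = 0" if w: "w \<in> U" for w
      proof -
        have wV: "w \<in> ell2 V" using w U by auto
        have "Q' w = (\<lambda>v. \<Sum>u\<in>U. if u = w then w v else 0)"
          unfolding U(4)[OF wV] using U(3)[OF w] by (intro ext sum.cong) auto
        then have "Q' w = w" using U(1) w by simp
        then show 1: "ell2_inner V w u = 0" using orth[OF wV] by simp
        show "ell2_inner V u w = 0" using 1 by (simp add: ell2_inner_cnj[of V u w])
      qed
      have "u \<notin> U" using wu(1)[of u] uu by auto
      show ?thesis
      proof (intro exI[of _ "insert u U"] conjI ballI)
        show "finite (insert u U)" "insert u U \<subseteq> ell2 V" using U u by auto
        show "ell2_inner V a b = (if a = b then 1 else 0)" if "a \<in> insert u U" "b \<in> insert u U" for a b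
          using that U(3) wu uu \<open>u \<notin> U\<close> by auto
        show "Q f = (\<lambda>v. \<Sum>w\<in>insert u U. ell2_inner V f w * w v)" if f: "f \<in> ell2 V" for f
          using fun_cong[OF U(4)[OF f]] U(1) \<open>u \<notin> U\<close> by (auto simp: Q'_def diff_eq_eq algebra_simps)
        show "real (card (insert u U)) = tr Q" using U \<open>u \<notin> U\<close> trQ' by simp
      qed
    qed
  qed
  then show ?thesis using Q reals_Archimedean2[of "tr Q"] unfolding tr_def by blast
qed

text \<open>The orthonormal system supplied by \<open>projection_orthonormal_basis\<close> is a
  basis of the range in the algebraic sense used by \<open>eigenvalue_count\<close>.\<close>

lemma projection_trace_dim:
  assumes V: "finite V" and Q: "ell2_projection V Q"
  shows "real (vector_space.dim (\<lambda>(c::complex) f v. c * f v) (Q ` ell2 V))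
    = (\<Sum>v\<in>V. Re (ell2_inner V (Q (delta_fun v)) (delta_fun v)))"
proof -
  interpret cf: vector_space "\<lambda>(c::complex) (f :: 'a \<Rightarrow> complex) v. c * f v"
    by unfold_locales (auto simp: algebra_simps)
  obtain U where U: "finite U" "U \<subseteq> ell2 V"
    "\<And>u w. u \<in> U \<Longrightarrow> w \<in> U \<Longrightarrow> ell2_inner V u w = (if u = w then 1 else 0)"
    "\<And>f. f \<in> ell2 V \<Longrightarrow> Q f = (\<lambda>v. \<Sum>u\<in>U. ell2_inner V f u * u v)"
    "real (card U) = (\<Sum>v\<in>V. Re (ell2_inner V (Q (delta_fun v)) (delta_fun v)))"
    using projection_orthonormal_basis[OF V Q] by blast
  have sum_fun: "(\<Sum>u\<in>U. (\<lambda>v. a u * u v)) = (\<lambda>v. \<Sum>u\<in>U. a u * u v)" for a :: "('a \<Rightarrow> complex) \<Rightarrow> complex"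
    using U(1) by (induction U rule: finite_induct) (auto simp: fun_eq_iff)
  have "card U = cf.dim (Q ` ell2 V)"
  proof (rule cf.basis_card_eq_dim)
    show "U \<subseteq> Q ` ell2 V"
    proof
      fix w assume w: "w \<in> U"
      have "Q w = (\<lambda>v. \<Sum>u\<in>U. if u = w then w v else 0)"
        unfolding U(4)[OF subsetD[OF U(2) w]] using U(3)[OF w] by (intro ext sum.cong) auto
      then have "Q w = w" using U(1) w by simp
      then show "w \<in> Q ` ell2 V" using U(2) w by (metis image_eqI subsetD)
    qed
    show "Q ` ell2 V \<subseteq> cf.span U"
    proof
      fix h assume "h \<in> Q ` ell2 V"
      then obtain f where "f \<in> ell2 V" "h = Q f" by auto
      then have "h = (\<Sum>u\<in>U. (\<lambda>v. ell2_inner V f u * u v))" using U(4) sum_fun by simp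
      then show "h \<in> cf.span U"
        by (simp only:) (rule cf.span_sum, rule cf.span_scale, rule cf.span_base)
    qed
    show "cf.independent U"
    proof (rule cf.independent_if_scalars_zero[OF U(1)])
      fix a w assume 0: "(\<Sum>u\<in>U. (\<lambda>v. a u * u v)) = 0" and w: "w \<in> U"
      have "ell2_inner V (\<lambda>v. \<Sum>u\<in>U. a u * u v) w = 0"
        using 0 unfolding sum_fun by (simp add: zero_fun_def)
      moreover have "ell2_inner V (\<lambda>v. \<Sum>u\<in>U. a u * u v) w = (\<Sum>u\<in>U. if u = w then a w else 0)"
        unfolding ell2_inner_sum_left[OF U(1,2) subsetD[OF U(2) w]]
        using U(3) w by (intro sum.cong) auto
      ultimately show "a w = 0" using U(1) w by simp
    qed
  qed
  then show ?thesis using U(5) by simp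
qed

section \<open>Eigenspaces as ranges of spectral projections\<close>

context psd_operator
begin

lemma spectral_proj_projection: "B \<in> sets borel \<Longrightarrow> ell2_projection V (spectral_proj B)"
  unfolding ell2_projection_def
  using spectral_proj_linear spectral_proj_sym spectral_proj_Int[of _ B B] by auto

lemma spectral_functional_eq: "f \<in> ell2 V \<Longrightarrow> B \<in> sets borel \<Longrightarrow>
    Re (ell2_inner V (spectral_proj B f) f) = spectral_functional f (indicator B)"
  by (simp add: spectral_proj_inner spectral_form_self)

text \<open>A vector fixed by the projection has its spectral form concentrated at
  \<open>\<mu>\<close>, where t acts as \<open>\<mu>\<close>. Conversely, for an eigenvector the
  density t - \<open>\<mu>\<close> kills the form, which therefore has no mass away from
  \<open>\<mu>\<close>.\<close>

lemma eigenspace_eq: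
  assumes V: "finite V"
  shows "eigenspace V A \<mu> = spectral_proj {\<mu>} ` ell2 V"
proof (intro equalityI subsetI)
  fix f assume "f \<in> spectral_proj {\<mu>} ` ell2 V"
  then obtain g where g: "g \<in> ell2 V" "f = spectral_proj {\<mu>} g" by auto
  have f: "f \<in> ell2 V" using g by (simp add: spectral_proj_closed)
  have Pf: "spectral_proj {\<mu>} f = f" using spectral_proj_Int[OF g(1), of "{\<mu>}" "{\<mu>}"] g by simp
  have "A f = (\<lambda>v. of_real \<mu> * f v)"
  proof (rule ell2_eqI)
    fix k assume k: "k \<in> ell2 V"
    have iC: "indicator {\<mu>} \<in> bounded_borel c" by simp
    have shift: "spectral_form f k (\<lambda>t. t ^ n * 1) = spectral_form f k (\<lambda>t. indicator {\<mu>} t * (t ^ n * 1))" for n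
    proof -
      have h: "(\<lambda>t. t ^ n * 1) \<in> bounded_borel c" by simp
      have "spectral_form f k (\<lambda>t. t ^ n * 1) = cnj (spectral_form k (spectral_proj {\<mu>} f) (\<lambda>t. t ^ n * 1))"
        using spectral_form_cnj[OF k f h] Pf by simp
      also have "\<dots> = cnj (spectral_form k f (\<lambda>t. indicator {\<mu>} t * (t ^ n * 1)))"
        by (subst spectral_form_proj_right[OF k f _ h]) auto
      also have "\<dots> = spectral_form f k (\<lambda>t. indicator {\<mu>} t * (t ^ n * 1))"
        using spectral_form_cnj[OF k f bounded_borel_mult[OF iC h]] by simp
      finally show ?thesis .
    qed
    have "(\<lambda>t. indicator {\<mu>} t * (t ^ 1 * 1)) = (\<lambda>t. \<mu> * (indicator {\<mu>} t * (t ^ 0 * 1)))"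
      by (auto simp: indicator_def)
    then have "spectral_form f k (\<lambda>t. t ^ 1 * 1) = of_real \<mu> * spectral_form f k (\<lambda>t. t ^ 0 * 1)"
      unfolding shift using mf_scale[OF spectral_form[OF f k], of "\<lambda>t. indicator {\<mu>} t * (t ^ 0 * 1)" \<mu>]
      by (simp add: scaleR_conv_of_real)
    then show "ell2_inner V (A f) k = ell2_inner V (\<lambda>v. of_real \<mu> * f v) k"
      using f k spectral_form_moment[OF f k, of 1] spectral_form_moment[OF f k, of 0]
      by (simp add: ell2_inner_scale_left)
  qed (use f in \<open>auto intro: closed ell2_scale\<close>)
  then show "f \<in> eigenspace V A \<mu>" using f by (simp add: eigenspace_def ell2_zero_outside)
next
  fix f assume "f \<in> eigenspace V A \<mu>"
  then have Af: "A f = (\<lambda>v. of_real \<mu> * f v)" and f0: "\<And>v. v \<notin> V \<Longrightarrow> f v = 0"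
    by (auto simp: eigenspace_def)
  have f: "f \<in> ell2 V" by (rule ell2_finite_support[of V]) (use V f0 in auto)
  have "spectral_proj {\<mu>} f = f"
  proof (rule ell2_eqI)
    fix k assume k: "k \<in> ell2 V"
    have shift: "spectral_form f k (\<lambda>t. (t - \<mu>) * h t) = 0" if h: "h \<in> bounded_borel c" for h
    proof -
      have "spectral_form f k (\<lambda>t. t ^ 1 * h t) = spectral_form (\<lambda>v. of_real \<mu> * f v) k h"
        using spectral_form_pow_left[OF f k h, of 1] Af by simp
      also have "\<dots> = of_real \<mu> * spectral_form f k h" by (rule spectral_form_scale_left[OF f k h])
      also have "\<dots> = spectral_form f k (\<lambda>t. \<mu> * h t)"
        using mf_scale[OF spectral_form[OF f k] h, of \<mu>] by (simp add: scaleR_conv_of_real)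
      finally show ?thesis using h mf_diff[OF spectral_form[OF f k], of "\<lambda>t. t * h t" "\<lambda>t. \<mu> * h t"]
        by (simp add: algebra_simps)
    qed
    \<comment> \<open>The inverse of t - \<open>\<mu>\<close>, cut off within distance 1/n of
      \<open>\<mu>\<close> and so bounded by n. The products (t - \<open>\<mu>\<close>) h stay
      bounded by 1 and tend to the indicator of the complement of \<open>\<mu>\<close>.\<close>
    define h where "h n t = (if 1 \<le> real n * \<bar>t - \<mu>\<bar> then 1 / (t - \<mu>) else 0)" for n :: nat and t
    have hb: "h n \<in> bounded_borel c" for n
    proof (rule bounded_borelI[where C="real n"])
      show "h n \<in> borel_measurable borel" unfolding h_def by measurable
      show "\<bar>h n t\<bar> \<le> real n" for t
      proof (cases "1 \<le> real n * \<bar>t - \<mu>\<bar>")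
        case True
        then have "0 < \<bar>t - \<mu>\<bar>" by (cases "t = \<mu>") auto
        then show ?thesis using True by (simp add: h_def abs_divide divide_le_eq)
      qed (simp add: h_def)
    qed
    have "(\<lambda>n. spectral_form f k (\<lambda>t. (t - \<mu>) * h n t)) \<longlonglongrightarrow> spectral_form f k (\<lambda>t. 1 - indicator {\<mu>} t)"
    proof (rule mf_limit[OF spectral_form[OF f k], where C=1])
      show "(\<lambda>t. (t - \<mu>) * h n t) \<in> borel_measurable borel" for n
        by (rule bounded_borel_measurable[where R=c]) (use hb[of n] in auto)
      show "\<bar>(t - \<mu>) * h n t\<bar> \<le> 1" for n t by (auto simp: h_def)
      show "(\<lambda>n. (t - \<mu>) * h n t) \<longlonglongrightarrow> 1 - indicator {\<mu>} t" for t
      proof (cases "t = \<mu>")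
        case True then show ?thesis by simp
      next
        case False
        then have pos: "0 < \<bar>t - \<mu>\<bar>" by simp
        obtain N :: nat where N: "1 / \<bar>t - \<mu>\<bar> \<le> real N" using real_arch_simple by blast
        have "\<forall>\<^sub>F n in sequentially. (t - \<mu>) * h n t = 1"
        proof (rule eventually_sequentiallyI[of N])
          fix n assume "N \<le> n"
          then have "1 / \<bar>t - \<mu>\<bar> \<le> real n" using N by linarith
          then have "1 \<le> real n * \<bar>t - \<mu>\<bar>" using pos by (simp add: pos_divide_le_eq)
          then show "(t - \<mu>) * h n t = 1" using False by (simp add: h_def)
        qed
        then show ?thesis using False by (simp add: tendsto_eventually)
      qed
    qed (auto intro!: borel_measurable_diff borel_measurable_indicator)
    then have "spectral_form f k (\<lambda>t. 1 - indicator {\<mu>} t) = 0"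
      using shift[OF hb] by (simp add: LIMSEQ_const_iff)
    then have "ell2_inner V f k = spectral_form f k (indicator {\<mu>})"
      using mf_diff[OF spectral_form[OF f k], of "\<lambda>t. 1" "indicator {\<mu>}"] spectral_form_one[OF f k] by simp
    then show "ell2_inner V (spectral_proj {\<mu>} f) k = ell2_inner V f k"
      by (simp add: spectral_proj_inner[OF f k])
  qed (use f in \<open>auto intro: spectral_proj_closed\<close>)
  then show "f \<in> spectral_proj {\<mu>} ` ell2 V" using f by (metis image_eqI)
qed

text \<open>The trace measure assigns to \<open>B\<close> the dimension of the range of P(B). Being
  integer-valued, it is a finite sum of atoms, and these are the eigenvalues weighted by
  multiplicity.\<close>

theorem eigenvalue_count_eq:
  assumes V: "finite V"
  shows "real (eigenvalue_count V A l) = (\<Sum>v\<in>V. spectral_functional (delta_fun v) (indicator {..l}))"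
proof -
  define \<nu> where "\<nu> h = (\<Sum>v\<in>V. spectral_functional (delta_fun v) h)" for h
  let ?dim = "vector_space.dim (\<lambda>(c::complex) (f :: 'v \<Rightarrow> complex) v. c * f v)"
  have \<nu>: "measure_functional c \<nu>" "positive_functional c \<nu>"
  proof -
    show "measure_functional c \<nu>"
      unfolding \<nu>_def using V by (intro mf_sum_functional spectral_functional) auto
    show "positive_functional c \<nu>"
      using spectral_functional_pos[OF ell2_delta]
      by (auto simp: positive_functional_def \<nu>_def intro!: sum_nonneg)
  qed
  have dim: "\<nu> (indicator B) = real (?dim (spectral_proj B ` ell2 V))" if B: "B \<in> sets borel" for B
    unfolding projection_trace_dim[OF V spectral_proj_projection[OF B]] \<nu>_def
    by (intro sum.cong) (simp_all add: spectral_functional_eq B)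
  have dim': "\<nu> (indicator {\<mu>}) = real (?dim (eigenspace V A \<mu>))" for \<mu>
    using dim[of "{\<mu>}"] by (simp add: eigenspace_eq[OF V])
  interpret cf: vector_space "\<lambda>(c::complex) (f :: 'v \<Rightarrow> complex) v. c * f v"
    by unfold_locales (auto simp: algebra_simps)
  have sub: "{\<mu>. \<mu> \<le> l \<and> \<nu> (indicator {\<mu>}) \<noteq> 0} \<subseteq> {\<mu>. \<mu> \<le> l \<and> (\<exists>f\<in>eigenspace V A \<mu>. f \<noteq> 0)}"
  proof clarify
    fix \<mu> assume nz: "\<nu> (indicator {\<mu>}) \<noteq> 0"
    show "\<exists>f\<in>eigenspace V A \<mu>. f \<noteq> 0"
    proof (rule ccontr)
      assume "\<not> ?thesis"
      then have "eigenspace V A \<mu> \<subseteq> {0}" by auto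
      then have "cf.dim (eigenspace V A \<mu>) = 0"
        using cf.basis_card_eq_dim[of "{}" "eigenspace V A \<mu>"] cf.independent_empty by simp
      then show False using nz dim' by simp
    qed
  qed
  \<comment> \<open>Mass zero means an empty orthonormal basis, so the projection onto the
    eigenspace would vanish.\<close>
  have sup: "\<nu> (indicator {\<mu>}) \<noteq> 0" if f: "f \<in> eigenspace V A \<mu>" "f \<noteq> 0" for f \<mu>
  proof
    assume 0: "\<nu> (indicator {\<mu>}) = 0"
    have f': "f \<in> ell2 V" using f V by (intro ell2_finite_support[of V]) (auto simp: eigenspace_def)
    obtain g where g: "g \<in> ell2 V" "f = spectral_proj {\<mu>} g" using f eigenspace_eq[OF V] by auto
    obtain U where U: "finite U" "\<And>f. f \<in> ell2 V \<Longrightarrow> spectral_proj {\<mu>} f = (\<lambda>v. \<Sum>u\<in>U. ell2_inner V f u * u v)"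
      "real (card U) = (\<Sum>v\<in>V. Re (ell2_inner V (spectral_proj {\<mu>} (delta_fun v)) (delta_fun v)))"
      using projection_orthonormal_basis[OF V spectral_proj_projection, of "{\<mu>}"] by auto
    have "real (card U) = \<nu> (indicator {\<mu>})"
      unfolding U(3) \<nu>_def by (intro sum.cong) (simp_all add: spectral_functional_eq)
    then have "U = {}" using 0 U(1) by simp
    then show False using U(2)[OF g(1)] g f by (simp add: zero_fun_def)
  qed
  have "real (eigenvalue_count V A l) = (\<Sum>\<mu> | \<mu> \<le> l \<and> (\<exists>f\<in>eigenspace V A \<mu>. f \<noteq> 0). \<nu> (indicator {\<mu>}))"
    by (simp add: eigenvalue_count_def dim')
  also have "{\<mu>. \<mu> \<le> l \<and> (\<exists>f\<in>eigenspace V A \<mu>. f \<noteq> 0)} = {\<mu>. \<mu> \<in> {..l} \<and> \<nu> (indicator {\<mu>}) \<noteq> 0}"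
    using sub sup by auto
  also have "(\<Sum>\<mu>\<in>\<dots>. \<nu> (indicator {\<mu>})) = \<nu> (indicator {..l})"
    by (rule integer_valued_functional_atomic(2)[OF \<nu>, symmetric]) (use dim in auto)
  finally show ?thesis by (simp add: \<nu>_def)
qed

end

section \<open>Magnetic Laplacians of bounded degree\<close>

lemma ell2_restrict_inner:
  assumes "W \<subseteq> V" "\<And>v. v \<notin> W \<Longrightarrow> g v = 0"
  shows "ell2_inner V f g = ell2_inner W f g" "ell2_inner V g f = ell2_inner W g f"
  unfolding ell2_inner_def by (rule infsum_cong_neutral; use assms in auto)+

lemma ell2_mono: "W \<subseteq> V \<Longrightarrow> f \<in> ell2 W \<Longrightarrow> f \<in> ell2 V"
proof -
  assume W: "W \<subseteq> V" and f: "f \<in> ell2 W"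
  have "(\<lambda>v. (cmod (f v))\<^sup>2) summable_on V \<longleftrightarrow> (\<lambda>v. (cmod (f v))\<^sup>2) summable_on W"
    using W ell2_zero_outside[OF f] by (intro summable_on_cong_neutral) auto
  then show ?thesis using f W by (auto simp: ell2_def)
qed

lemma restrict_proj_ell2:
  assumes "W \<subseteq> V" "f \<in> ell2 V" shows "restrict_proj W f \<in> ell2 W"
proof -
  have "(\<lambda>v. (cmod (f v))\<^sup>2) summable_on W"
    by (rule summable_on_subset_banach[OF ell2_summable[OF assms(2)] assms(1)])
  also have "?this \<longleftrightarrow> (\<lambda>v. (cmod (restrict_proj W f v))\<^sup>2) summable_on W"
    by (intro summable_on_cong) (simp add: restrict_proj_def)
  finally show ?thesis by (simp add: ell2_def restrict_proj_def)
qed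

lemma restrict_proj_id: "f \<in> ell2 W \<Longrightarrow> restrict_proj W f = f"
  by (auto simp: restrict_proj_def ell2_zero_outside)

text \<open>On functions supported in \<open>W\<close> the compression has the same sesquilinear
  form as \<open>A\<close>, so symmetry and both bounds are inherited. This covers the Dirichlet
  condition.\<close>

lemma (in psd_operator) psd_operator_compression:
  assumes W: "W \<subseteq> V"
  shows "psd_operator W (restrict_proj W \<circ> A \<circ> restrict_proj W) c"
proof -
  let ?B = "restrict_proj W \<circ> A \<circ> restrict_proj W"
  have B: "?B f = restrict_proj W (A f)" if "f \<in> ell2 W" for f
    using that by (simp add: restrict_proj_id)
  have Bcl: "?B f \<in> ell2 W" if "f \<in> ell2 W" for f
    using B[OF that] restrict_proj_ell2[OF W closed[OF ell2_mono[OF W that]]] by simp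
  have inner: "ell2_inner W (?B f) g = ell2_inner V (A f) g" if f: "f \<in> ell2 W" and g: "g \<in> ell2 W" for f g
  proof -
    have "ell2_inner W (?B f) g = ell2_inner W (A f) g"
      unfolding B[OF f] ell2_inner_def by (intro infsum_cong) (simp add: restrict_proj_def)
    then show ?thesis using ell2_restrict_inner(1)[OF W ell2_zero_outside[OF g]] by simp
  qed
  have inner2: "ell2_inner W f g = ell2_inner V f g" if g: "g \<in> ell2 W" for f g
    using ell2_restrict_inner(1)[OF W ell2_zero_outside[OF g]] by simp
  show ?thesis
  proof
    show "0 < c" by (rule c_pos)
    show "ell2_linear W ?B"
      unfolding ell2_linear_def
    proof (intro conjI ballI allI)
      fix f g assume f: "f \<in> ell2 W" and g: "g \<in> ell2 W"
      show "?B (\<lambda>v. f v + g v) = (\<lambda>v. ?B f v + ?B g v)"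
        unfolding B[OF f] B[OF g] B[OF ell2_add[OF f g]]
        by (auto simp: restrict_proj_def ell2_linear_add[OF linear ell2_mono[OF W f] ell2_mono[OF W g]])
    next
      fix a f assume f: "f \<in> ell2 W"
      show "?B (\<lambda>v. a * f v) = (\<lambda>v. a * ?B f v)"
        unfolding B[OF f] B[OF ell2_scale[OF f]]
        by (auto simp: restrict_proj_def ell2_linear_scale[OF linear ell2_mono[OF W f]])
    qed (rule Bcl)
    fix f assume f: "f \<in> ell2 W"
    show "ell2_inner W (?B f) g = ell2_inner W f (?B g)" if g: "g \<in> ell2 W" for g
      using inner[OF f g] sym[OF ell2_mono[OF W f] ell2_mono[OF W g]] inner[OF g f]
        ell2_inner_cnj[of W f "?B g"] ell2_inner_cnj[of V f "A g"] by simp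
    show "0 \<le> Re (ell2_inner W (?B f) f)"
      using nonneg[OF ell2_mono[OF W f]] inner[OF f f] by simp
    show "Re (ell2_inner W (?B f) f) \<le> c * ell2_sq W f"
      using le[OF ell2_mono[OF W f]] inner[OF f f] inner2[OF f, of f] by (simp add: ell2_sq_def)
  qed
qed

text \<open>General enough for the graph itself and for its finite pieces with the same
  \<open>D\<close>, so that Neumann operators are instances of the same theory.\<close>

locale magnetic_graph =
  fixes X :: "('v, 'e) pre_digraph" and rv :: "'e \<Rightarrow> 'e" and Ep :: "'e set" and \<sigma> :: "'e \<Rightarrow> complex" and D :: nat
  assumes rv_arcs: "e \<in> arcs X \<Longrightarrow> rv e \<in> arcs X"
    and rv_rv: "e \<in> arcs X \<Longrightarrow> rv (rv e) = e"
    and tail_rv: "e \<in> arcs X \<Longrightarrow> tail X (rv e) = head X e"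
    and head_verts: "e \<in> arcs X \<Longrightarrow> head X e \<in> verts X"
    and weight: "e \<in> arcs X \<Longrightarrow> cmod (\<sigma> e) = 1"
    and weight_rv: "e \<in> arcs X \<Longrightarrow> \<sigma> (rv e) = inverse (\<sigma> e)"
    and Ep: "Ep \<subseteq> arcs X" "\<And>e. e \<in> arcs X \<Longrightarrow> e \<in> Ep \<longleftrightarrow> rv e \<notin> Ep"
    and degree: "v \<in> verts X \<Longrightarrow> finite (in_arcs X v)" "v \<in> verts X \<Longrightarrow> card (in_arcs X v) \<le> D"
begin

abbreviation \<Delta> :: "('v \<Rightarrow> complex) \<Rightarrow> 'v \<Rightarrow> complex" where
  "\<Delta> \<equiv> dml X Ep \<sigma>"

lemma head_rv: "e \<in> arcs X \<Longrightarrow> head X (rv e) = tail X e"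
  using tail_rv[OF rv_arcs] rv_rv by simp

lemma tail_verts: "e \<in> arcs X \<Longrightarrow> tail X e \<in> verts X"
  using head_verts[OF rv_arcs] head_rv by simp

lemma weight_mult_cnj: "e \<in> arcs X \<Longrightarrow> \<sigma> e * cnj (\<sigma> e) = 1"
  using weight[of e] complex_norm_square[of "\<sigma> e"] by simp

lemma weight_cnj: "e \<in> arcs X \<Longrightarrow> \<sigma> (rv e) = cnj (\<sigma> e)"
  using weight_rv[of e] inverse_unique[OF weight_mult_cnj[of e]] by simp

lemma bij_rv: "bij_betw rv (arcs X) (arcs X)"
  by (rule bij_betw_byWitness[of _ rv]) (auto simp: rv_rv rv_arcs)

text \<open>Reversal maps the chosen arcs leaving v onto the arcs entering v that are not chosen,
  and conjugates the weight. So the two sums merge into one over all incoming arcs, free of the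
  orientation; a loop contributes one arc to each sum.\<close>

lemma dml_eq:
  assumes v: "v \<in> verts X"
  shows "\<Delta> f v = of_nat (in_degree X v) * f v - (\<Sum>e\<in>in_arcs X v. \<sigma> e * f (tail X e))"
proof -
  let ?A = "{e. e \<in> Ep \<and> head X e = v}" and ?B = "{e. e \<in> Ep \<and> tail X e = v}"
  have eq: "in_arcs X v = ?A \<union> rv ` ?B"
  proof (intro equalityI subsetI)
    fix e assume "e \<in> in_arcs X v"
    then have e: "e \<in> arcs X" "head X e = v" by auto
    show "e \<in> ?A \<union> rv ` ?B"
    proof (cases "e \<in> Ep")
      case False
      then have "rv e \<in> ?B" using e Ep(2)[of e] tail_rv by auto
      then have "rv (rv e) \<in> rv ` ?B" by (rule imageI)
      then show ?thesis using e by (simp add: rv_rv)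
    qed (use e in simp)
  qed (use Ep(1) rv_arcs head_rv in auto)
  have disj: "?A \<inter> rv ` ?B = {}" using Ep by auto
  have inj: "inj_on rv ?B" using Ep(1) rv_rv by (intro inj_on_inverseI[of _ rv]) auto
  have fin: "finite ?A" "finite (rv ` ?B)" using degree(1)[OF v] unfolding eq by auto
  have "(\<Sum>e\<in>in_arcs X v. \<sigma> e * f (tail X e))
      = (\<Sum>e\<in>?A. \<sigma> e * f (tail X e)) + (\<Sum>e\<in>?B. \<sigma> (rv e) * f (tail X (rv e)))"
    unfolding eq using fin disj inj by (simp add: sum.union_disjoint sum.reindex)
  also have "(\<Sum>e\<in>?B. \<sigma> (rv e) * f (tail X (rv e))) = (\<Sum>e\<in>?B. cnj (\<sigma> e) * f (head X e))"
    using Ep(1) by (intro sum.cong) (auto simp: weight_cnj tail_rv)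
  finally show ?thesis using v by (simp add: dml_def)
qed

section \<open>Sums over arcs and the magnetic gradient\<close>

lemma arcs_bij: "bij_betw snd (Sigma (verts X) (in_arcs X)) (arcs X)"
  by (rule bij_betw_byWitness[of _ "\<lambda>e. (head X e, e)"]) (auto simp: head_verts)

lemma arcs_summable:
  fixes F :: "'e \<Rightarrow> real"
  assumes "\<And>e. 0 \<le> F e" "(\<lambda>v. \<Sum>e\<in>in_arcs X v. F e) summable_on verts X"
  shows "F summable_on arcs X"
proof -
  have "(\<lambda>x. norm (F (snd x))) summable_on (Sigma (verts X) (in_arcs X))"
    unfolding Infinite_Sum.abs_summable_on_Sigma_iff
  proof (intro conjI ballI)
    have "(\<lambda>v. \<Sum>e\<in>in_arcs X v. F e) summable_on verts X
      \<longleftrightarrow> (\<lambda>v. norm (\<Sum>\<^sub>\<infinity>e\<in>in_arcs X v. norm (F (snd (v, e))))) summable_on verts X"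
      using assms(1) by (intro summable_on_cong) (simp add: degree(1) sum_nonneg)
    then show "(\<lambda>v. norm (\<Sum>\<^sub>\<infinity>e\<in>in_arcs X v. norm (F (snd (v, e))))) summable_on verts X"
      using assms(2) by simp
  qed (simp add: degree(1))
  then show ?thesis
    using summable_on_reindex_bij_betw[OF arcs_bij, of F] assms(1) by simp
qed

lemma
  fixes F :: "'e \<Rightarrow> 'b::banach"
  assumes F: "F summable_on arcs X"
  shows arcs_infsum: "(\<Sum>\<^sub>\<infinity>e\<in>arcs X. F e) = (\<Sum>\<^sub>\<infinity>v\<in>verts X. \<Sum>e\<in>in_arcs X v. F e)"
    and arcs_fibre_summable: "(\<lambda>v. \<Sum>e\<in>in_arcs X v. F e) summable_on verts X"
proof -
  have s: "(\<lambda>x. F (snd x)) summable_on Sigma (verts X) (in_arcs X)"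
    using summable_on_reindex_bij_betw[OF arcs_bij, of F] F by simp
  have "(\<Sum>\<^sub>\<infinity>e\<in>arcs X. F e) = (\<Sum>\<^sub>\<infinity>x\<in>Sigma (verts X) (in_arcs X). F (snd x))"
    by (rule infsum_reindex_bij_betw[OF arcs_bij, symmetric])
  also have "\<dots> = (\<Sum>\<^sub>\<infinity>v\<in>verts X. \<Sum>\<^sub>\<infinity>e\<in>in_arcs X v. F (snd (v, e)))"
    by (rule infsum_Sigma_banach[OF s, symmetric])
  also have "\<dots> = (\<Sum>\<^sub>\<infinity>v\<in>verts X. \<Sum>e\<in>in_arcs X v. F e)"
    by (rule infsum_cong) (simp add: degree(1))
  finally show "(\<Sum>\<^sub>\<infinity>e\<in>arcs X. F e) = (\<Sum>\<^sub>\<infinity>v\<in>verts X. \<Sum>e\<in>in_arcs X v. F e)" .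
  have "(\<lambda>v. \<Sum>\<^sub>\<infinity>e\<in>in_arcs X v. F e) summable_on verts X"
  proof (rule summable_on_Sigma_banach[of "\<lambda>v e. F e"])
    show "(\<lambda>(v, e). F e) summable_on Sigma (verts X) (in_arcs X)"
      using s by (simp add: case_prod_unfold)
  qed
  also have "?this \<longleftrightarrow> (\<lambda>v. \<Sum>e\<in>in_arcs X v. F e) summable_on verts X"
    by (rule summable_on_cong) (simp add: degree(1))
  finally show "(\<lambda>v. \<Sum>e\<in>in_arcs X v. F e) summable_on verts X" .
qed

text \<open>\<open>head_lift f - tail_lift f\<close> is the magnetic gradient of \<open>f\<close>.
  The two halves are kept apart because their norms are computed separately.\<close>

definition head_lift :: "('v \<Rightarrow> complex) \<Rightarrow> 'e \<Rightarrow> complex" where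
  "head_lift f e = (if e \<in> arcs X then f (head X e) else 0)"

definition tail_lift :: "('v \<Rightarrow> complex) \<Rightarrow> 'e \<Rightarrow> complex" where
  "tail_lift f e = (if e \<in> arcs X then \<sigma> e * f (tail X e) else 0)"

lemma head_lift_ell2:
  assumes "f \<in> ell2 (verts X)" shows "head_lift f \<in> ell2 (arcs X)"
proof -
  have "(\<lambda>e. (cmod (head_lift f e))\<^sup>2) summable_on arcs X"
  proof (rule arcs_summable)
    have eq: "(\<Sum>e\<in>in_arcs X v. (cmod (head_lift f e))\<^sup>2) = real (in_degree X v) * (cmod (f v))\<^sup>2" for v
      by (simp add: head_lift_def in_degree_def)
    show "(\<lambda>v. \<Sum>e\<in>in_arcs X v. (cmod (head_lift f e))\<^sup>2) summable_on verts X"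
    proof (rule summable_on_comparison_test)
      show "(\<lambda>v. real D * (cmod (f v))\<^sup>2) summable_on verts X"
        by (intro summable_on_cmult_right ell2_summable assms)
      show "(\<Sum>e\<in>in_arcs X v. (cmod (head_lift f e))\<^sup>2) \<le> real D * (cmod (f v))\<^sup>2" if "v \<in> verts X" for v
        unfolding eq using degree(2)[OF that] by (intro mult_right_mono) (auto simp: in_degree_def)
    qed (auto intro: sum_nonneg)
  qed auto
  then show ?thesis by (simp add: ell2_def head_lift_def)
qed

lemma tail_lift_ell2:
  assumes "f \<in> ell2 (verts X)" shows "tail_lift f \<in> ell2 (arcs X)"
proof -
  have "(\<lambda>e. (cmod (head_lift f (rv e)))\<^sup>2) summable_on arcs X"
    using summable_on_reindex_bij_betw[OF bij_rv, of "\<lambda>e. (cmod (head_lift f e))\<^sup>2"]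
      ell2_summable[OF head_lift_ell2[OF assms]] by simp
  also have "?this \<longleftrightarrow> (\<lambda>e. (cmod (tail_lift f e))\<^sup>2) summable_on arcs X"
    by (intro summable_on_cong) (simp add: tail_lift_def head_lift_def rv_arcs head_rv norm_mult weight)
  finally show ?thesis by (simp add: ell2_def tail_lift_def)
qed

text \<open>Reindex by \<open>rv\<close>: it exchanges the end points, and the unimodular weight
  cancels against its conjugate.\<close>

lemma tail_lift_inner:
  "ell2_inner (arcs X) (tail_lift f) (tail_lift g) = ell2_inner (arcs X) (head_lift f) (head_lift g)"
proof -
  have "ell2_inner (arcs X) (head_lift f) (head_lift g)
      = (\<Sum>\<^sub>\<infinity>e\<in>arcs X. head_lift f (rv e) * cnj (head_lift g (rv e)))"
    unfolding ell2_inner_def by (rule infsum_reindex_bij_betw[OF bij_rv, symmetric])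
  also have "\<dots> = ell2_inner (arcs X) (tail_lift f) (tail_lift g)"
    unfolding ell2_inner_def
  proof (rule infsum_cong)
    fix e assume e: "e \<in> arcs X"
    have "\<sigma> e * f (tail X e) * (cnj (\<sigma> e) * cnj (g (tail X e))) = (\<sigma> e * cnj (\<sigma> e)) * (f (tail X e) * cnj (g (tail X e)))"
      by (simp only: mult_ac)
    then show "head_lift f (rv e) * cnj (head_lift g (rv e)) = tail_lift f e * cnj (tail_lift g e)"
      using e by (simp add: head_lift_def tail_lift_def rv_arcs head_rv weight_mult_cnj)
  qed
  finally show ?thesis ..
qed

lemma head_tail_lift_inner:
  "ell2_inner (arcs X) (head_lift f) (tail_lift g) = ell2_inner (arcs X) (tail_lift f) (head_lift g)"
proof -
  have "ell2_inner (arcs X) (head_lift f) (tail_lift g)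
      = (\<Sum>\<^sub>\<infinity>e\<in>arcs X. head_lift f (rv e) * cnj (tail_lift g (rv e)))"
    unfolding ell2_inner_def by (rule infsum_reindex_bij_betw[OF bij_rv, symmetric])
  also have "\<dots> = ell2_inner (arcs X) (tail_lift f) (head_lift g)"
    unfolding ell2_inner_def
    by (intro infsum_cong) (simp add: head_lift_def tail_lift_def rv_arcs head_rv tail_rv weight_cnj)
  finally show ?thesis .
qed

text \<open>At most \<open>D\<close> arcs end at a vertex, so Cauchy-Schwarz bounds the square of
  their sum by \<open>D\<close> times the sum of squares, which is summable because the arcs are
  merely grouped by head.\<close>

lemma dml_ell2:
  assumes f: "f \<in> ell2 (verts X)" shows "\<Delta> f \<in> ell2 (verts X)"
proof -
  have "(\<lambda>v. \<Sum>e\<in>in_arcs X v. (cmod (tail_lift f e))\<^sup>2) summable_on verts X"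
    by (rule arcs_fibre_summable[OF ell2_summable[OF tail_lift_ell2[OF f]]])
  then have "(\<lambda>v. 2 * (real D)\<^sup>2 * (cmod (f v))\<^sup>2 + 2 * real D * (\<Sum>e\<in>in_arcs X v. (cmod (tail_lift f e))\<^sup>2)) summable_on verts X"
    by (intro summable_on_add summable_on_cmult_right ell2_summable f)
  moreover have "(cmod (\<Delta> f v))\<^sup>2
      \<le> 2 * (real D)\<^sup>2 * (cmod (f v))\<^sup>2 + 2 * real D * (\<Sum>e\<in>in_arcs X v. (cmod (tail_lift f e))\<^sup>2)"
    if v: "v \<in> verts X" for v
  proof -
    define S where "S = (\<Sum>e\<in>in_arcs X v. cmod (tail_lift f e))"
    have S0: "0 \<le> S" unfolding S_def by (rule sum_nonneg) auto
    have tl: "\<sigma> e * f (tail X e) = tail_lift f e" if "e \<in> in_arcs X v" for e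
      using that by (simp add: tail_lift_def)
    have "cmod (\<Delta> f v) \<le> cmod (of_nat (in_degree X v) * f v) + cmod (\<Sum>e\<in>in_arcs X v. \<sigma> e * f (tail X e))"
      unfolding dml_eq[OF v] by (rule norm_triangle_ineq4)
    also have "\<dots> \<le> real D * cmod (f v) + S"
      unfolding S_def using degree(2)[OF v]
      by (intro add_mono norm_sum[THEN order_trans])
         (auto simp: norm_mult in_degree_def tl intro!: mult_right_mono)
    finally have "(cmod (\<Delta> f v))\<^sup>2 \<le> (real D * cmod (f v) + S)\<^sup>2"
      by (rule power_mono) simp
    also have "\<dots> \<le> 2 * (real D * cmod (f v))\<^sup>2 + 2 * S\<^sup>2"
      using sum_squares_bound[of "real D * cmod (f v)" S] by (simp add: power2_sum)
    also have "S\<^sup>2 \<le> (\<Sum>e\<in>in_arcs X v. (cmod (tail_lift f e))\<^sup>2) * real (card (in_arcs X v))"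
      unfolding S_def by (rule sum_squared_le_sum_of_squares)
    also have "\<dots> \<le> (\<Sum>e\<in>in_arcs X v. (cmod (tail_lift f e))\<^sup>2) * real D"
      using degree(2)[OF v] by (intro mult_left_mono sum_nonneg) auto
    finally show ?thesis by (simp add: power_mult_distrib mult_ac)
  qed
  ultimately have "(\<lambda>v. (cmod (\<Delta> f v))\<^sup>2) summable_on verts X"
    by (rule summable_on_comparison_test) auto
  then show ?thesis by (simp add: ell2_def dml_def)
qed

text \<open>Each unoriented edge is counted twice in the sum over arcs, whence the factor 2.\<close>

lemma dml_gradient_form:
  assumes f: "f \<in> ell2 (verts X)" and g: "g \<in> ell2 (verts X)"
  shows "2 * ell2_inner (verts X) (\<Delta> f) g
    = ell2_inner (arcs X) (\<lambda>e. head_lift f e - tail_lift f e) (\<lambda>e. head_lift g e - tail_lift g e)"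
proof -
  note l = head_lift_ell2[OF f] head_lift_ell2[OF g] tail_lift_ell2[OF f] tail_lift_ell2[OF g]
  have hh: "ell2_inner (arcs X) (head_lift f) (head_lift g)
      = (\<Sum>\<^sub>\<infinity>v\<in>verts X. of_nat (in_degree X v) * f v * cnj (g v))" (is "_ = infsum ?d _")
    and hs: "(\<lambda>v. of_nat (in_degree X v) * f v * cnj (g v)) summable_on verts X"
  proof -
    have eq: "(\<Sum>e\<in>in_arcs X v. head_lift f e * cnj (head_lift g e)) = of_nat (in_degree X v) * f v * cnj (g v)" for v
      by (simp add: head_lift_def in_degree_def)
    note F = ell2_inner_summable[OF l(1,2)]
    show "ell2_inner (arcs X) (head_lift f) (head_lift g) = infsum ?d (verts X)"
      unfolding ell2_inner_def arcs_infsum[OF F] eq ..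
    show "?d summable_on verts X" using arcs_fibre_summable[OF F] unfolding eq .
  qed
  have th: "ell2_inner (arcs X) (tail_lift f) (head_lift g)
      = (\<Sum>\<^sub>\<infinity>v\<in>verts X. (\<Sum>e\<in>in_arcs X v. \<sigma> e * f (tail X e)) * cnj (g v))" (is "_ = infsum ?k _")
    and ts: "(\<lambda>v. (\<Sum>e\<in>in_arcs X v. \<sigma> e * f (tail X e)) * cnj (g v)) summable_on verts X"
  proof -
    have eq: "(\<Sum>e\<in>in_arcs X v. tail_lift f e * cnj (head_lift g e)) = ?k v" for v
      unfolding sum_distrib_right by (intro sum.cong) (auto simp: head_lift_def tail_lift_def)
    note F = ell2_inner_summable[OF l(3,2)]
    show "ell2_inner (arcs X) (tail_lift f) (head_lift g) = infsum ?k (verts X)"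
      unfolding ell2_inner_def arcs_infsum[OF F] eq ..
    show "?k summable_on verts X" using arcs_fibre_summable[OF F] unfolding eq .
  qed
  have "ell2_inner (verts X) (\<Delta> f) g = (\<Sum>\<^sub>\<infinity>v\<in>verts X. ?d v + (-1) * ?k v)"
    unfolding ell2_inner_def by (intro infsum_cong) (simp add: dml_eq algebra_simps)
  also have "\<dots> = infsum ?d (verts X) + (-1) * infsum ?k (verts X)"
    by (simp only: infsum_add[OF hs summable_on_cmult_right[OF ts]] infsum_cmult_right')
  finally show ?thesis
    using l hh th
    by (simp add: ell2_inner_diff_left ell2_inner_diff_right ell2_diff head_tail_lift_inner tail_lift_inner)
qed

lemma head_lift_sq_le:
  assumes f: "f \<in> ell2 (verts X)" shows "ell2_sq (arcs X) (head_lift f) \<le> real D * ell2_sq (verts X) f"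
proof -
  have eq: "(\<Sum>e\<in>in_arcs X v. (cmod (head_lift f e))\<^sup>2) = real (in_degree X v) * (cmod (f v))\<^sup>2" for v
    by (simp add: head_lift_def in_degree_def)
  note F = ell2_summable[OF head_lift_ell2[OF f]]
  have "ell2_sq (arcs X) (head_lift f) = (\<Sum>\<^sub>\<infinity>v\<in>verts X. real (in_degree X v) * (cmod (f v))\<^sup>2)"
    unfolding ell2_sq_eq arcs_infsum[OF F] eq ..
  also have "\<dots> \<le> (\<Sum>\<^sub>\<infinity>v\<in>verts X. real D * (cmod (f v))\<^sup>2)"
  proof (rule infsum_mono)
    show "(\<lambda>v. real (in_degree X v) * (cmod (f v))\<^sup>2) summable_on verts X"
      using arcs_fibre_summable[OF F] unfolding eq .
    show "(\<lambda>v. real D * (cmod (f v))\<^sup>2) summable_on verts X"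
      by (intro summable_on_cmult_right ell2_summable f)
    show "real (in_degree X v) * (cmod (f v))\<^sup>2 \<le> real D * (cmod (f v))\<^sup>2" if "v \<in> verts X" for v
      using degree(2)[OF that] by (intro mult_right_mono) (auto simp: in_degree_def)
  qed
  also have "\<dots> = real D * ell2_sq (verts X) f" by (simp add: ell2_sq_eq infsum_cmult_right')
  finally show ?thesis .
qed

text \<open>The summand 1 keeps the bound positive when there are no arcs.\<close>

lemma psd_operator_dml: "psd_operator (verts X) \<Delta> (2 * real D + 1)"
proof
  show "0 < 2 * real D + 1" by simp
  show "ell2_linear (verts X) \<Delta>"
    unfolding ell2_linear_def
  proof (intro conjI ballI allI dml_ell2)
    show "\<Delta> (\<lambda>v. f v + g v) = (\<lambda>v. \<Delta> f v + \<Delta> g v)" for f g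
      by (intro ext) (simp add: dml_def sum.distrib algebra_simps)
    show "\<Delta> (\<lambda>v. a * f v) = (\<lambda>v. a * \<Delta> f v)" for f a
      by (intro ext) (simp add: dml_def sum_distrib_left algebra_simps)
  qed
  fix f assume f: "f \<in> ell2 (verts X)"
  have fl: "head_lift f \<in> ell2 (arcs X)" "tail_lift f \<in> ell2 (arcs X)"
    using f by (auto intro: head_lift_ell2 tail_lift_ell2)
  show "ell2_inner (verts X) (\<Delta> f) g = ell2_inner (verts X) f (\<Delta> g)"
    if g: "g \<in> ell2 (verts X)" for g
  proof -
    have "2 * ell2_inner (verts X) (\<Delta> f) g = cnj (2 * ell2_inner (verts X) (\<Delta> g) f)"
      unfolding dml_gradient_form[OF f g] dml_gradient_form[OF g f] by (rule ell2_inner_cnj)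
    then show ?thesis by (simp add: ell2_inner_cnj[of "verts X" f "\<Delta> g"])
  qed
  have form: "2 * Re (ell2_inner (verts X) (\<Delta> f) f)
      = ell2_sq (arcs X) (\<lambda>e. head_lift f e - tail_lift f e)"
    using arg_cong[OF dml_gradient_form[OF f f], of Re] by (simp add: ell2_sq_def)
  show "0 \<le> Re (ell2_inner (verts X) (\<Delta> f) f)"
    using form ell2_sq_nonneg[of "arcs X" "\<lambda>e. head_lift f e - tail_lift f e"] by linarith
  \<comment> \<open>Parallelogram law: the squared norm of the gradient is at most four times that
    of \<open>head_lift f\<close>, hence at most 4 D times that of \<open>f\<close>; the factor 2 in
    \<open>form\<close> leaves 2 D.\<close>
  have "ell2_sq (arcs X) (\<lambda>e. head_lift f e - tail_lift f e) + ell2_sq (arcs X) (\<lambda>e. head_lift f e + tail_lift f e)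
      = 2 * ell2_sq (arcs X) (head_lift f) + 2 * ell2_sq (arcs X) (tail_lift f)"
    using fl unfolding ell2_sq_def
    by (simp add: ell2_inner_diff_left ell2_inner_diff_right ell2_diff ell2_inner_add_left ell2_inner_add_right ell2_add)
  moreover have "ell2_sq (arcs X) (tail_lift f) = ell2_sq (arcs X) (head_lift f)"
    by (simp add: ell2_sq_def tail_lift_inner)
  ultimately have "2 * Re (ell2_inner (verts X) (\<Delta> f) f) \<le> 4 * (real D * ell2_sq (verts X) f)"
    using form head_lift_sq_le[OF f] ell2_sq_nonneg[of "arcs X" "\<lambda>e. head_lift f e + tail_lift f e"] by linarith
  then show "Re (ell2_inner (verts X) (\<Delta> f) f) \<le> (2 * real D + 1) * ell2_sq (verts X) f"
    using ell2_sq_nonneg[of "verts X" f] by (simp only: distrib_right mult_1 mult.assoc)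
qed

end

section \<open>Finite propagation and regular exhaustions\<close>

lemma (in group) generate_words:
  assumes S: "S \<subseteq> carrier G" and g: "g \<in> generate G S"
  shows "\<exists>ws. set ws \<subseteq> S \<union> (\<lambda>s. inv s) ` S \<and> foldr (\<lambda>x y. x \<otimes> y) ws \<one> = g"
  using g
proof (induction g)
  case one
  show ?case by (rule exI[of _ "[]"]) simp
next
  case (incl h)
  then show ?case using S by (intro exI[of _ "[h]"]) auto
next
  case (inv h)
  then show ?case using S by (intro exI[of _ "[inv h]"]) auto
next
  case (eng h1 h2)
  obtain us vs where us: "set us \<subseteq> S \<union> (\<lambda>s. inv s) ` S" "foldr (\<lambda>x y. x \<otimes> y) us \<one> = h1"
    and vs: "set vs \<subseteq> S \<union> (\<lambda>s. inv s) ` S" "foldr (\<lambda>x y. x \<otimes> y) vs \<one> = h2"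
    using eng.IH by blast
  have h2: "h2 \<in> carrier G" using generate_in_carrier[OF S] eng by blast
  have "foldr (\<lambda>x y. x \<otimes> y) us h2 = foldr (\<lambda>x y. x \<otimes> y) us \<one> \<otimes> h2 \<and> foldr (\<lambda>x y. x \<otimes> y) us \<one> \<in> carrier G"
    using us(1) h2 S by (induction us) (auto simp: m_assoc)
  then have "foldr (\<lambda>x y. x \<otimes> y) (us @ vs) \<one> = h1 \<otimes> h2"
    using us vs by simp
  then show ?case using us vs by (intro exI[of _ "us @ vs"]) auto
qed

text \<open>\<open>word_length\<close> is a \<open>LEAST\<close>, so a bound on it produces a short
  word only because \<open>generate_words\<close> shows that some word exists.\<close>

lemma (in group) finite_word_ball:
  assumes S: "finite S" "S \<subseteq> carrier G" "generate G S = carrier G"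
  shows "finite {g \<in> carrier G. word_length G S g \<le> n}"
proof (rule finite_subset)
  let ?S = "S \<union> (\<lambda>s. inv s) ` S"
  show "finite ((\<lambda>ws. foldr (\<lambda>x y. x \<otimes> y) ws \<one>) ` {ws. set ws \<subseteq> ?S \<and> length ws \<le> n})"
    using S(1) by (intro finite_imageI finite_lists_length_le) auto
  show "{g \<in> carrier G. word_length G S g \<le> n} \<subseteq> (\<lambda>ws. foldr (\<lambda>x y. x \<otimes> y) ws \<one>) ` {ws. set ws \<subseteq> ?S \<and> length ws \<le> n}"
  proof clarify
    fix g assume g: "g \<in> carrier G" "word_length G S g \<le> n"
    have "\<exists>n ws. length ws = n \<and> set ws \<subseteq> ?S \<and> foldr (\<lambda>x y. x \<otimes> y) ws \<one> = g"
      using generate_words[OF S(2)] g S(3) by blast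
    from LeastI_ex[OF this] obtain ws where "length ws = word_length G S g" "set ws \<subseteq> ?S" "foldr (\<lambda>x y. x \<otimes> y) ws \<one> = g"
      unfolding word_length_def by blast
    then show "g \<in> (\<lambda>ws. foldr (\<lambda>x y. x \<otimes> y) ws \<one>) ` {ws. set ws \<subseteq> ?S \<and> length ws \<le> n}"
      using g by auto
  qed
qed

text \<open>
  Infinite sets have \<^const>\<open>card\<close> zero, so finiteness is needed to exploit the hypothesis on the boundaries.
\<close>

lemma (in group) finite_word_boundary:
  assumes S: "finite S" "S \<subseteq> carrier G" "generate G S = carrier G" and L: "finite L" "L \<subseteq> carrier G"
  shows "finite (word_boundary G S \<delta> L)"
proof (rule finite_subset)
  define n where "n = nat \<lceil>\<delta>\<rceil>"
  let ?B = "{g \<in> carrier G. word_length G S g \<le> n}"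
  show "finite ((\<lambda>(h, x). h \<otimes> inv x) ` (L \<times> ?B))"
    using finite_word_ball[OF S] L by auto
  show "word_boundary G S \<delta> L \<subseteq> (\<lambda>(h, x). h \<otimes> inv x) ` (L \<times> ?B)"
  proof
    fix g assume "g \<in> word_boundary G S \<delta> L"
    then have g: "g \<in> carrier G" and "word_setdist G S g L < ereal \<delta>"
      by (auto simp: word_boundary_def)
    then obtain h where h: "h \<in> L" "ereal (real (word_dist G S g h)) < ereal \<delta>"
      unfolding word_setdist_def by (auto simp: INF_less_iff)
    define x where "x = inv g \<otimes> h"
    have hc: "h \<in> carrier G" using h L by auto
    have "word_length G S x \<le> n" using h(2) by (simp add: word_dist_def x_def n_def) linarith
    moreover have "x \<in> carrier G" using g hc by (simp add: x_def)
    moreover have "g = h \<otimes> inv x" using g hc by (simp add: x_def inv_mult_group m_assoc[symmetric])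
    ultimately show "g \<in> (\<lambda>(h, x). h \<otimes> inv x) ` (L \<times> ?B)" using h(1) by force
  qed
qed

text \<open>By left-invariance g d has the same distance from g for every g, namely the length of d.
  So each g counted here lies in a boundary whose width depends on d alone, and \<open>C\<close> is
  finite.\<close>

lemma (in group) translate_leaves_ratio:
  assumes S: "finite S" "S \<subseteq> carrier G" "generate G S = carrier G"
    and \<Lambda>: "regular_exhaustion G S \<Lambda>" and C: "finite C" "C \<subseteq> carrier G"
  shows "(\<lambda>m. real (card {g \<in> \<Lambda> m. \<exists>d\<in>C. g \<otimes> d \<notin> \<Lambda> m}) / real (card (\<Lambda> m))) \<longlonglongrightarrow> 0"
proof -
  have fin: "finite (\<Lambda> m)" and car: "\<Lambda> m \<subseteq> carrier G" for m
    using \<Lambda> unfolding regular_exhaustion_def by blast+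
  \<comment> \<open>The first summand is the distance of g from itself, the second that of g from g
    d, and the 1 makes both inequalities strict.\<close>
  define \<delta> where "\<delta> d = real (word_length G S \<one>) + real (word_length G S d) + 1" for d
  have \<delta>: "\<delta> d > 0" for d by (simp add: \<delta>_def add_nonneg_pos)
  have sub: "{g \<in> \<Lambda> m. \<exists>d\<in>C. g \<otimes> d \<notin> \<Lambda> m} \<subseteq> (\<Union>d\<in>C. word_boundary G S (\<delta> d) (\<Lambda> m))" for m
  proof clarify
    fix g d assume g: "g \<in> \<Lambda> m" and d: "d \<in> C" "g \<otimes> d \<notin> \<Lambda> m"
    have gc: "g \<in> carrier G" and dc: "d \<in> carrier G" using g d car C by auto
    have "word_setdist G S g (\<Lambda> m) \<le> ereal (real (word_dist G S g g))"
      unfolding word_setdist_def by (rule INF_lower[OF g])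
    also have "word_dist G S g g = word_length G S \<one>" using gc by (simp add: word_dist_def)
    also have "ereal (real (word_length G S \<one>)) < ereal (\<delta> d)" by (simp add: \<delta>_def)
    finally have 1: "word_setdist G S g (\<Lambda> m) < ereal (\<delta> d)" .
    have gd: "g \<otimes> d \<in> carrier G - \<Lambda> m" using gc dc d by simp
    have "word_setdist G S g (carrier G - \<Lambda> m) \<le> ereal (real (word_dist G S g (g \<otimes> d)))"
      unfolding word_setdist_def by (rule INF_lower[OF gd])
    also have "word_dist G S g (g \<otimes> d) = word_length G S d"
      using gc dc by (simp add: word_dist_def m_assoc[symmetric])
    also have "ereal (real (word_length G S d)) < ereal (\<delta> d)" by (simp add: \<delta>_def)
    finally have "word_setdist G S g (carrier G - \<Lambda> m) < ereal (\<delta> d)" .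
    with 1 gc d show "g \<in> (\<Union>d\<in>C. word_boundary G S (\<delta> d) (\<Lambda> m))"
      by (auto simp: word_boundary_def)
  qed
  have "(\<lambda>m. \<Sum>d\<in>C. real (card (word_boundary G S (\<delta> d) (\<Lambda> m))) / real (card (\<Lambda> m))) \<longlonglongrightarrow> (\<Sum>d\<in>C. 0)"
    using \<Lambda> \<delta> unfolding regular_exhaustion_def by (intro tendsto_sum) blast
  then have lim: "(\<lambda>m. \<Sum>d\<in>C. real (card (word_boundary G S (\<delta> d) (\<Lambda> m))) / real (card (\<Lambda> m))) \<longlonglongrightarrow> 0" by simp
  show ?thesis
  proof (rule Lim_null_comparison[OF _ lim], rule always_eventually, rule allI)
    fix m
    have "card {g \<in> \<Lambda> m. \<exists>d\<in>C. g \<otimes> d \<notin> \<Lambda> m} \<le> card (\<Union>d\<in>C. word_boundary G S (\<delta> d) (\<Lambda> m))"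
      using C finite_word_boundary[OF S fin car] by (intro card_mono sub) auto
    also have "\<dots> \<le> (\<Sum>d\<in>C. card (word_boundary G S (\<delta> d) (\<Lambda> m)))"
      by (rule card_UN_le[OF C(1)])
    finally have "real (card {g \<in> \<Lambda> m. \<exists>d\<in>C. g \<otimes> d \<notin> \<Lambda> m}) \<le> (\<Sum>d\<in>C. real (card (word_boundary G S (\<delta> d) (\<Lambda> m))))"
      unfolding of_nat_sum[symmetric] of_nat_le_iff .
    then show "norm (real (card {g \<in> \<Lambda> m. \<exists>d\<in>C. g \<otimes> d \<notin> \<Lambda> m}) / real (card (\<Lambda> m)))
      \<le> (\<Sum>d\<in>C. real (card (word_boundary G S (\<delta> d) (\<Lambda> m))) / real (card (\<Lambda> m)))"
      by (simp add: sum_divide_distrib[symmetric] divide_right_mono)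
  qed
qed

lemma dml_scale: "dml X Ep \<sigma> (\<lambda>v. a * f v) = (\<lambda>v. a * dml X Ep \<sigma> f v)"
  by (intro ext) (simp add: dml_def sum_distrib_left algebra_simps)

lemma dml_outside: "v \<notin> verts X \<Longrightarrow> dml X Ep \<sigma> f v = 0"
  by (simp add: dml_def)

section \<open>Graphs with a free action and a weakly invariant weight\<close>

locale magnetic_action = group G
  for G :: "('g, 'm) monoid_scheme" (structure) +
  fixes X :: "('v, 'e) pre_digraph" and rv :: "'e \<Rightarrow> 'e" and Ep :: "'e set"
    and \<phi> :: "'g \<Rightarrow> 'v \<Rightarrow> 'v" and \<psi> :: "'g \<Rightarrow> 'e \<Rightarrow> 'e"
    and FV :: "'v set" and FE :: "'e set set" and \<sigma> :: "'e \<Rightarrow> complex"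
  assumes bidir: "bidirected_digraph X rv" and orient: "edge_orientation X rv Ep"
    and free: "free_graph_action G X rv \<phi> \<psi>" and finite_orbits: "finite (orbits G (arcs X) \<psi>)"
    and fund: "fundamental_domain G X rv \<phi> \<psi> FV FE"
    and wt: "weight_function X rv \<sigma>" and wi: "weakly_invariant G X \<psi> \<sigma>"
begin

lemma action_verts: "group_action G (verts X) \<phi>" and action_arcs: "group_action G (arcs X) \<psi>"
  using free by (auto simp: free_graph_action_def graph_action_def)

lemma act_verts: "g \<in> carrier G \<Longrightarrow> v \<in> verts X \<Longrightarrow> \<phi> g v \<in> verts X"
  using group_action.element_image[OF action_verts] by blast

lemma act_arcs: "g \<in> carrier G \<Longrightarrow> e \<in> arcs X \<Longrightarrow> \<psi> g e \<in> arcs X"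
  using group_action.element_image[OF action_arcs] by blast

lemma act_verts_mult: "g \<in> carrier G \<Longrightarrow> h \<in> carrier G \<Longrightarrow> v \<in> verts X \<Longrightarrow> \<phi> (g \<otimes> h) v = \<phi> g (\<phi> h v)"
  using group_action.composition_rule[OF action_verts] by blast

lemma act_arcs_mult: "g \<in> carrier G \<Longrightarrow> h \<in> carrier G \<Longrightarrow> e \<in> arcs X \<Longrightarrow> \<psi> (g \<otimes> h) e = \<psi> g (\<psi> h e)"
  using group_action.composition_rule[OF action_arcs] by blast

lemma act_verts_one: "v \<in> verts X \<Longrightarrow> \<phi> \<one> v = v"
  using group_action.id_eq_one[OF action_verts] by (metis restrict_apply')

lemma act_arcs_one: "e \<in> arcs X \<Longrightarrow> \<psi> \<one> e = e"
  using group_action.id_eq_one[OF action_arcs] by (metis restrict_apply')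

lemma tail_act: "g \<in> carrier G \<Longrightarrow> e \<in> arcs X \<Longrightarrow> tail X (\<psi> g e) = \<phi> g (tail X e)"
  and head_act: "g \<in> carrier G \<Longrightarrow> e \<in> arcs X \<Longrightarrow> head X (\<psi> g e) = \<phi> g (head X e)"
  and rv_act: "g \<in> carrier G \<Longrightarrow> e \<in> arcs X \<Longrightarrow> rv (\<psi> g e) = \<psi> g (rv e)"
  using free by (auto simp: free_graph_action_def graph_action_def)

lemma act_verts_inv: "g \<in> carrier G \<Longrightarrow> v \<in> verts X \<Longrightarrow> \<phi> (inv g) (\<phi> g v) = v"
  "g \<in> carrier G \<Longrightarrow> v \<in> verts X \<Longrightarrow> \<phi> g (\<phi> (inv g) v) = v"
  by (simp_all add: act_verts_mult[symmetric] act_verts_one)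

lemma act_arcs_inv: "g \<in> carrier G \<Longrightarrow> e \<in> arcs X \<Longrightarrow> \<psi> (inv g) (\<psi> g e) = e"
  "g \<in> carrier G \<Longrightarrow> e \<in> arcs X \<Longrightarrow> \<psi> g (\<psi> (inv g) e) = e"
  by (simp_all add: act_arcs_mult[symmetric] act_arcs_one)

lemma act_free:
  assumes "g \<in> carrier G" "h \<in> carrier G" "v \<in> verts X" "\<phi> g v = \<phi> h v" shows "g = h"
proof -
  have "\<phi> (inv h \<otimes> g) v = v" using assms act_verts_inv(1)[of h v] by (simp add: act_verts_mult)
  then have "inv h \<otimes> g = \<one>"
    using free assms by (auto simp: free_graph_action_def)
  then show ?thesis using assms by (metis inv_equality inv_inv inv_closed)
qed

lemma FV_sub: "FV \<subseteq> verts X" "finite FV"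
  using fund by (auto simp: fundamental_domain_def)

lemma vertex_translate:
  assumes v: "v \<in> verts X" shows "\<exists>g\<in>carrier G. \<exists>w\<in>FV. v = \<phi> g w"
proof -
  obtain w where w: "w \<in> FV" "w \<in> Group_Action.orbit G \<phi> v"
    using fund v by (auto simp: fundamental_domain_def)
  then obtain g where "g \<in> carrier G" "w = \<phi> g v" by (auto simp: orbit_def)
  then show ?thesis using w v act_verts_inv(1)[of g v] by (intro bexI[of _ "inv g"] bexI[of _ w]) auto
qed

text \<open>The fundamental domain fixes the vertex w, then freeness fixes g. Hence the vertices of
  a piece are parametrized by \<open>FV\<close> times the set of group elements, which is why
  division by the size of \<open>\<Lambda> m\<close> is the right normalization.\<close>

lemma vertex_translate_unique:
  assumes "g \<in> carrier G" "h \<in> carrier G" "w \<in> FV" "w' \<in> FV" "\<phi> g w = \<phi> h w'"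
  shows "g = h \<and> w = w'"
proof -
  have wV: "w \<in> verts X" "w' \<in> verts X" using assms FV_sub by auto
  have "w' = \<phi> (inv h \<otimes> g) w"
    using assms wV act_verts_inv(1)[of h w'] by (simp add: act_verts_mult)
  then have "w' \<in> Group_Action.orbit G \<phi> w" using assms unfolding orbit_def by blast
  moreover have "w \<in> Group_Action.orbit G \<phi> w"
    using group_action.orbit_refl[OF action_verts wV(1)] .
  ultimately have "w = w'"
    using fund wV assms unfolding fundamental_domain_def by blast
  then show ?thesis using act_free[of g h w] assms wV by simp
qed

lemma edge_translate:
  assumes e: "e \<in> arcs X" shows "\<exists>g\<in>carrier G. \<exists>u\<in>FE. u \<subseteq> arcs X \<and> {e, rv e} = \<psi> g ` u"
proof -
  interpret bidirected_digraph X rv by (rule bidir)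
  have "{e, rv e} \<in> unoriented_edges X rv" using e by (auto simp: unoriented_edges_def)
  then obtain u where u: "u \<in> FE" "u \<in> Group_Action.orbit G (\<lambda>g. (`) (\<psi> g)) {e, rv e}"
    using fund unfolding fundamental_domain_def by blast
  then obtain g where g: "g \<in> carrier G" "u = \<psi> g ` {e, rv e}" by (auto simp: orbit_def)
  then have eq: "{e, rv e} = \<psi> (inv g) ` u" using e act_arcs_inv(1)[of g] by simp
  have sub: "u \<subseteq> arcs X" using g e act_arcs by auto
  show ?thesis using sub eq u(1) inv_closed[OF g(1)] by blast
qed

lemma in_arcs_act:
  assumes g: "g \<in> carrier G" and u: "u \<in> verts X"
  shows "in_arcs X (\<phi> g u) = \<psi> g ` in_arcs X u" "inj_on (\<psi> g) (in_arcs X u)"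
proof -
  interpret bidirected_digraph X rv by (rule bidir)
  show "inj_on (\<psi> g) (in_arcs X u)"
    by (rule inj_on_inverseI[of _ "\<psi> (inv g)"]) (use act_arcs_inv g in auto)
  show "in_arcs X (\<phi> g u) = \<psi> g ` in_arcs X u"
  proof (intro equalityI subsetI)
    fix e assume e: "e \<in> in_arcs X (\<phi> g u)"
    then have "\<psi> (inv g) e \<in> in_arcs X u"
      using g u act_arcs act_verts_inv by (auto simp: head_act)
    then show "e \<in> \<psi> g ` in_arcs X u" using e g act_arcs_inv(2)[of g e] by (metis image_eqI in_in_arcs_conv)
  qed (use g act_arcs head_act in auto)
qed

text \<open>Bounds every valence: two arcs with the same head in one orbit differ by a group element
  fixing that head, which freeness makes the identity.\<close>

definition degree_bound :: nat where "degree_bound = card (orbits G (arcs X) \<psi>)"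

sublocale magnetic_graph X rv Ep \<sigma> degree_bound
proof
  interpret bidirected_digraph X rv by (rule bidir)
  fix e assume e: "e \<in> arcs X"
  show "rv e \<in> arcs X" "rv (rv e) = e" "tail X (rv e) = head X e" "head X e \<in> verts X"
    using e by auto
  show "cmod (\<sigma> e) = 1" "\<sigma> (rv e) = inverse (\<sigma> e)" using wt e by (auto simp: weight_function_def)
  have u: "{e, rv e} \<in> unoriented_edges X rv" using e by (auto simp: unoriented_edges_def)
  have "\<forall>u\<in>unoriented_edges X rv. \<exists>!e. e \<in> u \<and> e \<in> Ep"
    using orient unfolding edge_orientation_def by (rule conjunct2)
  from bspec[OF this u] have "\<exists>!x. x \<in> {e, rv e} \<and> x \<in> Ep" .
  then obtain x where x: "x \<in> {e, rv e}" "x \<in> Ep" "\<And>y. y \<in> {e, rv e} \<Longrightarrow> y \<in> Ep \<Longrightarrow> y = x"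
    by (elim ex1E) blast
  from x(1) have "x = e \<or> x = rv e" by simp
  then show "e \<in> Ep \<longleftrightarrow> rv e \<notin> Ep" using x(2) x(3)[of e] x(3)[of "rv e"] arev_neq[OF e] by auto
next
  show "Ep \<subseteq> arcs X" using orient by (auto simp: edge_orientation_def)
next
  interpret bidirected_digraph X rv by (rule bidir)
  fix v assume v: "v \<in> verts X"
  have inj: "inj_on (Group_Action.orbit G \<psi>) (in_arcs X v)"
  proof (rule inj_onI)
    fix e e' assume e: "e \<in> in_arcs X v" "e' \<in> in_arcs X v" "Group_Action.orbit G \<psi> e = Group_Action.orbit G \<psi> e'"
    then have "e' \<in> Group_Action.orbit G \<psi> e"
      using group_action.orbit_refl[OF action_arcs, of e'] by auto
    then obtain g where g: "g \<in> carrier G" "e' = \<psi> g e" by (auto simp: orbit_def)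
    have "\<phi> g v = \<phi> \<one> v" using e g head_act[of g e] v act_verts_one by auto
    then have "g = \<one>" using act_free[of g \<one> v] g v by simp
    then show "e = e'" using g e act_arcs_one by auto
  qed
  have sub: "Group_Action.orbit G \<psi> ` in_arcs X v \<subseteq> orbits G (arcs X) \<psi>" by (auto simp: orbits_def)
  show "finite (in_arcs X v)" using finite_subset[OF sub finite_orbits] inj by (rule finite_imageD)
  show "card (in_arcs X v) \<le> degree_bound"
    unfolding degree_bound_def by (rule card_inj_on_le[OF inj sub finite_orbits])
qed

text \<open>Covariance under a magnetic translation, stated pointwise: \<open>F\<close> is
  \<open>f\<close> moved by \<open>g\<close> and twisted by the phases \<open>s\<close>. The phase
  at the tail cancels against the conjugate in the weight, leaving the phase at the head.\<close>

lemma dml_translate: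
  assumes g: "g \<in> carrier G"
    and s: "\<And>v. v \<in> verts X \<Longrightarrow> cmod (s v) = 1"
      "\<And>e. e \<in> arcs X \<Longrightarrow> \<sigma> (\<psi> g e) = \<sigma> e * s (head X e) * cnj (s (tail X e))"
    and F: "\<And>u. u \<in> verts X \<Longrightarrow> F (\<phi> g u) = s u * f u" and u: "u \<in> verts X"
  shows "\<Delta> F (\<phi> g u) = s u * \<Delta> f u"
proof -
  have "\<sigma> (\<psi> g e) * F (tail X (\<psi> g e)) = s u * (\<sigma> e * f (tail X e))" if e: "e \<in> in_arcs X u" for e
  proof -
    have eX: "e \<in> arcs X" and h: "head X e = u" using e by auto
    have "cnj (s (tail X e)) * s (tail X e) = 1"
      using s(1)[OF tail_verts[OF eX]] complex_norm_square[of "s (tail X e)"] by (simp add: mult.commute)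
    then have "\<sigma> e * s u * cnj (s (tail X e)) * (s (tail X e) * f (tail X e)) = s u * (\<sigma> e * f (tail X e))"
      by (simp add: mult_ac)
    then show ?thesis using eX h g s(2)[OF eX] F[OF tail_verts[OF eX]] by (simp add: tail_act)
  qed
  then have "(\<Sum>e\<in>in_arcs X (\<phi> g u). \<sigma> e * F (tail X e)) = s u * (\<Sum>e\<in>in_arcs X u. \<sigma> e * f (tail X e))"
    unfolding in_arcs_act(1)[OF g u] sum_distrib_left
    by (simp add: sum.reindex[OF in_arcs_act(2)[OF g u]])
  moreover have "in_degree X (\<phi> g u) = in_degree X u"
    unfolding in_degree_def in_arcs_act(1)[OF g u] by (rule card_image[OF in_arcs_act(2)[OF g u]])
  ultimately show ?thesis
    using F[OF u] by (simp add: dml_eq[OF u] dml_eq[OF act_verts[OF g u]] algebra_simps)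
qed

text \<open>The magnetic translate of delta_w is s(w) times the delta function at the translated
  vertex, whence the factor \<open>s w\<close>. One \<open>s\<close> serves all k, and for u = w the
  phases cancel.\<close>

lemma dml_pow_translate:
  assumes g: "g \<in> carrier G" and w: "w \<in> verts X"
  shows "\<exists>s. (\<forall>v\<in>verts X. s v \<noteq> 0) \<and> (\<forall>k. \<forall>u\<in>verts X.
    s w * (\<Delta> ^^ k) (delta_fun (\<phi> g w)) (\<phi> g u) = s u * (\<Delta> ^^ k) (delta_fun w) u)"
proof -
  obtain s where s: "\<And>v. v \<in> verts X \<Longrightarrow> cmod (s v) = 1"
      "\<And>e. e \<in> arcs X \<Longrightarrow> \<sigma> (\<psi> g e) = \<sigma> e * s (head X e) * cnj (s (tail X e))"
    using wi g unfolding weakly_invariant_def by blast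
  have "s w * (\<Delta> ^^ k) (delta_fun (\<phi> g w)) (\<phi> g u) = s u * (\<Delta> ^^ k) (delta_fun w) u"
    if u: "u \<in> verts X" for k u
    using u
  proof (induction k arbitrary: u)
    case 0
    have "\<phi> g u = \<phi> g w \<longleftrightarrow> u = w" using act_verts_inv(1)[OF g] 0 w by metis
    then show ?case by (simp add: delta_fun_def)
  next
    case (Suc k)
    have "\<Delta> (\<lambda>v. s w * (\<Delta> ^^ k) (delta_fun (\<phi> g w)) v) (\<phi> g u)
      = s u * \<Delta> ((\<Delta> ^^ k) (delta_fun w)) u"
      by (rule dml_translate[OF g s Suc.IH Suc.prems])
    then show ?case unfolding dml_scale by simp
  qed
  then show ?thesis using s(1) by (intro exI[of _ s]) force
qed

lemma dml_pow_finite_support: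
  assumes w: "w \<in> verts X"
  shows "finite {v. (\<Delta> ^^ k) (delta_fun w) v \<noteq> 0} \<and> {v. (\<Delta> ^^ k) (delta_fun w) v \<noteq> 0} \<subseteq> verts X"
proof (induction k)
  case 0
  then show ?case using w by (auto simp: delta_fun_def)
next
  case (Suc k)
  define f where "f = (\<Delta> ^^ k) (delta_fun w)"
  let ?S = "{v. f v \<noteq> 0}"
  have S: "finite ?S" "?S \<subseteq> verts X" using Suc by (auto simp: f_def)
  have "{v. \<Delta> f v \<noteq> 0} \<subseteq> ?S \<union> tail X ` (\<Union>u\<in>?S. in_arcs X u)"
  proof (rule ccontr)
    assume "\<not> ?thesis"
    then obtain v where v: "\<Delta> f v \<noteq> 0" "f v = 0" "v \<notin> tail X ` (\<Union>u\<in>?S. in_arcs X u)" by auto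
    have vX: "v \<in> verts X" using v(1) by (auto simp: dml_def split: if_splits)
    have "f (tail X e) = 0" if e: "e \<in> in_arcs X v" for e
    proof (rule ccontr)
      assume nz: "f (tail X e) \<noteq> 0"
      have "rv e \<in> in_arcs X (tail X e)" "tail X (rv e) = v" using e by (auto simp: rv_arcs head_rv tail_rv)
      then show False using v(3) nz by (metis (mono_tags, lifting) UN_I image_eqI mem_Collect_eq)
    qed
    then have "\<Delta> f v = 0" using v(2) by (simp add: dml_eq[OF vX])
    then show False using v(1) by simp
  qed
  moreover have "finite (?S \<union> tail X ` (\<Union>u\<in>?S. in_arcs X u))"
    using S degree(1) by auto
  moreover have "{v. \<Delta> f v \<noteq> 0} \<subseteq> verts X" by (auto simp: dml_def split: if_splits)
  ultimately show ?case using finite_subset by (auto simp: f_def)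
qed

section \<open>Finite pieces and restricted operators\<close>

abbreviation piece :: "'g set \<Rightarrow> ('v, 'e) pre_digraph" where
  "piece L \<equiv> exhaustion_subgraph X rv \<phi> \<psi> FV FE L"

lemma piece_verts: "verts (piece L) = (\<Union>g\<in>L. \<phi> g ` FV)"
  and piece_arcs: "arcs (piece L) = {e \<in> arcs X. {e, rv e} \<in> (\<Union>g\<in>L. (\<lambda>u. \<psi> g ` u) ` FE) \<and>
     tail X e \<in> (\<Union>g\<in>L. \<phi> g ` FV) \<and> head X e \<in> (\<Union>g\<in>L. \<phi> g ` FV)}"
  and piece_simps [simp]: "tail (piece L) = tail X" "head (piece L) = head X"
  by (auto simp: exhaustion_subgraph_def Let_def)

lemma piece_verts_sub: "L \<subseteq> carrier G \<Longrightarrow> verts (piece L) \<subseteq> verts X"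
  using act_verts FV_sub by (auto simp: piece_verts)

lemma piece_verts_finite: "finite L \<Longrightarrow> finite (verts (piece L))"
  using FV_sub by (simp add: piece_verts)

lemma piece_rv: "e \<in> arcs (piece L) \<Longrightarrow> rv e \<in> arcs (piece L)"
  by (auto simp: piece_arcs rv_arcs rv_rv tail_rv head_rv insert_commute)

lemma piece_in_arcs: "in_arcs (piece L) v \<subseteq> in_arcs X v"
  by (auto simp: piece_arcs)

lemma magnetic_graph_piece:
  assumes L: "L \<subseteq> carrier G"
  shows "magnetic_graph (piece L) rv (Ep \<inter> arcs (piece L)) \<sigma> degree_bound"
proof
  fix e assume e: "e \<in> arcs (piece L)"
  then have eX: "e \<in> arcs X" by (simp add: piece_arcs)
  show "rv e \<in> arcs (piece L)" by (rule piece_rv[OF e])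
  show "rv (rv e) = e" "tail (piece L) (rv e) = head (piece L) e" "cmod (\<sigma> e) = 1" "\<sigma> (rv e) = inverse (\<sigma> e)"
    using eX by (auto simp: rv_rv tail_rv weight weight_rv)
  show "head (piece L) e \<in> verts (piece L)" using e by (auto simp: piece_arcs piece_verts)
  show "e \<in> Ep \<inter> arcs (piece L) \<longleftrightarrow> rv e \<notin> Ep \<inter> arcs (piece L)"
    using Ep(2)[OF eX] e piece_rv[OF e] by auto
next
  fix v assume "v \<in> verts (piece L)"
  then have v: "v \<in> verts X" using piece_verts_sub[OF L] by auto
  show "finite (in_arcs (piece L) v)" using piece_in_arcs degree(1)[OF v] by (rule finite_subset)
  have "card (in_arcs (piece L) v) \<le> card (in_arcs X v)" by (rule card_mono[OF degree(1)[OF v] piece_in_arcs])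
  then show "card (in_arcs (piece L) v) \<le> degree_bound" using degree(2)[OF v] by simp
qed auto

abbreviation restricted :: "boundary_condition \<Rightarrow> 'g set \<Rightarrow> ('v \<Rightarrow> complex) \<Rightarrow> 'v \<Rightarrow> complex" where
  "restricted bc L \<equiv> restricted_dml bc X Ep \<sigma> (piece L)"

text \<open>The constant depends neither on \<open>L\<close> nor on \<open>bc\<close>, which puts
  all spectral functionals on one compact interval.\<close>

lemma psd_operator_restricted:
  assumes L: "L \<subseteq> carrier G"
  shows "psd_operator (verts (piece L)) (restricted bc L) (2 * real degree_bound + 1)"
proof (cases bc)
  case Dirichlet
  then show ?thesis
    using psd_operator.psd_operator_compression[OF psd_operator_dml piece_verts_sub[OF L]]
    by (simp add: restricted_dml_def)
next
  case Neumann
  then show ?thesis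
    using magnetic_graph.psd_operator_dml[OF magnetic_graph_piece[OF L]]
    by (simp add: restricted_dml_def)
qed

text \<open>All arcs at the support of \<open>f\<close> lie in the piece, hence so do the
  neighbours, and the Dirichlet truncation loses nothing. In the Neumann case valences can differ
  only where \<open>f\<close> vanishes, and missing arcs start where \<open>f\<close>
  vanishes.\<close>

lemma restricted_eq_dml:
  assumes L: "L \<subseteq> carrier G"
    and supp: "\<And>v. f v \<noteq> 0 \<Longrightarrow> v \<in> verts (piece L) \<and> in_arcs X v \<subseteq> arcs (piece L)"
  shows "restricted bc L f = \<Delta> f"
proof -
  have edge: "e \<in> arcs (piece L)" if e: "e \<in> arcs X" "f (tail X e) \<noteq> 0" for e
  proof -
    have "rv e \<in> in_arcs X (tail X e)" using e by (auto simp: rv_arcs head_rv)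
    then have "rv e \<in> arcs (piece L)" using supp[OF e(2)] by auto
    then show ?thesis using piece_rv[of "rv e" L] e by (simp add: rv_rv)
  qed
  have outside: "\<Delta> f v = 0" if v: "v \<notin> verts (piece L)" for v
  proof (cases "v \<in> verts X")
    case True
    have "f v = 0" using supp[of v] v by auto
    moreover have "f (tail X e) = 0" if "e \<in> in_arcs X v" for e
      using edge[of e] that v by (auto simp: piece_arcs piece_verts)
    ultimately show ?thesis by (simp add: dml_eq[OF True])
  qed (rule dml_outside)
  show ?thesis
  proof (cases bc)
    case Dirichlet
    have "restrict_proj (verts (piece L)) f = f"
      unfolding restrict_proj_def using supp by (intro ext) (metis (full_types))
    then show ?thesis using Dirichlet outside by (auto simp: restricted_dml_def restrict_proj_def)
  next
    case Neumann
    have "dml (piece L) (Ep \<inter> arcs (piece L)) \<sigma> f v = \<Delta> f v" for v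
    proof (cases "v \<in> verts (piece L)")
      case True
      then have vX: "v \<in> verts X" using piece_verts_sub[OF L] by auto
      have deg: "of_nat (in_degree (piece L) v) * f v = of_nat (in_degree X v) * f v"
      proof (cases "f v = 0")
        case False
        then have "in_arcs (piece L) v = in_arcs X v" using supp[of v] piece_in_arcs by auto
        then show ?thesis by (simp add: in_degree_def)
      qed simp
      have "(\<Sum>e\<in>in_arcs (piece L) v. \<sigma> e * f (tail X e)) = (\<Sum>e\<in>in_arcs X v. \<sigma> e * f (tail X e))"
        using edge by (intro sum.mono_neutral_left degree(1) vX piece_in_arcs) auto
      then show ?thesis
        using deg by (simp add: magnetic_graph.dml_eq[OF magnetic_graph_piece[OF L] True] dml_eq[OF vX])
    qed (simp add: dml_outside outside)
    then show ?thesis using Neumann by (simp add: restricted_dml_def fun_eq_iff)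
  qed
qed

text \<open>Finite propagation: \<open>\<langle>\<Delta>\<^sup>k \<delta>\<^bsub>gw\<^esub>, \<delta>\<^bsub>gw\<^esub>\<rangle>\<close> only sees the graph near \<open>gw\<close>, so it is
  unaffected by the boundary as soon as \<open>g C \<subseteq> L\<close> for a finite \<open>C\<close>, and then translation
  covariance makes it independent of \<open>g\<close>.\<close>

lemma restricted_pow_local:
  assumes w: "w \<in> FV"
  shows "\<exists>C. finite C \<and> C \<subseteq> carrier G \<and> (\<forall>bc L g. L \<subseteq> carrier G \<longrightarrow> g \<in> L \<longrightarrow> (\<forall>d\<in>C. g \<otimes> d \<in> L) \<longrightarrow>
     (restricted bc L ^^ k) (delta_fun (\<phi> g w)) (\<phi> g w) = (\<Delta> ^^ k) (delta_fun w) w)"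
proof -
  have wX: "w \<in> verts X" using w FV_sub by auto
  define f where "f j = (\<Delta> ^^ j) (delta_fun w)" for j
  \<comment> \<open>Powers below k suffice: the k-th application of the operator only needs its
    argument to be supported in the interior.\<close>
  define Z where "Z = (\<Union>j<k. {v. f j v \<noteq> 0})"
  have Z: "finite Z" "Z \<subseteq> verts X" using dml_pow_finite_support[OF wX] by (auto simp: Z_def f_def)
  obtain gv where gv: "\<And>v. v \<in> verts X \<Longrightarrow> gv v \<in> carrier G \<and> (\<exists>w\<in>FV. v = \<phi> (gv v) w)"
    using vertex_translate by metis
  obtain ge where ge: "\<And>e. e \<in> arcs X \<Longrightarrow> ge e \<in> carrier G \<and> (\<exists>u\<in>FE. u \<subseteq> arcs X \<and> {e, rv e} = \<psi> (ge e) ` u)"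
    using edge_translate by metis
  \<comment> \<open>The group elements whose translates of the fundamental domain contain the
    vertices of Z, the arcs entering them and the tails of these arcs. If all g d with d in C belong
    to L, then g moves Z into the interior of the piece.\<close>
  define C where "C = gv ` Z \<union> (\<Union>u\<in>Z. ge ` in_arcs X u \<union> gv ` tail X ` in_arcs X u)"
  have finC: "finite C" using Z degree(1) by (auto simp: C_def)
  have carC: "C \<subseteq> carrier G" using Z gv ge tail_verts by (auto simp: C_def)
  have loc: "(restricted bc L ^^ k) (delta_fun (\<phi> g w)) (\<phi> g w) = (\<Delta> ^^ k) (delta_fun w) w"
    if L: "L \<subseteq> carrier G" and g: "g \<in> L" and C: "\<forall>d\<in>C. g \<otimes> d \<in> L" for bc L g
  proof -
    have gc: "g \<in> carrier G" using g L by auto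
    obtain s where s: "\<And>v. v \<in> verts X \<Longrightarrow> s v \<noteq> 0"
      "\<And>j u. u \<in> verts X \<Longrightarrow> s w * (\<Delta> ^^ j) (delta_fun (\<phi> g w)) (\<phi> g u) = s u * f j u"
      using dml_pow_translate[OF gc wX] unfolding f_def by blast
    have inV: "\<phi> g v \<in> verts (piece L)" if v: "v \<in> verts X" "g \<otimes> gv v \<in> L" for v
    proof -
      obtain w' where w': "w' \<in> FV" "v = \<phi> (gv v) w'" using gv[OF v(1)] by auto
      then have "\<phi> g v = \<phi> (g \<otimes> gv v) w'" using gv[OF v(1)] gc FV_sub by (metis act_verts_mult subsetD)
      then show ?thesis using v w' by (auto simp: piece_verts)
    qed
    have interior: "\<phi> g u \<in> verts (piece L) \<and> in_arcs X (\<phi> g u) \<subseteq> arcs (piece L)" if u: "u \<in> Z" for u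
    proof
      have uX: "u \<in> verts X" using u Z by auto
      show 1: "\<phi> g u \<in> verts (piece L)" using C u by (intro inV[OF uX]) (auto simp: C_def)
      show "in_arcs X (\<phi> g u) \<subseteq> arcs (piece L)"
        unfolding in_arcs_act(1)[OF gc uX]
      proof clarify
        fix e assume e: "e \<in> in_arcs X u"
        then have eX: "e \<in> arcs X" and he: "head X e = u" by auto
        obtain v where v: "v \<in> FE" "v \<subseteq> arcs X" "{e, rv e} = \<psi> (ge e) ` v" using ge[OF eX] by auto
        have "{\<psi> g e, rv (\<psi> g e)} = \<psi> g ` {e, rv e}" using gc eX by (simp add: rv_act)
        also have "\<dots> = \<psi> (g \<otimes> ge e) ` v"
          unfolding v(3) image_image using v(2) gc ge[OF eX] by (intro image_cong) (auto simp: act_arcs_mult)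
        finally have eq: "{\<psi> g e, rv (\<psi> g e)} = \<psi> (g \<otimes> ge e) ` v" .
        have "ge e \<in> C" unfolding C_def using u e by blast
        then have gL: "g \<otimes> ge e \<in> L" using C by blast
        have "{\<psi> g e, rv (\<psi> g e)} \<in> (\<Union>g\<in>L. (\<lambda>u. \<psi> g ` u) ` FE)"
          unfolding eq using v(1) by (intro UN_I[OF gL] imageI)
        moreover have "tail X (\<psi> g e) \<in> verts (piece L)"
        proof -
          have "gv (tail X e) \<in> C" unfolding C_def using u e by blast
          then show ?thesis unfolding tail_act[OF gc eX] using C by (intro inV tail_verts eX) blast
        qed
        moreover have "head X (\<psi> g e) \<in> verts (piece L)"
          unfolding head_act[OF gc eX] he by (rule 1)
        ultimately show "\<psi> g e \<in> arcs (piece L)"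
          using act_arcs[OF gc eX] by (simp add: piece_arcs piece_verts)
      qed
    qed
    \<comment> \<open>Translation covariance places the supports of the earlier powers inside g Z,
      so at each step the restricted operator acts as \<open>\<Delta>\<close>.\<close>
    have "(restricted bc L ^^ j) (delta_fun (\<phi> g w)) = (\<Delta> ^^ j) (delta_fun (\<phi> g w))" if "j \<le> k" for j
      using that
    proof (induction j)
      case (Suc j)
      define F where "F = (\<Delta> ^^ j) (delta_fun (\<phi> g w))"
      have "restricted bc L F = \<Delta> F"
      proof (rule restricted_eq_dml[OF L])
        fix x assume x: "F x \<noteq> 0"
        have xX: "x \<in> verts X" using dml_pow_finite_support[OF act_verts[OF gc wX], of j] x by (auto simp: F_def)
        define u where "u = \<phi> (inv g) x"
        have u: "u \<in> verts X" "x = \<phi> g u" using xX gc act_verts_inv(2) by (auto simp: u_def act_verts)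
        have "f j u \<noteq> 0" using s(2)[OF u(1), of j] s(1)[OF u(1)] s(1)[OF wX] x u(2) by (auto simp: F_def)
        then have "u \<in> Z" using Suc.prems by (auto simp: Z_def)
        then show "x \<in> verts (piece L) \<and> in_arcs X x \<subseteq> arcs (piece L)" using interior u(2) by simp
      qed
      then show ?case using Suc by (simp add: F_def)
    qed simp
    then show ?thesis using s(1)[OF wX] s(2)[OF wX, of k] by (simp add: f_def)
  qed
  show ?thesis
    by (intro exI[of _ C] conjI allI impI finC carC) (rule loc)
qed

section \<open>Averaged spectral functionals and their limit\<close>

abbreviation vertex_functional :: "'v \<Rightarrow> (real \<Rightarrow> real) \<Rightarrow> real" where
  "vertex_functional v \<equiv> psd_operator.spectral_functional (verts X) \<Delta> (2 * real degree_bound + 1) (delta_fun v)"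

abbreviation piece_functional :: "boundary_condition \<Rightarrow> 'g set \<Rightarrow> 'v \<Rightarrow> (real \<Rightarrow> real) \<Rightarrow> real" where
  "piece_functional bc L v \<equiv> psd_operator.spectral_functional (verts (piece L)) (restricted bc L) (2 * real degree_bound + 1) (delta_fun v)"

lemma sum_piece_verts:
  assumes L: "L \<subseteq> carrier G"
  shows "(\<Sum>v\<in>verts (piece L). h v) = (\<Sum>w\<in>FV. \<Sum>g\<in>L. h (\<phi> g w))"
proof -
  have inj: "inj_on (\<lambda>(w, g). \<phi> g w) (FV \<times> L)"
    using vertex_translate_unique subsetD[OF L] by (intro inj_onI) (clarsimp, blast)
  have "verts (piece L) = (\<lambda>(w, g). \<phi> g w) ` (FV \<times> L)" by (auto simp: piece_verts)
  then have "(\<Sum>v\<in>verts (piece L). h v) = (\<Sum>(w, g)\<in>FV \<times> L. h (\<phi> g w))"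
    using sum.reindex[OF inj, of h] by (simp add: case_prod_unfold o_def)
  then show ?thesis by (simp add: sum.cartesian_product)
qed

text \<open>Support in [-c, c] and mass 1 give a bound uniform in the vertex, used where the moment
  feels the boundary.\<close>

lemma (in psd_operator) spectral_functional_delta_moment:
  assumes "v \<in> V"
  shows "spectral_functional (delta_fun v) (\<lambda>t. t ^ k) = Re ((A ^^ k) (delta_fun v) v)"
    and "\<bar>spectral_functional (delta_fun v) (\<lambda>t. t ^ k)\<bar> \<le> c ^ k"
proof -
  note d = ell2_delta[OF assms]
  show "spectral_functional (delta_fun v) (\<lambda>t. t ^ k) = Re ((A ^^ k) (delta_fun v) v)"
    using assms by (simp add: spectral_functional_moment moment_def ell2_inner_delta)
  have "\<bar>spectral_functional (delta_fun v) (\<lambda>t. t ^ k)\<bar> \<le> c ^ k * spectral_functional (delta_fun v) (\<lambda>t. 1)"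
  proof (rule positive_functional_abs[OF spectral_functional[OF d] spectral_functional_pos[OF d]])
    show "\<bar>x ^ k\<bar> \<le> c ^ k" if "x \<in> {-c..c}" for x
      using that by (simp only: power_abs) (intro power_mono, auto)
  qed simp
  also have "spectral_functional (delta_fun v) (\<lambda>t. 1) = 1"
    using spectral_functional_moment[OF d, of 0] assms by (simp add: moment_0)
  finally show "\<bar>spectral_functional (delta_fun v) (\<lambda>t. t ^ k)\<bar> \<le> c ^ k" by simp
qed

text \<open>For fixed w and k the finite set C of \<open>restricted_pow_local\<close> is the same
  for all m. A group element g with g C inside \<open>\<Lambda> m\<close> contributes the exact
  limit; every other one errs by at most 2 c^k, and their share tends to 0.\<close>

lemma average_moment_converges:
  assumes S: "finite S" "S \<subseteq> carrier G" "generate G S = carrier G"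
    and \<Lambda>: "regular_exhaustion G S \<Lambda>"
  shows "(\<lambda>m. (\<Sum>v\<in>verts (piece (\<Lambda> m)). piece_functional bc (\<Lambda> m) v (\<lambda>t. t ^ k)) / real (card (\<Lambda> m)))
    \<longlonglongrightarrow> (\<Sum>w\<in>FV. vertex_functional w (\<lambda>t. t ^ k))"
proof -
  define c where "c = 2 * real degree_bound + 1"
  define a where "a m v = piece_functional bc (\<Lambda> m) v (\<lambda>t. t ^ k)" for m v
  define b where "b w = vertex_functional w (\<lambda>t. t ^ k)" for w
  have fin: "finite (\<Lambda> m)" and ne: "\<Lambda> m \<noteq> {}" and car: "\<Lambda> m \<subseteq> carrier G" for m
    using \<Lambda> unfolding regular_exhaustion_def by blast+
  have N: "real (card (\<Lambda> m)) > 0" for m using fin ne by (simp add: card_gt_0_iff)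
  have av: "a m v = Re ((restricted bc (\<Lambda> m) ^^ k) (delta_fun v) v)" "\<bar>a m v\<bar> \<le> c ^ k"
    if "v \<in> verts (piece (\<Lambda> m))" for m v
    using psd_operator.spectral_functional_delta_moment[OF psd_operator_restricted[OF car] that]
    unfolding a_def c_def by auto
  have bw: "b w = Re ((\<Delta> ^^ k) (delta_fun w) w)" "\<bar>b w\<bar> \<le> c ^ k" if "w \<in> FV" for w
    using psd_operator.spectral_functional_delta_moment[OF psd_operator_dml] that FV_sub
    unfolding b_def c_def by auto
  have lim: "(\<lambda>m. (\<Sum>g\<in>\<Lambda> m. a m (\<phi> g w)) / real (card (\<Lambda> m))) \<longlonglongrightarrow> b w" if w: "w \<in> FV" for w
  proof -
    obtain C where C: "finite C" "C \<subseteq> carrier G"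
      "\<And>bc L g. L \<subseteq> carrier G \<Longrightarrow> g \<in> L \<Longrightarrow> (\<forall>d\<in>C. g \<otimes> d \<in> L) \<Longrightarrow>
         (restricted bc L ^^ k) (delta_fun (\<phi> g w)) (\<phi> g w) = (\<Delta> ^^ k) (delta_fun w) w"
      using restricted_pow_local[OF w, of k] by blast
    define B where "B m = {g \<in> \<Lambda> m. \<exists>d\<in>C. g \<otimes> d \<notin> \<Lambda> m}" for m
    have "(\<lambda>m. 2 * c ^ k * (real (card (B m)) / real (card (\<Lambda> m)))) \<longlonglongrightarrow> 2 * c ^ k * 0"
      unfolding B_def by (intro tendsto_intros translate_leaves_ratio[OF S \<Lambda> C(1,2)])
    then have B0: "(\<lambda>m. 2 * c ^ k * (real (card (B m)) / real (card (\<Lambda> m)))) \<longlonglongrightarrow> 0" by simp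
    show ?thesis
    proof (rule LIM_zero_cancel, rule Lim_null_comparison[OF _ B0], rule always_eventually, rule allI)
      fix m
      have gw: "\<phi> g w \<in> verts (piece (\<Lambda> m))" if "g \<in> \<Lambda> m" for g
        using that w by (auto simp: piece_verts)
      have "(\<Sum>g\<in>\<Lambda> m. a m (\<phi> g w)) / real (card (\<Lambda> m)) - b w = (\<Sum>g\<in>\<Lambda> m. a m (\<phi> g w) - b w) / real (card (\<Lambda> m))"
        using N[of m] by (simp add: sum_subtractf field_simps)
      also have "(\<Sum>g\<in>\<Lambda> m. a m (\<phi> g w) - b w) = (\<Sum>g\<in>B m. a m (\<phi> g w) - b w)"
      proof (rule sum.mono_neutral_right[OF fin])
        show "\<forall>g\<in>\<Lambda> m - B m. a m (\<phi> g w) - b w = 0"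
          using av(1)[OF gw] bw(1)[OF w] C(3)[OF car] by (auto simp: B_def)
      qed (auto simp: B_def)
      finally have "norm ((\<Sum>g\<in>\<Lambda> m. a m (\<phi> g w)) / real (card (\<Lambda> m)) - b w)
          = \<bar>\<Sum>g\<in>B m. a m (\<phi> g w) - b w\<bar> / real (card (\<Lambda> m))"
        by (simp add: abs_divide)
      also have "\<bar>\<Sum>g\<in>B m. a m (\<phi> g w) - b w\<bar> \<le> (\<Sum>g\<in>B m. 2 * c ^ k)"
      proof (rule order_trans[OF sum_abs sum_mono])
        fix g assume "g \<in> B m"
        then have "\<bar>a m (\<phi> g w)\<bar> \<le> c ^ k" using av(2)[OF gw] by (simp add: B_def)
        then show "\<bar>a m (\<phi> g w) - b w\<bar> \<le> 2 * c ^ k" using bw(2)[OF w] by linarith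
      qed
      finally show "norm ((\<Sum>g\<in>\<Lambda> m. a m (\<phi> g w)) / real (card (\<Lambda> m)) - b w)
          \<le> 2 * c ^ k * (real (card (B m)) / real (card (\<Lambda> m)))"
        using N[of m] by (simp add: divide_right_mono field_simps)
    qed
  qed
  have "(\<lambda>m. \<Sum>w\<in>FV. (\<Sum>g\<in>\<Lambda> m. a m (\<phi> g w)) / real (card (\<Lambda> m))) \<longlonglongrightarrow> (\<Sum>w\<in>FV. b w)"
    by (intro tendsto_sum lim)
  then show ?thesis
    unfolding a_def b_def sum_piece_verts[OF car] sum_divide_distrib .
qed

theorem eigenvalue_count_converges:
  assumes S: "finite S" "S \<subseteq> carrier G" "generate G S = carrier G"
    and \<Lambda>: "regular_exhaustion G S \<Lambda>"
  defines "F \<equiv> spectral_density (verts X) FV \<Delta>"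
  shows "mono F"
    and "isCont F l \<Longrightarrow> (\<lambda>m. real (eigenvalue_count (verts (piece (\<Lambda> m))) (restricted bc (\<Lambda> m)) l) / real (card (\<Lambda> m)))
      \<longlonglongrightarrow> F l"
proof -
  define c where "c = 2 * real degree_bound + 1"
  interpret A: psd_operator "verts X" "\<Delta>" c unfolding c_def by (rule psd_operator_dml)
  have fin: "finite (\<Lambda> m)" and ne: "\<Lambda> m \<noteq> {}" and car: "\<Lambda> m \<subseteq> carrier G" for m
    using \<Lambda> unfolding regular_exhaustion_def by blast+
  interpret B: psd_operator "verts (piece (\<Lambda> m))" "restricted bc (\<Lambda> m)" c for m
    unfolding c_def by (rule psd_operator_restricted[OF car])
  define I where "I h = (\<Sum>w\<in>FV. vertex_functional w h)" for h
  define L where "L m h = (\<Sum>v\<in>verts (piece (\<Lambda> m)). piece_functional bc (\<Lambda> m) v h) / real (card (\<Lambda> m))" for m h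
  have d: "delta_fun w \<in> ell2 (verts X)" if "w \<in> FV" for w using that FV_sub by auto
  have I: "measure_functional c I" "positive_functional c I"
  proof -
    show "measure_functional c I"
      unfolding I_def c_def[symmetric] using FV_sub d by (intro mf_sum_functional A.spectral_functional) auto
    show "positive_functional c I"
      using A.spectral_functional_pos[OF d] unfolding I_def c_def[symmetric] positive_functional_def
      by (auto intro!: sum_nonneg)
  qed
  have Lm: "measure_functional c (L m)" "positive_functional c (L m)" for m
  proof -
    have eq: "L m = (\<lambda>h. (1 / real (card (\<Lambda> m))) *\<^sub>R (\<Sum>v\<in>verts (piece (\<Lambda> m)). piece_functional bc (\<Lambda> m) v h))"
      by (auto simp: L_def)
    show "measure_functional c (L m)"
      unfolding eq c_def[symmetric] using piece_verts_finite[OF fin]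
      by (intro mf_scaleR mf_sum_functional B.spectral_functional) auto
    show "positive_functional c (L m)"
      using B.spectral_functional_pos[OF ell2_delta] unfolding L_def c_def[symmetric] positive_functional_def
      by (auto intro!: sum_nonneg divide_nonneg_nonneg)
  qed
  have F: "F l = I (indicator {..l})" for l
  proof -
    have "ell2_inner (verts X) (spectral_projection (verts X) \<Delta> {..l} (delta_fun w)) (delta_fun w)
        = of_real (vertex_functional w (indicator {..l}))" if "w \<in> FV" for w
      unfolding c_def[symmetric]
      by (rule A.spectral_measure_form[OF A.spectral_projection_spectral_measure d[OF that]]) simp
    then show ?thesis by (simp add: F_def spectral_density_def vn_trace_def I_def)
  qed
  show "mono F"
    unfolding F by (intro monoI positive_functional_mono[OF I]) (auto simp: indicator_def)
  assume cont: "isCont F l"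
  have mom: "(\<lambda>m. L m (\<lambda>t. t ^ k)) \<longlonglongrightarrow> I (\<lambda>t. t ^ k)" for k
    unfolding L_def I_def by (rule average_moment_converges[OF S \<Lambda>])
  have "F = (\<lambda>l. I (indicator {..l}))" using F by auto
  then have "(\<lambda>m. L m (indicator {..l})) \<longlonglongrightarrow> F l"
    using moments_imp_distribution_convergence[OF Lm I mom, of l] cont by simp
  moreover have "L m (indicator {..l}) = real (eigenvalue_count (verts (piece (\<Lambda> m))) (restricted bc (\<Lambda> m)) l) / real (card (\<Lambda> m))" for m
    unfolding L_def c_def[symmetric] B.eigenvalue_count_eq[OF piece_verts_finite[OF fin]] ..
  ultimately show "(\<lambda>m. real (eigenvalue_count (verts (piece (\<Lambda> m))) (restricted bc (\<Lambda> m)) l) / real (card (\<Lambda> m))) \<longlonglongrightarrow> F l"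
    by simp
qed

end

theorem theorem0p2:
  fixes G :: "('g, 'm) monoid_scheme" and S :: "'g set" and \<Lambda> :: "nat \<Rightarrow> 'g set"
    and X :: "('v, 'e) pre_digraph" and rv :: "'e \<Rightarrow> 'e" and Ep :: "'e set"
    and \<phi> :: "'g \<Rightarrow> 'v \<Rightarrow> 'v" and \<psi> :: "'g \<Rightarrow> 'e \<Rightarrow> 'e"
    and FV :: "'v set" and FE :: "'e set set" and \<sigma> :: "'e \<Rightarrow> complex"
    and F :: "real \<Rightarrow> real" and N :: "nat \<Rightarrow> nat"
    and E :: "boundary_condition \<Rightarrow> nat \<Rightarrow> real \<Rightarrow> nat"
    and Xm :: "nat \<Rightarrow> ('v, 'e) pre_digraph"
  assumes "group G" and "finite S" and "S \<subseteq> carrier G" and "generate G S = carrier G"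
    and "amenable_group G"
    and "bidirected_digraph X rv" and "edge_orientation X rv Ep"
    and "free_graph_action G X rv \<phi> \<psi>"
    and "finite (orbits G (verts X) \<phi>)" and "finite (orbits G (arcs X) \<psi>)"
    and "fundamental_domain G X rv \<phi> \<psi> FV FE"
    and "weight_function X rv \<sigma>" and "weakly_invariant G X \<psi> \<sigma>"
    and "regular_exhaustion G S \<Lambda>"
    and Xm: "\<And>m. Xm m = exhaustion_subgraph X rv \<phi> \<psi> FV FE (\<Lambda> m)"
    and N: "\<And>m. N m = card (\<Lambda> m)"
    and E: "\<And>bc m l. E bc m l =
              eigenvalue_count (verts (Xm m)) (restricted_dml bc X Ep \<sigma> (Xm m)) l"
    and F: "\<And>l. F l = spectral_density (verts X) FV (dml X Ep \<sigma>) l"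
  shows "\<forall>bc. (\<forall>l. isCont F l \<longrightarrow> (\<lambda>m. real (E bc m l) / real (N m)) \<longlonglongrightarrow> F l) \<and>
              countable {l. \<not> ((\<lambda>m. real (E bc m l) / real (N m)) \<longlonglongrightarrow> F l)}"
proof -
  have action: "magnetic_action G X rv Ep \<phi> \<psi> FV FE \<sigma>"
    using assms(1,6,7,8,10,11,12,13) by (intro magnetic_action.intro magnetic_action_axioms.intro)
  note spectral = magnetic_action.eigenvalue_count_converges[OF action assms(2,3,4,14)]
  have F_eq: "F = spectral_density (verts X) FV (dml X Ep \<sigma>)" using F by (intro ext)
  have lim: "(\<lambda>m. real (E bc m l) / real (N m)) \<longlonglongrightarrow> F l" if "isCont F l" for bc l
    using spectral(2)[of l bc] that unfolding E N Xm F_eq by blast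
  have "countable {l. \<not> isCont F l}"
    using mono_ctble_discont spectral(1) unfolding F_eq by blast
  then have "countable {l. \<not> ((\<lambda>m. real (E bc m l) / real (N m)) \<longlonglongrightarrow> F l)}" for bc
    by (rule countable_subset[rotated]) (use lim in blast)
  with lim show ?thesis by blast
qed

end
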